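(* Let $m\ge 4$. The Markov operator $\mathcal{P}$ of the signed random heap process on the measurable space $(\Omega_H,\mathcal{F}_H)$ of generalized (possibly infinite) heaps with $m$ columns has a unique stationary probability distribution $\nu$. Moreover, if $(W_n)_{n\ge0}$ is the signed random heap process started from the empty heap, then its finite dimensional distributions converge to those of $\nu$ in total variation: for every positive integer $\ell$, the law of $T_\ell(W_n)$ converges in total variation distance to $\nu\circ T_\ell^{-1}$ as $n\to\infty$.
   Context: Finite heaps and dropping a piece. Columns are indexed by $\mathbb{Z}_m$. A piece is a triple (height, column, sign) with height in $\{1,2,\dots\}$, column in $\mathbb{Z}_m$, sign in $\{+,-\}$. Given a finite heap, let $h_j$ be the height of the highest piece in column $j$ and $s_j$ its sign, with $h_j=0$ if column $j$ is empty. Dropping a piece with sign $s$ in column $k$: if $h_k>\max\{h_{k-1},h_{k+1}\}$ and $s_k\ne s$, then the piece $(h_k,k,s_k)$ is removed and nothing is added (annihilation); otherwise the piece $(\max\{h_{k-1},h_k,h_{k+1}\}+1,k,s)$ is added. A finite heap is a finite set of pieces such that: (1) every piece at height $v>1$ in column $w$ has some piece at height $v-1$ in one of the columns $w-1,w,w+1$; (2) two pieces in the same column at consecutive heights have the same sign; (3) two pieces in adjacent columns never have the same height. In the signed random heap process, at each step $(k,s)$ is chosen uniformly from the $2m$ possibilities, independently of the past, and a piece with sign $s$ is dropped in column $k$. Roofs. A piece of a heap is removable if there is no piece at greater height in its own column or in the two adjacent columns. The roof (1st level roof) is the set of removable pieces. Removing the roof gives a new heap, whose roof is the 2nd level roof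 of the original heap, and so on. A finite heap is determined by the columns and signs of the pieces in its successive roofs. $T_k(W)$ denotes the configuration (columns and signs of the pieces) of the 1st through $k$-th level roofs of $W$, and $R_k$ is the finite set of possible such configurations. Generalized heaps. A generalized heap is specified by a sequence of roof configurations, one for each level $1,2,3,\dots$, such that for every $k$ the first $k$ of them are exactly the successive roofs of a finite heap; $T_k$ is defined on generalized heaps as the first $k$ roofs. Finite heaps are the generalized heaps with only finitely many nonempty roofs. $\Omega_H$ is the set of generalized heaps and $\mathcal{F}_H$ is the $\sigma$-field generated by the sets $T_k^{-1}(\phi)$, $\phi\in R_k$, $k\ge1$. Since the top $k$ roofs of a heap determine the top $k-1$ roofs after a piece is dropped, dropping a piece extends to generalized heaps: the result of dropping $(k,s)$ on $W$ is the generalized heap whose first $j$ roofs, for each $j$, are those obtained by dropping $(k,s)$ on the finite heap with roofs $T_{j+1}(W)$. $\mathcal{P}$ is the resulting Markov operator (with $(k,s)$ uniform), acting on probability measures on $(\Omega_H,\mathcal{F}_H)$. *)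

theory Defs
  imports "HOL-Probability.Probability"
begin

(* A column is a natural number below m, standing for an element of Z_m;
   the sign True is +, False is -. *)
type_synonym sign = bool
type_synonym piece = "nat \<times> nat \<times> sign"
type_synonym config = "(nat \<times> sign) set"

definition left_col :: "nat \<Rightarrow> nat \<Rightarrow> nat" where
  "left_col m w = (w + m - 1) mod m"

definition right_col :: "nat \<Rightarrow> nat \<Rightarrow> nat" where
  "right_col m w = (w + 1) mod m"


section \<open>Finite heaps\<close>

(* The clause on equal heights in one column is implicit in speaking of the sign
   of the highest piece of a column: a position carries at most one piece. *)
definition finite_heap :: "nat \<Rightarrow> piece set \<Rightarrow> bool" where
  "finite_heap m V \<longleftrightarrow>
     finite V \<and>
     (\<forall>(v, w, s)\<in>V. 1 \<le> v \<and> w < m) \<and>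
     (\<forall>v w s s'. (v, w, s) \<in> V \<longrightarrow> (v, w, s') \<in> V \<longrightarrow> s = s') \<and>
     (\<forall>(v, w, s)\<in>V. 1 < v \<longrightarrow>
        (\<exists>w'\<in>{left_col m w, w, right_col m w}. \<exists>s'. (v - 1, w', s') \<in> V)) \<and>
     (\<forall>v w s s'. (v, w, s) \<in> V \<longrightarrow> (v + 1, w, s') \<in> V \<longrightarrow> s = s') \<and>
     (\<forall>(v, w, s)\<in>V. \<forall>(v', w', s')\<in>V. w' \<in> {left_col m w, right_col m w} \<longrightarrow> v \<noteq> v')"

definition col_height :: "piece set \<Rightarrow> nat \<Rightarrow> nat" where
  "col_height V j = Max (insert 0 {v. \<exists>s. (v, j, s) \<in> V})"

(* Only meaningful if column j is nonempty. *)
definition top_sign :: "piece set \<Rightarrow> nat \<Rightarrow> sign" where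
  "top_sign V j = (THE s. (col_height V j, j, s) \<in> V)"

definition drop_piece :: "nat \<Rightarrow> nat \<times> sign \<Rightarrow> piece set \<Rightarrow> piece set" where
  "drop_piece m = (\<lambda>(k, s) V.
     let hl = col_height V (left_col m k);
         h = col_height V k;
         hr = col_height V (right_col m k)
     in if max hl hr < h \<and> top_sign V k \<noteq> s
        then V - {(h, k, top_sign V k)}
        else insert (max hl (max h hr) + 1, k, s) V)"


section \<open>Roofs\<close>

definition roof :: "nat \<Rightarrow> piece set \<Rightarrow> piece set" where
  "roof m V = {(v, w, s) \<in> V.
     \<not> (\<exists>(v', w', s')\<in>V. v < v' \<and> w' \<in> {left_col m w, w, right_col m w})}"

(* roof_seq m V i is the configuration of the roof of level i + 1. *)
definition roof_seq :: "nat \<Rightarrow> piece set \<Rightarrow> nat \<Rightarrow> config" where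
  "roof_seq m V i = snd ` roof m (((\<lambda>U. U - roof m U) ^^ i) V)"

(* T_k; on a finite heap V it is top_roofs k (roof_seq m V). *)
definition top_roofs :: "nat \<Rightarrow> (nat \<Rightarrow> config) \<Rightarrow> config list" where
  "top_roofs k W = map W [0..<k]"

(* R_k *)
definition roof_configs :: "nat \<Rightarrow> nat \<Rightarrow> config list set" where
  "roof_configs m k = {top_roofs k (roof_seq m V) | V. finite_heap m V}"

definition has_roofs :: "nat \<Rightarrow> piece set \<Rightarrow> config list \<Rightarrow> bool" where
  "has_roofs m V \<phi> \<longleftrightarrow> (\<forall>i. roof_seq m V i = (if i < length \<phi> then \<phi> ! i else {}))"

definition heap_with_roofs :: "nat \<Rightarrow> config list \<Rightarrow> piece set" where
  "heap_with_roofs m \<phi> = (THE V. finite_heap m V \<and> has_roofs m V \<phi>)"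


section \<open>Generalized heaps\<close>

definition gen_heaps :: "nat \<Rightarrow> (nat \<Rightarrow> config) set" where
  "gen_heaps m = {W. \<forall>k. \<exists>V. finite_heap m V \<and> has_roofs m V (top_roofs k W)}"

definition heap_space :: "nat \<Rightarrow> (nat \<Rightarrow> config) measure" where
  "heap_space m = sigma (gen_heaps m)
     {top_roofs k -` {\<phi>} \<inter> gen_heaps m | k \<phi>. 1 \<le> k \<and> \<phi> \<in> roof_configs m k}"

definition gen_drop :: "nat \<Rightarrow> nat \<times> sign \<Rightarrow> (nat \<Rightarrow> config) \<Rightarrow> (nat \<Rightarrow> config)" where
  "gen_drop m c W = (THE W'. W' \<in> gen_heaps m \<and>
     (\<forall>j. top_roofs j W' =
          top_roofs j (roof_seq m (drop_piece m c (heap_with_roofs m (top_roofs (j + 1) W))))))"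


section \<open>The signed random heap process\<close>

definition choice_measure :: "nat \<Rightarrow> (nat \<times> sign) measure" where
  "choice_measure m = uniform_count_measure ({..<m} \<times> UNIV)"

definition heap_kernel :: "nat \<Rightarrow> (nat \<Rightarrow> config) \<Rightarrow> (nat \<Rightarrow> config) measure" where
  "heap_kernel m W = distr (choice_measure m) (heap_space m) (\<lambda>c. gen_drop m c W)"

definition markov_op :: "nat \<Rightarrow> (nat \<Rightarrow> config) measure \<Rightarrow> (nat \<Rightarrow> config) measure" where
  "markov_op m \<mu> = \<mu> \<bind> heap_kernel m"

definition stationary :: "nat \<Rightarrow> (nat \<Rightarrow> config) measure \<Rightarrow> bool" where
  "stationary m \<nu> \<longleftrightarrow>
     prob_space \<nu> \<and> sets \<nu> = sets (heap_space m) \<and> markov_op m \<nu> = \<nu>"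

definition heap_process_from_empty :: "nat \<Rightarrow> 'a measure \<Rightarrow> (nat \<Rightarrow> 'a \<Rightarrow> piece set) \<Rightarrow> bool" where
  "heap_process_from_empty m Pr W \<longleftrightarrow>
     prob_space Pr \<and>
     (\<exists>C. prob_space.indep_vars Pr (\<lambda>_. choice_measure m) C UNIV \<and>
          (\<forall>n. distr Pr (choice_measure m) (C n) = choice_measure m) \<and>
          (\<forall>\<omega>\<in>space Pr. W 0 \<omega> = {} \<and> (\<forall>n. W (Suc n) \<omega> = drop_piece m (C n \<omega>) (W n \<omega>))))"

definition tv_dist :: "'b measure \<Rightarrow> 'b measure \<Rightarrow> real" where
  "tv_dist M N = (SUP A\<in>sets M. \<bar>measure M A - measure N A\<bar>)"

end

theory Submission
  imports Defs
begin

text \<open>A heap is an element of a right-angled Artin group, and the process multiplies on the side of the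
  roofs. The heart of the matter is that two copies of the process driven by the same drops, from
  arbitrary heaps, agree on their first \<open>l\<close> roofs after \<open>n\<close> drops except with probability at most
  \<open>C \<rho>\<^sup>n\<close>, uniformly in the initial heaps. Indeed, a bounded number of suitable drops puts the same
  long spiral staircase of pieces on top of both heaps without any cancellation, and as long as its
  last piece \<open>p\<close> is not removed, everything below the staircase is invisible in the first \<open>l\<close> roofs.
  The number of pieces above \<open>p\<close> grows at least three times as often as it shrinks, so \<open>p\<close> survives
  forever with probability bounded below, and a failure is noticed exponentially fast.

  Consequently the averages \<open>P\<^sup>n F\<close> of a function \<open>F\<close> of finitely many roofs converge uniformly to
  a constant. These constants define a content on the cylinder sets, which extends to a measure by
  compactness; invariance, uniqueness and convergence in total variation follow at once.\<close>

text \<open>Every drop is invertible, so two copies fed with the same drops never merge; only their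
  tops can come to agree. Agreement of the first \<open>l\<close> roofs at one time is not stable
  either: a cancellation lifts deeper roofs, where the copies may differ. The spiral is a
  certificate of agreement that persists. Its length \<open>m + l\<close> is chosen so that after
  \<open>l\<close> roofs are stripped there remain \<open>m\<close> steps, which occupy every column
  and so block all that lies beneath. The signs on the two initial roofs are arbitrary, so an
  arbitrary drop may cancel in one heap and not in the other; dropping next to a removable piece
  never cancels, and the construction of the spiral rests on this. Survival of \<open>p\<close> is
  measured by \<open>1/2\<close> to the power of the number of pieces above \<open>p\<close>, with
  \<open>p\<close> counted. This potential is 1 when \<open>p\<close> is missing, so the bound for a
  surviving spiral turns by itself into the bound for arbitrary heaps when \<open>p\<close> is lost,
  and no stopping times are needed. Infinite heaps have roofs but no heights. Hence drops are first
  rewritten as operations on roofs.\<close>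

locale columns =
  fixes m :: nat
  assumes two_columns: "2 \<le> m"
begin

section \<open>Adjacent columns, blocking pieces and the heap axioms\<close>

definition near :: "nat \<Rightarrow> nat \<Rightarrow> bool" where
  "near w w' \<longleftrightarrow> w' \<in> {left_col m w, w, right_col m w}"

text \<open>The piece \<open>y\<close> blocks \<open>x\<close>: it has to go before \<open>x\<close>
  can be removed. The relation is not transitive; the heap order is its closure, which
  \<open>above\<close> takes later.\<close>

definition below :: "piece \<Rightarrow> piece \<Rightarrow> bool" where
  "below x y \<longleftrightarrow> fst x < fst y \<and> near (fst (snd x)) (fst (snd y))"

lemma col_less: "left_col m w < m" "right_col m w < m"
  using two_columns by (auto simp: left_col_def right_col_def)

lemma left_col_eq: "w < m \<Longrightarrow> left_col m w = (if w = 0 then m - 1 else w - 1)"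
  using two_columns by (auto simp: left_col_def mod_if)

lemma right_col_eq: "w < m \<Longrightarrow> right_col m w = (if w = m - 1 then 0 else w + 1)"
  using two_columns by (auto simp: right_col_def)

lemma col_neq: "w < m \<Longrightarrow> left_col m w \<noteq> w" "w < m \<Longrightarrow> right_col m w \<noteq> w"
  using two_columns by (auto simp: left_col_eq right_col_eq)

lemma near_sym: "w < m \<Longrightarrow> w' < m \<Longrightarrow> near w w' \<longleftrightarrow> near w' w"
  by (auto simp: near_def left_col_eq right_col_eq split: if_splits)

lemma near_refl [simp]: "near w w"
  by (simp add: near_def)

lemma near_right: "near w (right_col m w)" and near_left: "near w (left_col m w)"
  by (auto simp: near_def)

lemma roof_iff: "x \<in> roof m V \<longleftrightarrow> x \<in> V \<and> (\<forall>y\<in>V. \<not> below x y)"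
  by (cases x) (auto simp: roof_def below_def near_def)

lemma roof_subset: "roof m V \<subseteq> V"
  by (auto simp: roof_iff)

text \<open>With \<open>near\<close> including the column itself, "one piece per position" and "no
  equal heights in adjacent columns" merge into the last clause. In this form the axioms can be
  compared clause by clause with properties of levels.\<close>

lemma finite_heap_iff:
  "finite_heap m V \<longleftrightarrow>
     finite V \<and>
     (\<forall>x\<in>V. 1 \<le> fst x \<and> fst (snd x) < m) \<and>
     (\<forall>x\<in>V. 1 < fst x \<longrightarrow> (\<exists>y\<in>V. fst y = fst x - 1 \<and> near (fst (snd x)) (fst (snd y)))) \<and>
     (\<forall>x\<in>V. \<forall>y\<in>V. fst y = Suc (fst x) \<longrightarrow> fst (snd x) = fst (snd y) \<longrightarrow> snd x = snd y) \<and>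
     (\<forall>x\<in>V. \<forall>y\<in>V. near (fst (snd x)) (fst (snd y)) \<longrightarrow> fst x = fst y \<longrightarrow> x = y)"
    (is "_ \<longleftrightarrow> ?F \<and> ?B \<and> ?S \<and> ?C \<and> ?N")
proof
  assume H: "finite_heap m V"
  have F: ?F and B: ?B using H unfolding finite_heap_def by auto
  have U: "\<And>v w s s'. (v, w, s) \<in> V \<Longrightarrow> (v, w, s') \<in> V \<Longrightarrow> s = s'"
    and A: "\<And>v w s v' w' s'. (v, w, s) \<in> V \<Longrightarrow> (v', w', s') \<in> V \<Longrightarrow>
      w' \<in> {left_col m w, right_col m w} \<Longrightarrow> v \<noteq> v'"
    and C: "\<And>v w s s'. (v, w, s) \<in> V \<Longrightarrow> (v + 1, w, s') \<in> V \<Longrightarrow> s = s'"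
    using H unfolding finite_heap_def by blast+
  have S: ?S
  proof (intro ballI impI)
    fix x assume x: "x \<in> V" "1 < fst x"
    obtain v w s where [simp]: "x = (v, w, s)" by (cases x)
    have "\<exists>w'\<in>{left_col m w, w, right_col m w}. \<exists>s'. (v - 1, w', s') \<in> V"
      using H x unfolding finite_heap_def by fastforce
    then show "\<exists>y\<in>V. fst y = fst x - 1 \<and> near (fst (snd x)) (fst (snd y))"
      by (force simp: near_def)
  qed
  have C': ?C
  proof (intro ballI impI)
    fix x y assume "x \<in> V" "y \<in> V" "fst y = Suc (fst x)" "fst (snd x) = fst (snd y)"
    then show "snd x = snd y"
      using C[of "fst x" "fst (snd x)" "snd (snd x)" "snd (snd y)"]
      by (cases x; cases y) auto
  qed
  have N: ?N
  proof (intro ballI impI)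
    fix x y assume xy: "x \<in> V" "y \<in> V" "near (fst (snd x)) (fst (snd y))" "fst x = fst y"
    then have "fst (snd x) = fst (snd y)"
      using A[of "fst x" "fst (snd x)" "snd (snd x)" "fst y" "fst (snd y)" "snd (snd y)"]
      unfolding near_def prod.collapse by (metis insert_iff)
    then show "x = y"
      using U[of "fst x" "fst (snd x)" "snd (snd x)" "snd (snd y)"] xy by (cases x; cases y) auto
  qed
  show "?F \<and> ?B \<and> ?S \<and> ?C \<and> ?N" using F B S C' N by blast
next
  assume H: "?F \<and> ?B \<and> ?S \<and> ?C \<and> ?N"
  then have N: ?N and B: ?B and S: ?S and C: ?C by blast+
  have 1: "s = s'" if "(v, w, s) \<in> V" "(v, w, s') \<in> V" for v w s s'
    using N[rule_format, OF that] by simp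
  have 2: "v \<noteq> v'" if "(v, w, s) \<in> V" "(v', w', s') \<in> V" "w' \<in> {left_col m w, right_col m w}"
    for v w s v' w' s'
  proof
    assume "v = v'"
    then have "w = w'"
      using N[rule_format, OF that(1,2)] that(3) by (auto simp: near_def)
    then show False using that B col_neq[of w] by fastforce
  qed
  have 3: "\<exists>w'\<in>{left_col m w, w, right_col m w}. \<exists>s'. (v - 1, w', s') \<in> V"
    if "(v, w, s) \<in> V" "1 < v" for v w s
    using S[rule_format, OF that(1)] that(2) unfolding near_def by force
  have 4: "s = s'" if "(v, w, s) \<in> V" "(v + 1, w, s') \<in> V" for v w s s'
    using C[rule_format, OF that] by simp
  show "finite_heap m V"
    unfolding finite_heap_def
  proof (intro conjI)
    show "\<forall>(v, w, s)\<in>V. 1 \<le> v \<and> w < m" using B by auto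
    show "\<forall>(v, w, s)\<in>V. \<forall>(v', w', s')\<in>V. w' \<in> {left_col m w, right_col m w} \<longrightarrow> v \<noteq> v'"
      using 2 by blast
    show "\<forall>(v, w, s)\<in>V. 1 < v \<longrightarrow>
        (\<exists>w'\<in>{left_col m w, w, right_col m w}. \<exists>s'. (v - 1, w', s') \<in> V)"
      using 3 by blast
  qed (use H 1 4 in blast)+
qed

lemma heap_finite: "finite_heap m V \<Longrightarrow> finite V"
  by (simp add: finite_heap_iff)

lemma heap_bounds: "finite_heap m V \<Longrightarrow> x \<in> V \<Longrightarrow> 1 \<le> fst x" "finite_heap m V \<Longrightarrow> x \<in> V \<Longrightarrow> fst (snd x) < m"
  by (auto simp: finite_heap_iff)

lemma heapI:
  assumes "finite V"
    and "\<And>x. x \<in> V \<Longrightarrow> 1 \<le> fst x"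
    and "\<And>x. x \<in> V \<Longrightarrow> fst (snd x) < m"
    and "\<And>x. x \<in> V \<Longrightarrow> 1 < fst x \<Longrightarrow> \<exists>y\<in>V. fst y = fst x - 1 \<and> near (fst (snd x)) (fst (snd y))"
    and "\<And>x y. x \<in> V \<Longrightarrow> y \<in> V \<Longrightarrow> fst y = Suc (fst x) \<Longrightarrow> fst (snd x) = fst (snd y) \<Longrightarrow> snd x = snd y"
    and "\<And>x y. x \<in> V \<Longrightarrow> y \<in> V \<Longrightarrow> near (fst (snd x)) (fst (snd y)) \<Longrightarrow> fst x = fst y \<Longrightarrow> x = y"
  shows "finite_heap m V"
  unfolding finite_heap_iff using assms by blast

lemma heap_support:
  assumes "finite_heap m V" "x \<in> V" "1 < fst x"
  obtains y where "y \<in> V" "fst y = fst x - 1" "near (fst (snd x)) (fst (snd y))"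
  using assms unfolding finite_heap_iff by blast

lemma heap_consecutive:
  "finite_heap m V \<Longrightarrow> x \<in> V \<Longrightarrow> y \<in> V \<Longrightarrow> fst y = Suc (fst x) \<Longrightarrow>
     fst (snd x) = fst (snd y) \<Longrightarrow> snd x = snd y"
  unfolding finite_heap_iff by blast

lemma heap_near_eq:
  "finite_heap m V \<Longrightarrow> x \<in> V \<Longrightarrow> y \<in> V \<Longrightarrow> near (fst (snd x)) (fst (snd y)) \<Longrightarrow>
     fst x = fst y \<Longrightarrow> x = y"
  unfolding finite_heap_iff by blast

lemma heap_empty [simp]: "finite_heap m {}"
  by (simp add: finite_heap_iff)

lemma heap_near_sym:
  "finite_heap m V \<Longrightarrow> x \<in> V \<Longrightarrow> y \<in> V \<Longrightarrow>
     near (fst (snd x)) (fst (snd y)) \<longleftrightarrow> near (fst (snd y)) (fst (snd x))"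
  by (rule near_sym) (erule (1) heap_bounds(2))+

text \<open>Distinct pieces in near columns have distinct heights, so one of them blocks the other.
  In the language of groups, letters that do not commute are ordered.\<close>

lemma heap_near_cases:
  assumes "finite_heap m V" "x \<in> V" "y \<in> V" "near (fst (snd x)) (fst (snd y))"
  shows "x = y \<or> below x y \<or> below y x"
proof -
  have "x = y" if "fst x = fst y"
    by (rule heap_near_eq[OF assms that])
  then show ?thesis
    using assms(4) heap_near_sym[OF assms(1-3)] unfolding below_def by linarith
qed

lemma roof_near_eq:
  assumes "finite_heap m V" "x \<in> roof m V" "y \<in> roof m V" "near (fst (snd x)) (fst (snd y))"
  shows "x = y"
  using heap_near_cases[OF assms(1), of x y] assms(2-4) unfolding roof_iff by metis

lemma roof_snd_inj: "finite_heap m V \<Longrightarrow> inj_on snd (roof m V)"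
  by (rule inj_onI, erule (2) roof_near_eq) simp

lemma roof_nonempty:
  assumes "finite V" "V \<noteq> {}"
  shows "roof m V \<noteq> {}"
proof -
  have "Max (fst ` V) \<in> fst ` V"
    using assms by (intro Max_in) auto
  then obtain x where x: "x \<in> V" "fst x = Max (fst ` V)" by auto
  then have "\<forall>y\<in>V. fst y \<le> fst x" using assms by auto
  then have "x \<in> roof m V" using x by (auto simp: roof_iff below_def leD)
  then show ?thesis by auto
qed

section \<open>Stripping roofs\<close>

abbreviation strip :: "piece set \<Rightarrow> piece set" where
  "strip V \<equiv> V - roof m V"

abbreviation deep :: "nat \<Rightarrow> piece set \<Rightarrow> piece set" where
  "deep i V \<equiv> ((\<lambda>U. U - roof m U) ^^ i) V"

text \<open>A piece that supports another one is blocked by it and hence is not in the roof, so no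
  support is lost.\<close>

lemma heap_remove:
  assumes "finite_heap m V" and R: "R \<subseteq> roof m V"
  shows "finite_heap m (V - R)"
proof (rule heapI)
  fix x assume x: "x \<in> V - R" "1 < fst x"
  then obtain y where y: "y \<in> V" "fst y = fst x - 1" "near (fst (snd x)) (fst (snd y))"
    using heap_support[OF assms(1), of x] by blast
  then have "below y x"
    using x heap_near_sym[OF assms(1), of x y] by (auto simp: below_def)
  then have "y \<notin> roof m V" using x by (auto simp: roof_iff)
  then show "\<exists>y\<in>V - R. fst y = fst x - 1 \<and> near (fst (snd x)) (fst (snd y))"
    using y R by blast
next
  fix x y assume xy: "x \<in> V - R" "y \<in> V - R"
  then have V: "x \<in> V" "y \<in> V" by auto
  show "snd x = snd y" if "fst y = Suc (fst x)" "fst (snd x) = fst (snd y)"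
    using heap_consecutive[OF assms(1) V that] .
  show "x = y" if "near (fst (snd x)) (fst (snd y))" "fst x = fst y"
    using heap_near_eq[OF assms(1) V that] .
qed (use heap_finite[OF assms(1)] heap_bounds[OF assms(1)] in auto)

lemma heap_deep: "finite_heap m V \<Longrightarrow> finite_heap m (deep i V)"
  by (induction i) (auto intro: heap_remove)

lemma deep_Suc: "deep (Suc i) V = strip (deep i V)"
  by simp

lemma deep_mono: "i \<le> j \<Longrightarrow> deep j V \<subseteq> deep i V"
  by (induction j) (auto simp: le_Suc_eq)

lemma deep_card: "finite V \<Longrightarrow> i \<le> card V \<Longrightarrow> finite (deep i V) \<and> card (deep i V) \<le> card V - i"
proof (induction i)
  case (Suc i)
  then have IH: "finite (deep i V)" "card (deep i V) \<le> card V - i" by auto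
  show ?case
  proof (cases "deep i V = {}")
    case False
    then have "card (strip (deep i V)) < card (deep i V)"
      using roof_nonempty[OF IH(1) False] roof_subset[of "deep i V"] IH(1)
      by (intro psubset_card_mono) auto
    then show ?thesis using IH by simp
  qed simp
qed simp

lemma deep_empty:
  assumes "finite V"
  shows "deep (card V) V = {}"
  using deep_card[OF assms order_refl] by auto

text \<open>Levels start at 0, like the index of \<open>roof_seq\<close>. For a piece of the heap
  this is the length of the longest chain of blockers upwards from it, just as its height is
  governed by the chains of supports downwards.\<close>

definition level :: "piece set \<Rightarrow> piece \<Rightarrow> nat" where
  "level V x = (LEAST i. x \<notin> deep (Suc i) V)"

lemma level_iff:
  assumes "finite V" "x \<in> V"
  shows "x \<in> roof m (deep i V) \<longleftrightarrow> level V x = i"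
proof -
  have ex: "\<exists>i. x \<notin> deep (Suc i) V"
    by (rule exI[of _ "card V"]) (simp add: deep_empty[OF assms(1)])
  have L: "x \<notin> deep (Suc (level V x)) V"
    unfolding level_def by (rule LeastI_ex[OF ex])
  have G: "x \<in> deep i V" if "i \<le> level V x" for i
  proof (cases i)
    case (Suc j)
    then have "j < (LEAST i. x \<notin> deep (Suc i) V)" using that unfolding level_def by simp
    from not_less_Least[OF this] show ?thesis unfolding Suc by blast
  qed (use assms in simp)
  have D: "x \<in> deep i V \<longleftrightarrow> i \<le> level V x" for i
  proof
    assume "x \<in> deep i V"
    moreover have "deep i V \<subseteq> deep (Suc (level V x)) V" if "\<not> i \<le> level V x"
      using that by (intro deep_mono) simp
    ultimately show "i \<le> level V x" using L by blast
  qed (rule G)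
  have "x \<in> roof m (deep i V) \<longleftrightarrow> x \<in> deep i V \<and> x \<notin> deep (Suc i) V"
    unfolding deep_Suc using roof_subset[of "deep i V"] by blast
  then show ?thesis using D[of i] D[of "Suc i"] by auto
qed

lemma mem_deep_iff:
  assumes "finite V"
  shows "x \<in> deep i V \<longleftrightarrow> x \<in> V \<and> i \<le> level V x"
proof (cases "x \<in> V")
  case True
  have "x \<in> deep i V \<longleftrightarrow> i \<le> level V x"
  proof (induction i)
    case (Suc i)
    have "x \<in> deep (Suc i) V \<longleftrightarrow> x \<in> deep i V \<and> x \<notin> roof m (deep i V)" by simp
    then show ?case unfolding Suc level_iff[OF assms True] by auto
  qed (use True in simp)
  then show ?thesis using True by simp
next
  case False
  then show ?thesis using deep_mono[of 0 i V] by auto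
qed

lemma level_below:
  assumes V: "finite_heap m V" and "x \<in> V" "y \<in> V" "below x y"
  shows "level V y < level V x"
proof (rule ccontr)
  note F = heap_finite[OF V]
  assume "\<not> ?thesis"
  then have "y \<in> deep (level V x) V" using mem_deep_iff[OF F] assms by simp
  moreover have "x \<in> roof m (deep (level V x) V)" using level_iff[OF F] assms by simp
  ultimately show False using assms(4) by (auto simp: roof_iff)
qed

text \<open>Near pieces are comparable, and blocking strictly lowers the level. So on near pieces
  the order of levels is the reverse of the order of heights, which is what turning the heap upside
  down relies on.\<close>

lemma level_below_iff:
  assumes V: "finite_heap m V" and "x \<in> V" "y \<in> V" "near (fst (snd x)) (fst (snd y))"
  shows "level V y < level V x \<longleftrightarrow> fst x < fst y"
proof -
  have "fst x < fst y \<Longrightarrow> below x y"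
    using assms(4) by (simp add: below_def)
  moreover have "x = y \<or> fst x < fst y \<or> below y x"
    using heap_near_cases[OF V assms(2-4)] by (auto simp: below_def)
  moreover have "below y x \<Longrightarrow> fst y < fst x" by (simp add: below_def)
  ultimately show ?thesis
    using level_below[OF V assms(2,3)] level_below[OF V assms(3,2)] by fastforce
qed

lemma level_near_eq:
  assumes V: "finite_heap m V" and "x \<in> V" "y \<in> V" "near (fst (snd x)) (fst (snd y))" "level V x = level V y"
  shows "x = y"
  using heap_near_cases[OF V assms(2-4)] level_below[OF V assms(2,3)] level_below[OF V assms(3,2)] assms(5)
  by auto

text \<open>The support axiom for levels: just before the last stripping that \<open>x\<close>
  survived, some piece still blocked it. That piece has level at least \<open>level V x - 1\<close>,
  and less than \<open>level V x\<close> because it blocks \<open>x\<close>.\<close>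

lemma level_support:
  assumes V: "finite_heap m V" and x: "x \<in> V" and "0 < level V x"
  obtains y where "y \<in> V" "below x y" "level V y = level V x - 1"
proof -
  note F = heap_finite[OF V]
  obtain i where i: "level V x = Suc i" using assms(3) not0_implies_Suc by auto
  have "x \<in> deep i V" using mem_deep_iff[OF F, of x i] x i by simp
  moreover have "x \<notin> roof m (deep i V)" using level_iff[OF F x, of i] i by simp
  ultimately obtain y where y: "y \<in> deep i V" "below x y" unfolding roof_iff by blast
  then have "y \<in> V" "i \<le> level V y" using mem_deep_iff[OF F, of y i] by simp_all
  moreover from this have "level V y < level V x" using level_below[OF V x _ y(2)] by simp
  ultimately show thesis using i by (intro that[OF _ y(2)]) simp_all
qed

section \<open>Turning a heap upside down\<close>

text \<open>Levels, counted from the top, obey the same axioms as heights. Hence the roof sequence of a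
  finite heap, read as a set of pieces whose heights are the levels, is again a finite heap, and
  doing this twice gives back the original heap.\<close>

definition stack :: "(nat \<Rightarrow> config) \<Rightarrow> piece set" where
  "stack W = {x. 1 \<le> fst x \<and> snd x \<in> W (fst x - 1)}"

definition star :: "piece set \<Rightarrow> piece \<Rightarrow> piece" where
  "star V x = (Suc (level V x), snd x)"

lemma stack_roof_seq:
  assumes "finite V"
  shows "stack (roof_seq m V) = star V ` V"
proof (intro set_eqI iffI)
  fix x assume "x \<in> stack (roof_seq m V)"
  then obtain y where y: "1 \<le> fst x" "snd x = snd y" "y \<in> roof m (deep (fst x - 1) V)"
    by (auto simp: stack_def roof_seq_def)
  then have "y \<in> V" using roof_subset deep_mono[of 0 "fst x - 1" V] by auto
  then have "level V y = fst x - 1" using y level_iff[OF assms] by simp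
  then have "star V y = x" unfolding star_def using y by (intro prod_eqI) auto
  then show "x \<in> star V ` V" using \<open>y \<in> V\<close> by blast
next
  fix x assume "x \<in> star V ` V"
  then obtain y where y: "y \<in> V" "x = star V y" by blast
  then have "snd x \<in> snd ` roof m (deep (level V y) V)"
    using level_iff[OF assms y(1)] by (simp add: star_def)
  then show "x \<in> stack (roof_seq m V)"
    using y by (simp add: stack_def roof_seq_def star_def)
qed

lemma star_inj:
  assumes "finite_heap m V"
  shows "inj_on (star V) V"
  using level_near_eq[OF assms] by (auto intro!: inj_onI simp: star_def)

lemma heap_star:
  assumes V: "finite_heap m V"
  shows "finite_heap m (star V ` V)"
proof -
  note F = heap_finite[OF V]
  have 1: "\<exists>y\<in>star V ` V. fst y = fst x - 1 \<and> near (fst (snd x)) (fst (snd y))"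
    if x: "x \<in> star V ` V" "1 < fst x" for x
  proof -
    obtain x' where x': "x' \<in> V" "x = star V x'" using x by auto
    then obtain y where "y \<in> V" "below x' y" "level V y = level V x' - 1"
      using level_support[OF V, of x'] x by (auto simp: star_def)
    then show ?thesis using x x' by (auto simp: star_def below_def intro!: bexI[of _ y])
  qed
  have 2: "snd x = snd y" if xy: "x \<in> V" "y \<in> V" "level V y = Suc (level V x)" "fst (snd x) = fst (snd y)" for x y
  proof -
    have lt: "fst y < fst x" using level_below_iff[OF V xy(2,1)] xy by simp
    show ?thesis
    proof (cases "fst x = Suc (fst y)")
      case True
      then show ?thesis using heap_consecutive[OF V xy(2,1)] xy by simp
    next
      case False
      then have "1 < fst x" using lt by simp
      \<comment> \<open>If the heights of \<open>y\<close> and \<open>x\<close> were not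
        consecutive, the support \<open>z\<close> of \<open>x\<close> would lie strictly between
        them in height, near both. Its level would then lie strictly between two consecutive
        numbers.\<close>
      then obtain z where z: "z \<in> V" "fst z = fst x - 1" "near (fst (snd x)) (fst (snd z))"
        using heap_support[OF V xy(1)] by blast
      then have "level V z < level V y"
        using level_below_iff[OF V xy(2) z(1)] xy lt False by simp
      moreover have "level V x < level V z"
        using level_below_iff[OF V z(1) xy(1)] heap_near_sym[OF V xy(1) z(1)] z \<open>1 < fst x\<close> by auto
      ultimately show ?thesis using xy by simp
    qed
  qed
  show ?thesis
  proof (rule heapI)
    fix x y assume xy: "x \<in> star V ` V" "y \<in> star V ` V"
    then obtain x' y' where *: "x' \<in> V" "y' \<in> V" "x = star V x'" "y = star V y'" by blast
    show "snd x = snd y" if "fst y = Suc (fst x)" "fst (snd x) = fst (snd y)"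
      using 2[of x' y'] * that by (simp add: star_def)
    show "x = y" if "near (fst (snd x)) (fst (snd y))" "fst x = fst y"
      using level_near_eq[OF V, of x' y'] * that by (simp add: star_def)
  next
    show "fst (snd x) < m" if "x \<in> star V ` V" for x
      using that heap_bounds(2)[OF V] unfolding star_def by force
  next
    show "1 \<le> fst x" if "x \<in> star V ` V" for x using that unfolding star_def by force
  qed (fact finite_imageI[OF F], fact 1)
qed

lemma below_star:
  assumes V: "finite_heap m V" and "x \<in> V" "y \<in> V"
  shows "below (star V x) (star V y) \<longleftrightarrow> fst y < fst x \<and> near (fst (snd x)) (fst (snd y))"
proof -
  have "below (star V x) (star V y) \<longleftrightarrow> level V x < level V y \<and> near (fst (snd x)) (fst (snd y))"
    by (simp add: below_def star_def)
  then show ?thesis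
    using level_below_iff[OF V assms(3,2)] heap_near_sym[OF assms] by metis
qed

text \<open>In the reversed heap the blockers of a piece are the lower near pieces of
  \<open>V\<close>. Once only heights above \<open>j\<close> are left, the support axiom provides a
  blocker for every piece except those at height \<open>j + 1\<close>, so the roofs of the reversed
  heap are the height layers of \<open>V\<close>.\<close>

lemma roof_star:
  assumes V: "finite_heap m V"
  shows "roof m (star V ` {x \<in> V. j < fst x}) = star V ` {x \<in> V. fst x = Suc j}"
proof -
  have *: "(\<forall>y\<in>V. j < fst y \<longrightarrow> \<not> below (star V x) (star V y)) \<longleftrightarrow> fst x = Suc j"
    if x: "x \<in> V" "j < fst x" for x
  proof
    assume L: "\<forall>y\<in>V. j < fst y \<longrightarrow> \<not> below (star V x) (star V y)"
    show "fst x = Suc j"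
    proof (rule ccontr)
      assume "fst x \<noteq> Suc j"
      then have "1 < fst x" using x by simp
      then obtain y where y: "y \<in> V" "fst y = fst x - 1" "near (fst (snd x)) (fst (snd y))"
        using heap_support[OF V x(1)] by blast
      then have "j < fst y" using x \<open>fst x \<noteq> Suc j\<close> by simp
      then show False using L y below_star[OF V x(1) y(1)] x(2) by simp
    qed
  next
    assume "fst x = Suc j"
    then show "\<forall>y\<in>V. j < fst y \<longrightarrow> \<not> below (star V x) (star V y)"
      using below_star[OF V x(1)] by simp
  qed
  then have "star V x \<in> roof m (star V ` {x \<in> V. j < fst x}) \<longleftrightarrow> fst x = Suc j"
    if "x \<in> V" "j < fst x" for x
    using *[OF that] that unfolding roof_iff by blast
  moreover have "z \<in> star V ` {x \<in> V. j < fst x}" if "z \<in> roof m (star V ` {x \<in> V. j < fst x})" for z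
    using that roof_subset by blast
  ultimately show ?thesis by (intro set_eqI iffI) force+
qed

lemma deep_star:
  assumes V: "finite_heap m V"
  shows "deep j (star V ` V) = star V ` {x \<in> V. j < fst x}"
proof (induction j)
  case 0
  have "{x \<in> V. 0 < fst x} = V" using heap_bounds(1)[OF V] by fastforce
  then show ?case by simp
next
  case (Suc j)
  have "star V ` {x \<in> V. j < fst x} - star V ` {x \<in> V. fst x = Suc j} =
      star V ` ({x \<in> V. j < fst x} - {x \<in> V. fst x = Suc j})"
    by (rule inj_on_image_set_diff[OF star_inj[OF V], symmetric]) auto
  also have "{x \<in> V. j < fst x} - {x \<in> V. fst x = Suc j} = {x \<in> V. Suc j < fst x}"
    by auto
  finally show ?case unfolding deep_Suc Suc roof_star[OF V] .
qed

lemma roof_seq_star: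
  assumes "finite_heap m V"
  shows "roof_seq m (star V ` V) j = {p. (Suc j, p) \<in> V}"
proof -
  have "roof_seq m (star V ` V) j = snd ` star V ` {x \<in> V. fst x = Suc j}"
    unfolding roof_seq_def deep_star[OF assms] roof_star[OF assms] ..
  also have "\<dots> = {p. (Suc j, p) \<in> V}"
    by (auto simp: star_def image_iff)
  finally show ?thesis .
qed

lemma heap_stack_roof_seq: "finite_heap m V \<Longrightarrow> finite_heap m (stack (roof_seq m V))"
  by (simp add: stack_roof_seq heap_finite heap_star)

lemma stack_stack:
  assumes "finite_heap m V"
  shows "stack (roof_seq m (stack (roof_seq m V))) = V"
proof -
  have "stack (roof_seq m (stack (roof_seq m V))) = {x. 1 \<le> fst x \<and> (Suc (fst x - 1), snd x) \<in> V}"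
    unfolding stack_roof_seq[OF heap_finite[OF assms]] stack_def[of "roof_seq m (star V ` V)"]
      roof_seq_star[OF assms] by simp
  also have "\<dots> = V" using heap_bounds(1)[OF assms] by force
  finally show ?thesis .
qed

text \<open>The source of heaps with prescribed roofs: as soon as the stacked configurations satisfy
  the heap axioms, reversing the stack gives a heap with exactly these roofs.\<close>

lemma roof_seq_stack:
  assumes "finite_heap m (stack W)"
  shows "roof_seq m (stack (roof_seq m (stack W))) = W"
  by (rule ext) (simp add: stack_roof_seq[OF heap_finite[OF assms]] roof_seq_star[OF assms], simp add: stack_def)

lemma roof_seq_inj: "finite_heap m V \<Longrightarrow> finite_heap m V' \<Longrightarrow> roof_seq m V = roof_seq m V' \<Longrightarrow> V = V'"
  by (metis stack_stack)

section \<open>Dropping a piece\<close>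

lemma col_height_ge: "finite V \<Longrightarrow> x \<in> V \<Longrightarrow> fst x \<le> col_height V (fst (snd x))"
proof -
  assume V: "finite V" "x \<in> V"
  have "{v. \<exists>s. (v, fst (snd x), s) \<in> V} \<subseteq> fst ` V" by force
  then have "finite {v. \<exists>s. (v, fst (snd x), s) \<in> V}" using V finite_subset by blast
  then show ?thesis unfolding col_height_def using V by (intro Max_ge) (auto intro: exI[of _ "snd (snd x)"])
qed

lemma col_height_attained:
  assumes "finite V" "0 < col_height V j"
  obtains x where "x \<in> V" "fst x = col_height V j" "fst (snd x) = j"
proof -
  have "{v. \<exists>s. (v, j, s) \<in> V} \<subseteq> fst ` V" by force
  then have "finite (insert 0 {v. \<exists>s. (v, j, s) \<in> V})" using assms finite_subset by blast
  then have "col_height V j \<in> insert 0 {v. \<exists>s. (v, j, s) \<in> V}"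
    unfolding col_height_def by (rule Max_in) simp
  then obtain s where "(col_height V j, j, s) \<in> V" using assms(2) by auto
  then show thesis using that[of "(col_height V j, j, s)"] by simp
qed

lemma top_sign_eq:
  assumes "finite_heap m V" "x \<in> V" "fst x = col_height V (fst (snd x))"
  shows "top_sign V (fst (snd x)) = snd (snd x)"
  unfolding top_sign_def
proof (rule the_equality)
  show "(col_height V (fst (snd x)), fst (snd x), snd (snd x)) \<in> V"
    using assms(2) unfolding assms(3)[symmetric] by simp
next
  fix s assume "(col_height V (fst (snd x)), fst (snd x), s) \<in> V"
  from heap_near_eq[OF assms(1) this assms(2)] assms(3) show "s = snd (snd x)"
    by (auto simp: prod_eq_iff)
qed

definition new_height :: "piece set \<Rightarrow> nat \<Rightarrow> nat" where
  "new_height V k = max (col_height V (left_col m k)) (max (col_height V k) (col_height V (right_col m k))) + 1"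

lemma new_height_greater:
  assumes "finite V" "x \<in> V" "near k (fst (snd x))"
  shows "fst x < new_height V k"
  using col_height_ge[OF assms(1,2)] assms(3) unfolding near_def new_height_def by auto

lemma new_height_attained:
  assumes "finite V" "1 < new_height V k"
  obtains x where "x \<in> V" "fst x = new_height V k - 1" "near k (fst (snd x))"
proof -
  have "\<exists>j. near k j \<and> new_height V k - 1 = col_height V j"
    unfolding new_height_def near_def by (auto simp: max_def)
  then obtain j where j: "near k j" "new_height V k - 1 = col_height V j" by blast
  then have "0 < col_height V j" using assms(2) by simp
  then obtain x where "x \<in> V" "fst x = col_height V j" "fst (snd x) = j"
    by (rule col_height_attained[OF assms(1)])
  then show thesis using j by (intro that[of x]) simp_all
qed

text \<open>The annihilation rule without heights. Near pieces never share a height, so the top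
  piece of a column strictly exceeds both neighbouring columns exactly when it is removable.\<close>

lemma cancel_iff:
  assumes V: "finite_heap m V" and k: "k < m"
  shows "max (col_height V (left_col m k)) (col_height V (right_col m k)) < col_height V k \<and> top_sign V k \<noteq> s
    \<longleftrightarrow> (\<exists>x\<in>roof m V. snd x = (k, \<not> s))" (is "?L \<longleftrightarrow> ?R")
    and "x \<in> roof m V \<Longrightarrow> snd x = (k, \<not> s) \<Longrightarrow> x = (col_height V k, k, top_sign V k)"
proof -
  note F = heap_finite[OF V]
  have roof_top: "fst x = col_height V (fst (snd x))" if "x \<in> roof m V" for x
  proof (rule ccontr)
    assume n: "fst x \<noteq> col_height V (fst (snd x))"
    have "x \<in> V" using that roof_subset by blast
    then have l: "fst x < col_height V (fst (snd x))" using n col_height_ge[OF F, of x] by simp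
    then obtain y where "y \<in> V" "fst y = col_height V (fst (snd x))" "fst (snd y) = fst (snd x)"
      using col_height_attained[OF F, of "fst (snd x)"] by auto
    then have "y \<in> V" "below x y" using l by (simp_all add: below_def)
    then show False using that unfolding roof_iff by blast
  qed
  show eq: "x \<in> roof m V \<Longrightarrow> snd x = (k, \<not> s) \<Longrightarrow> x = (col_height V k, k, top_sign V k)" for x
    using roof_top[of x] top_sign_eq[OF V, of x] roof_subset by (auto simp: prod_eq_iff)
  show "?L \<longleftrightarrow> ?R"
  proof
    assume L: ?L
    then obtain x where x: "x \<in> V" "fst x = col_height V k" "fst (snd x) = k"
      using col_height_attained[OF F, of k] by auto
    have "\<not> below x y" if "y \<in> V" for y
      using col_height_ge[OF F that] L x by (auto simp: below_def near_def)
    then have "x \<in> roof m V" using x by (simp add: roof_iff)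
    moreover have "snd (snd x) = (\<not> s)" using L top_sign_eq[OF V x(1)] x by auto
    ultimately show ?R using x by (intro bexI[of _ x]) (auto simp: prod_eq_iff)
  next
    assume ?R
    then obtain x where x: "x \<in> roof m V" "snd x = (k, \<not> s)" by blast
    have xeq: "x = (col_height V k, k, top_sign V k)" by (rule eq[OF x])
    have xV: "x \<in> V" using x roof_subset by blast
    then have pos: "1 \<le> col_height V k" using heap_bounds(1)[OF V xV] xeq by simp
    have *: "col_height V j < col_height V k" if j: "near k j" "j \<noteq> k" for j
    proof (rule ccontr)
      assume n: "\<not> ?thesis"
      then obtain y where y: "y \<in> V" "fst y = col_height V j" "fst (snd y) = j"
        using col_height_attained[OF F, of j] pos by auto
      have "\<not> below x y" using x y unfolding roof_iff by blast
      then have "fst x = fst y" using n y xeq j by (auto simp: below_def)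
      then have "x = y" using heap_near_eq[OF V xV y(1)] y j xeq by (metis fst_conv snd_conv)
      then have "fst (snd y) = k" using xeq by auto
      then show False using y j by simp
    qed
    have "col_height V (left_col m k) < col_height V k" "col_height V (right_col m k) < col_height V k"
      by (rule *, simp_all add: near_left near_right col_neq k)+
    moreover have "top_sign V k \<noteq> s" using xeq x(2) by auto
    ultimately show ?L by simp
  qed
qed

lemma drop_cancel:
  assumes "finite_heap m V" "x \<in> roof m V" "snd x = (k, \<not> s)"
  shows "drop_piece m (k, s) V = V - {x}"
proof -
  have k: "k < m" using heap_bounds(2)[OF assms(1), of x] assms roof_subset[of V] by auto
  have "x = (col_height V k, k, top_sign V k)" by (rule cancel_iff(2)[OF assms(1) k assms(2,3)])
  then show ?thesis
    using cancel_iff(1)[OF assms(1) k, of s] assms unfolding drop_piece_def by (auto simp: Let_def)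
qed

lemma drop_add:
  assumes "finite_heap m V" "k < m" "\<And>x. x \<in> roof m V \<Longrightarrow> snd x \<noteq> (k, \<not> s)"
  shows "drop_piece m (k, s) V = insert (new_height V k, k, s) V"
  using cancel_iff(1)[OF assms(1,2), of s] assms(3) unfolding drop_piece_def new_height_def
  by (auto simp: Let_def)

lemma heap_drop:
  assumes V: "finite_heap m V" and "fst c < m"
  shows "finite_heap m (drop_piece m c V)"
proof -
  obtain k s where c: "c = (k, s)" by (cases c)
  have k: "k < m" using assms c by simp
  note F = heap_finite[OF V]
  show ?thesis
  proof (cases "\<exists>x\<in>roof m V. snd x = (k, \<not> s)")
    case True
    then obtain x where "x \<in> roof m V" "snd x = (k, \<not> s)" by blast
    then show ?thesis using drop_cancel[OF V] heap_remove[OF V, of "{x}"] by (simp add: c)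
  next
    case False
    let ?q = "(new_height V k, k, s)"
    have gr: "fst x < new_height V k" if "x \<in> V" "near k (fst (snd x))" for x
      using new_height_greater[OF F that] .
    have "finite_heap m (insert ?q V)"
    proof (rule heapI)
      show "finite (insert ?q V)" using F by simp
      show "1 \<le> fst x" if "x \<in> insert ?q V" for x
        using that heap_bounds(1)[OF V, of x] by (auto simp: new_height_def)
      show bd: "fst (snd x) < m" if "x \<in> insert ?q V" for x
        using that heap_bounds(2)[OF V, of x] k by auto
      fix x assume x: "x \<in> insert ?q V"
      show "\<exists>y\<in>insert ?q V. fst y = fst x - 1 \<and> near (fst (snd x)) (fst (snd y))" if x1: "1 < fst x"
      proof (cases "x = ?q")
        case True
        then have "1 < new_height V k" using that by simp
        then obtain y where "y \<in> V" "fst y = new_height V k - 1" "near k (fst (snd y))"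
          by (rule new_height_attained[OF F])
        then show ?thesis using True by (intro bexI[of _ y]) simp_all
      next
        case False
        then have "x \<in> V" using x by simp
        then obtain y where "y \<in> V" "fst y = fst x - 1" "near (fst (snd x)) (fst (snd y))"
          by (rule heap_support[OF V _ x1])
        then show ?thesis by blast
      qed
      fix y assume y: "y \<in> insert ?q V"
      show "snd x = snd y" if h: "fst y = Suc (fst x)" "fst (snd x) = fst (snd y)"
      proof (cases "x = ?q")
        case True
        then have "y \<noteq> ?q" using h(1) by (metis fst_conv n_not_Suc_n)
        then have "y \<in> V" using y by simp
        then show ?thesis using gr[of y] h True by simp
      next
        case xV: False
        then have xV: "x \<in> V" using x by simp
        show ?thesis
        proof (cases "y = ?q")
          case True
          \<comment> \<open>The sign axiom for the new piece. A piece \<open>x\<close> right beneath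
            it in the same column is blocked by nothing, so it was removable; with the opposite sign
            it would have been annihilated.\<close>
          have "\<not> below x z" if "z \<in> V" for z
            using gr[OF that] h True by (auto simp: below_def)
          then have "x \<in> roof m V" using xV by (simp add: roof_iff)
          then have "snd x \<noteq> (k, \<not> s)" using False by blast
          then show ?thesis using True h by (auto simp: prod_eq_iff)
        next
          case False
          then show ?thesis using heap_consecutive[OF V xV _ h] y by simp
        qed
      qed
      show "x = y" if h: "near (fst (snd x)) (fst (snd y))" "fst x = fst y"
      proof -
        have "near (fst (snd y)) (fst (snd x))"
          using h(1) near_sym[of "fst (snd x)" "fst (snd y)"] bd[OF x] bd[OF y] by simp
        then have "y \<in> V \<Longrightarrow> x \<noteq> ?q" "x \<in> V \<Longrightarrow> y \<noteq> ?q"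
          using gr[of x] gr[of y] h by auto
        then consider "x \<in> V" "y \<in> V" | "x = ?q" "y = ?q" using x y by blast
        then show ?thesis
        proof cases
          case 1
          then show ?thesis by (rule heap_near_eq[OF V _ _ h])
        qed simp
      qed
    qed
    then show ?thesis using drop_add[OF V k] False by (auto simp: c)
  qed
qed

section \<open>The effect of a drop on each roof\<close>

primrec push :: "(nat \<Rightarrow> config) \<Rightarrow> nat \<times> sign \<Rightarrow> nat \<Rightarrow> config" where
  "push W p 0 = {p}"
| "push W p (Suc i) = {a \<in> W i. \<exists>b\<in>push W p i. near (fst a) (fst b)}"

text \<open>Both recursions list the pieces that change roof. An added piece enters roof 0 and
  displaces its near pieces to the next roof, and so on: \<open>push W p i\<close> enters roof
  \<open>i\<close>. When \<open>p\<close> is removed, a piece of the next roof rises if all its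
  blockers in the roof above it rise: \<open>pull W p i\<close> leaves roof
  \<open>i\<close>.\<close>

primrec pull :: "(nat \<Rightarrow> config) \<Rightarrow> nat \<times> sign \<Rightarrow> nat \<Rightarrow> config" where
  "pull W p 0 = {p}"
| "pull W p (Suc i) = {a \<in> W (Suc i). \<forall>b\<in>W i. near (fst a) (fst b) \<longrightarrow> b \<in> pull W p i}"

text \<open>The same recursions on pieces with their heights, where sets can be compared with
  \<open>deep i V\<close>. The projection \<open>snd\<close> is injective on each roof and carries
  these versions to \<open>push\<close> and \<open>pull\<close>.\<close>

primrec pushed :: "piece set \<Rightarrow> piece \<Rightarrow> nat \<Rightarrow> piece set" where
  "pushed V q 0 = {q}"
| "pushed V q (Suc i) = {x \<in> roof m (deep i V). \<exists>y\<in>pushed V q i. near (fst (snd x)) (fst (snd y))}"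

primrec pulled :: "piece set \<Rightarrow> piece \<Rightarrow> nat \<Rightarrow> piece set" where
  "pulled V q 0 = {q}"
| "pulled V q (Suc i) = {x \<in> roof m (deep (Suc i) V).
     \<forall>y\<in>roof m (deep i V). near (fst (snd x)) (fst (snd y)) \<longrightarrow> y \<in> pulled V q i}"

lemma deep_subset: "deep i V \<subseteq> V"
  using deep_mono[of 0 i V] by simp

lemma roof_union:
  assumes W: "finite_heap m W" and "D \<subseteq> W" "A \<subseteq> W" and disj: "A \<inter> D = {}"
    and nb: "\<And>x y. y \<in> A \<Longrightarrow> x \<in> D \<union> A \<Longrightarrow> \<not> below y x"
  shows "roof m (D \<union> A) = (roof m D - {x \<in> roof m D. \<exists>y\<in>A. near (fst (snd x)) (fst (snd y))}) \<union> A"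
proof -
  have *: "below x y \<longleftrightarrow> near (fst (snd x)) (fst (snd y))" if "x \<in> D" "y \<in> A" for x y
  proof
    assume "near (fst (snd x)) (fst (snd y))"
    with heap_near_cases[OF W, of x y] show "below x y"
      using that assms(2,3) disj nb[of y x] by blast
  qed (simp add: below_def)
  have "x \<in> roof m (D \<union> A) \<longleftrightarrow> x \<in> roof m D \<and> (\<forall>y\<in>A. \<not> near (fst (snd x)) (fst (snd y)))" if "x \<in> D" for x
    using that *[OF that] unfolding roof_iff by blast
  moreover have "x \<in> roof m (D \<union> A)" if "x \<in> A" for x
    using that nb unfolding roof_iff by blast
  moreover have "x \<in> D \<union> A" if "x \<in> roof m (D \<union> A)" for x
    using that unfolding roof_iff by blast
  moreover have "x \<in> D" if "x \<in> roof m D" for x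
    using that unfolding roof_iff by blast
  ultimately show ?thesis using disj by blast
qed

text \<open>The invariant of stripping in parallel: after \<open>i\<close> rounds the heap with
  \<open>q\<close> lags behind by the displaced pieces \<open>pushed V q i\<close>. These lie on top
  and go in the next round, during which they hold back exactly the roof pieces near them.\<close>

lemma deep_insert:
  assumes V': "finite_heap m (insert q V)"
    and q: "\<And>x. x \<in> V \<Longrightarrow> near (fst (snd q)) (fst (snd x)) \<Longrightarrow> fst x < fst q"
  shows "deep i (insert q V) = deep i V \<union> pushed V q i"
    and "roof m (deep i (insert q V)) = (roof m (deep i V) - pushed V q (Suc i)) \<union> pushed V q i"
proof -
  have sub: "pushed V q (Suc i) \<subseteq> roof m (deep i V)" for i by auto
  have disj: "pushed V q i \<inter> deep i V = {}" for i
  proof (cases i)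
    case 0
    then show ?thesis using q[of q] by auto
  next
    case (Suc j)
    then show ?thesis using sub[of j] deep_Suc by blast
  qed
  have A_sub: "pushed V q i \<subseteq> insert q V" for i
  proof (cases i)
    case (Suc j)
    then show ?thesis using sub[of j] roof_subset[of "deep j V"] deep_subset[of j V] by blast
  qed simp
  have nb: "\<not> below y x" if "y \<in> pushed V q i" "x \<in> deep i V \<union> pushed V q i" for x y i
  proof (cases i)
    case 0
    then show ?thesis using that q[of x] by (auto simp: below_def)
  next
    case (Suc j)
    then have "y \<in> roof m (deep j V)" "x \<in> deep j V"
      using that sub[of j] deep_Suc roof_subset[of "deep j V"] by blast+
    then show ?thesis unfolding roof_iff by blast
  qed
  have roof: "roof m (deep i V \<union> pushed V q i) = (roof m (deep i V) - pushed V q (Suc i)) \<union> pushed V q i" for i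
    unfolding pushed.simps(2)
    by (rule roof_union[OF V' _ A_sub disj nb]) (use deep_subset[of i V] in blast)
  have P: "deep i (insert q V) = deep i V \<union> pushed V q i" for i
  proof (induction i)
    case (Suc i)
    show ?case unfolding deep_Suc Suc roof
      using roof_subset[of "deep i V"] disj[of i] sub[of i] by blast
  qed simp
  show "deep i (insert q V) = deep i V \<union> pushed V q i" by (rule P)
  show "roof m (deep i (insert q V)) = (roof m (deep i V) - pushed V q (Suc i)) \<union> pushed V q i"
    unfolding P by (rule roof)
qed

text \<open>A piece of the second roof is blocked only by pieces of the first, so removing
  \<open>B\<close> frees it exactly when all its near pieces in the first roof belong to
  \<open>B\<close>. Deeper pieces keep a blocker in the second roof.\<close>

lemma roof_diff:
  assumes V: "finite_heap m V" and D: "D \<subseteq> V" and B: "B \<subseteq> roof m D"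
  shows "roof m (D - B) = (roof m D - B) \<union>
    {x \<in> roof m (strip D). \<forall>y\<in>roof m D. near (fst (snd x)) (fst (snd y)) \<longrightarrow> y \<in> B}"
proof -
  have *: "below x y \<longleftrightarrow> near (fst (snd x)) (fst (snd y))" if "x \<in> strip D" "y \<in> roof m D" for x y
  proof
    assume "near (fst (snd x)) (fst (snd y))"
    moreover have "x \<noteq> y" using that by blast
    moreover have "\<not> below y x" "x \<in> D" "y \<in> D" using that unfolding roof_iff by blast+
    ultimately show "below x y"
      using heap_near_cases[OF V, of x y] D by blast
  qed (simp add: below_def)
  have 1: "x \<in> roof m (D - B) \<longleftrightarrow> x \<notin> B" if "x \<in> roof m D" for x
    using that unfolding roof_iff by blast
  have "x \<in> roof m (D - B) \<longleftrightarrow> (\<forall>y\<in>D. below x y \<longrightarrow> y \<in> B)" if "x \<in> strip D" for x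
    using that B unfolding roof_iff by blast
  moreover have "(\<forall>y\<in>D. below x y \<longrightarrow> y \<in> B) \<longleftrightarrow>
      x \<in> roof m (strip D) \<and> (\<forall>y\<in>roof m D. near (fst (snd x)) (fst (snd y)) \<longrightarrow> y \<in> B)"
    if x: "x \<in> strip D" for x
  proof
    assume L: "\<forall>y\<in>D. below x y \<longrightarrow> y \<in> B"
    have "x \<in> roof m (strip D)" using L x B unfolding roof_iff[of x "strip D"] by blast
    moreover have "y \<in> B" if "y \<in> roof m D" "near (fst (snd x)) (fst (snd y))" for y
      using *[OF x that(1)] that L roof_subset[of D] by blast
    ultimately show "x \<in> roof m (strip D) \<and> (\<forall>y\<in>roof m D. near (fst (snd x)) (fst (snd y)) \<longrightarrow> y \<in> B)"
      by blast
  next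
    assume R: "x \<in> roof m (strip D) \<and> (\<forall>y\<in>roof m D. near (fst (snd x)) (fst (snd y)) \<longrightarrow> y \<in> B)"
    show "\<forall>y\<in>D. below x y \<longrightarrow> y \<in> B"
    proof (intro ballI impI)
      fix y assume y: "y \<in> D" "below x y"
      then have "y \<in> roof m D" using R unfolding roof_iff[of x "strip D"] by blast
      then show "y \<in> B" using R y by (simp add: below_def)
    qed
  qed
  ultimately have 2: "x \<in> roof m (D - B) \<longleftrightarrow>
      x \<in> roof m (strip D) \<and> (\<forall>y\<in>roof m D. near (fst (snd x)) (fst (snd y)) \<longrightarrow> y \<in> B)"
    if "x \<in> strip D" for x using that by simp
  show ?thesis
    using 1 2 roof_subset[of "D - B"] roof_subset[of "strip D"] roof_subset[of D] by blast
qed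

text \<open>Dual to \<open>deep_insert\<close>: without \<open>q\<close> the stripping runs ahead,
  and what has gone early by round \<open>i\<close> is \<open>pulled V q i\<close>.\<close>

lemma deep_remove:
  assumes V: "finite_heap m V" and q: "q \<in> roof m V"
  shows "pulled V q i \<subseteq> roof m (deep i V)"
    and "roof m (deep i (V - {q})) = (roof m (deep i V) - pulled V q i) \<union> pulled V q (Suc i)"
proof -
  have Q: "pulled V q i \<subseteq> roof m (deep i V)" for i
  proof (cases i)
    case (Suc j)
    then show ?thesis unfolding Suc pulled.simps by blast
  qed (use q in simp)
  have roof: "roof m (deep i V - pulled V q i) = (roof m (deep i V) - pulled V q i) \<union> pulled V q (Suc i)" for i
    unfolding pulled.simps(2) deep_Suc by (rule roof_diff[OF V deep_subset Q])
  have P: "deep i (V - {q}) = deep i V - pulled V q i" for i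
  proof (induction i)
    case (Suc i)
    show ?case unfolding deep_Suc Suc roof
      using Q[of i] roof_subset[of "deep i V"] by blast
  qed simp
  show "pulled V q i \<subseteq> roof m (deep i V)" by (rule Q)
  show "roof m (deep i (V - {q})) = (roof m (deep i V) - pulled V q i) \<union> pulled V q (Suc i)"
    unfolding P by (rule roof)
qed

lemma roof_seq_insert:
  assumes V: "finite_heap m V" and V': "finite_heap m (insert q V)"
    and q: "\<And>x. x \<in> V \<Longrightarrow> near (fst (snd q)) (fst (snd x)) \<Longrightarrow> fst x < fst q"
  shows "roof_seq m (insert q V) i =
    (roof_seq m V i - push (roof_seq m V) (snd q) (Suc i)) \<union> push (roof_seq m V) (snd q) i"
proof -
  have push: "push (roof_seq m V) (snd q) i = snd ` pushed V q i" for i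
  proof (induction i)
    case (Suc i)
    show ?case unfolding push.simps Suc unfolding pushed.simps roof_seq_def by blast
  qed simp
  have "snd ` (roof m (deep i V) - pushed V q (Suc i)) = snd ` roof m (deep i V) - snd ` pushed V q (Suc i)"
    by (rule inj_on_image_set_diff[OF roof_snd_inj[OF heap_deep[OF V]]]) auto
  moreover have "roof m (deep i (insert q V)) = (roof m (deep i V) - pushed V q (Suc i)) \<union> pushed V q i"
    by (rule deep_insert(2)[OF V']) (rule q)
  ultimately show ?thesis unfolding push roof_seq_def by (simp only: image_Un)
qed

lemma roof_seq_remove:
  assumes V: "finite_heap m V" and q: "q \<in> roof m V"
  shows "roof_seq m (V - {q}) i =
    (roof_seq m V i - pull (roof_seq m V) (snd q) i) \<union> pull (roof_seq m V) (snd q) (Suc i)"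
proof -
  have pull: "pull (roof_seq m V) (snd q) i = snd ` pulled V q i" for i
  proof (induction i)
    case (Suc i)
    have *: "snd y \<in> snd ` pulled V q i \<longleftrightarrow> y \<in> pulled V q i" if "y \<in> roof m (deep i V)" for y
      by (rule inj_on_image_mem_iff[OF roof_snd_inj[OF heap_deep[OF V]] that deep_remove(1)[OF V q]])
    have "(\<forall>b\<in>snd ` roof m (deep i V). near (fst (snd x)) (fst b) \<longrightarrow> b \<in> snd ` pulled V q i) \<longleftrightarrow>
        (\<forall>y\<in>roof m (deep i V). near (fst (snd x)) (fst (snd y)) \<longrightarrow> y \<in> pulled V q i)" for x :: piece
      using * by blast
    then show ?case unfolding pull.simps Suc unfolding pulled.simps roof_seq_def by blast
  qed simp
  have "snd ` (roof m (deep i V) - pulled V q i) = snd ` roof m (deep i V) - snd ` pulled V q i"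
    using inj_on_image_set_diff[OF roof_snd_inj[OF heap_deep[OF V, of i]] _ deep_remove(1)[OF V q]] by blast
  then show ?thesis
    unfolding pull roof_seq_def deep_remove(2)[OF V q] image_Un by (simp only:)
qed

text \<open>Makes sense for arbitrary sequences of configurations, infinite heaps included. Roof 0
  decides between cancelling and adding.\<close>

definition drop_config :: "nat \<times> sign \<Rightarrow> (nat \<Rightarrow> config) \<Rightarrow> nat \<Rightarrow> config" where
  "drop_config c W i =
     (if (fst c, \<not> snd c) \<in> W 0
      then (W i - pull W (fst c, \<not> snd c) i) \<union> pull W (fst c, \<not> snd c) (Suc i)
      else (W i - push W c (Suc i)) \<union> push W c i)"

lemma roof_seq_drop:
  assumes V: "finite_heap m V" and c: "fst c < m"
  shows "roof_seq m (drop_piece m c V) = drop_config c (roof_seq m V)"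
proof
  fix i
  obtain k s where [simp]: "c = (k, s)" by (cases c)
  have in0: "(k, \<not> s) \<in> roof_seq m V 0 \<longleftrightarrow> (\<exists>x\<in>roof m V. snd x = (k, \<not> s))"
  proof -
    have "roof_seq m V 0 = snd ` roof m V" by (simp add: roof_seq_def)
    then show ?thesis unfolding image_def by (simp add: eq_commute)
  qed
  show "roof_seq m (drop_piece m c V) i = drop_config c (roof_seq m V) i"
  proof (cases "\<exists>x\<in>roof m V. snd x = (k, \<not> s)")
    case True
    then obtain x where x: "x \<in> roof m V" "snd x = (k, \<not> s)" by blast
    show ?thesis
      using roof_seq_remove[OF V x(1), of i] True in0 drop_cancel[OF V x] x(2)
      by (simp add: drop_config_def del: pull.simps)
  next
    case False
    have d: "drop_piece m c V = insert (new_height V k, k, s) V"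
      using drop_add[OF V, of k s] False c by auto
    have "finite_heap m (insert (new_height V k, k, s) V)"
      using heap_drop[OF V c] d by simp
    from roof_seq_insert[OF V this, of i] show ?thesis
      using False in0 d new_height_greater[OF heap_finite[OF V]]
      by (simp add: drop_config_def del: push.simps)
  qed
qed

lemma push_cong: "(\<And>j. j < i \<Longrightarrow> W j = W' j) \<Longrightarrow> push W p i = push W' p i"
  by (induction i) auto

lemma pull_cong: "(\<And>j. j \<le> i \<Longrightarrow> W j = W' j) \<Longrightarrow> pull W p i = pull W' p i"
  by (induction i) auto

text \<open>The dependence on roof \<open>i + 1\<close> comes from the cancelling case alone,
  through \<open>pull W p (Suc i)\<close>. It is the reason for \<open>T_{j+1}\<close> in the
  definition of a drop on generalized heaps.\<close>

lemma drop_config_cong: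
  assumes "\<And>j. j \<le> Suc i \<Longrightarrow> W j = W' j"
  shows "drop_config c W i = drop_config c W' i"
proof -
  have "push W p i = push W' p i" "push W p (Suc i) = push W' p (Suc i)"
    "pull W p i = pull W' p i" "pull W p (Suc i) = pull W' p (Suc i)" for p
    by (rule push_cong pull_cong, use assms in simp)+
  then show ?thesis using assms[of 0] assms[of i] by (simp add: drop_config_def del: push.simps pull.simps)
qed

section \<open>Generalized heaps\<close>

lemma top_roofs_eq_iff: "top_roofs k W = top_roofs k W' \<longleftrightarrow> (\<forall>i<k. W i = W' i)"
  by (auto simp: top_roofs_def)

lemma has_roofs_top_roofs:
  "has_roofs m V (top_roofs k W) \<longleftrightarrow> roof_seq m V = (\<lambda>i. if i < k then W i else {})"
  by (auto simp: has_roofs_def top_roofs_def fun_eq_iff)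

lemma heap_below_level:
  assumes V: "finite_heap m V"
  shows "finite_heap m {x \<in> V. fst x \<le> k}"
proof (rule heapI)
  fix x assume x: "x \<in> {x \<in> V. fst x \<le> k}" "1 < fst x"
  then have "x \<in> V" by simp
  then obtain y where "y \<in> V" "fst y = fst x - 1" "near (fst (snd x)) (fst (snd y))"
    by (rule heap_support[OF V _ x(2)])
  then show "\<exists>y\<in>{x \<in> V. fst x \<le> k}. fst y = fst x - 1 \<and> near (fst (snd x)) (fst (snd y))"
    using x by (intro bexI[of _ y]) auto
next
  fix x y assume xy: "x \<in> {x \<in> V. fst x \<le> k}" "y \<in> {x \<in> V. fst x \<le> k}"
  then have V': "x \<in> V" "y \<in> V" by auto
  show "snd x = snd y" if "fst y = Suc (fst x)" "fst (snd x) = fst (snd y)"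
    using heap_consecutive[OF V V' that] .
  show "x = y" if "near (fst (snd x)) (fst (snd y))" "fst x = fst y"
    using heap_near_eq[OF V V' that] .
qed (use heap_finite[OF V] heap_bounds[OF V] in auto)

text \<open>Cutting a heap below a height is harmless because supports point downwards. Keeping the
  first \<open>k\<close> roofs is the same operation on the reversed heap.\<close>

lemma heap_truncate:
  assumes V: "finite_heap m V"
  obtains V' where "finite_heap m V'" "roof_seq m V' = (\<lambda>i. if i < k then roof_seq m V i else {})"
proof -
  let ?W = "\<lambda>i. if i < k then roof_seq m V i else {}"
  have "stack ?W = {x \<in> stack (roof_seq m V). fst x \<le> k}"
    by (auto simp: stack_def split: if_splits)
  then have S: "finite_heap m (stack ?W)"
    using heap_below_level[OF heap_stack_roof_seq[OF V]] by simp
  show thesis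
    by (rule that[OF heap_stack_roof_seq[OF S] roof_seq_stack[OF S]])
qed

lemma roof_seq_gen_heap: "finite_heap m V \<Longrightarrow> roof_seq m V \<in> gen_heaps m"
  unfolding gen_heaps_def has_roofs_top_roofs by (blast elim: heap_truncate)

lemma heap_with_roofs:
  assumes "W \<in> gen_heaps m"
  shows "finite_heap m (heap_with_roofs m (top_roofs k W))"
    and "roof_seq m (heap_with_roofs m (top_roofs k W)) = (\<lambda>i. if i < k then W i else {})"
proof -
  have "\<exists>!V. finite_heap m V \<and> has_roofs m V (top_roofs k W)"
  proof (rule ex_ex1I)
    show "\<exists>V. finite_heap m V \<and> has_roofs m V (top_roofs k W)"
      using assms by (simp add: gen_heaps_def)
    fix V V' assume "finite_heap m V \<and> has_roofs m V (top_roofs k W)"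
      "finite_heap m V' \<and> has_roofs m V' (top_roofs k W)"
    then show "V = V'" unfolding has_roofs_top_roofs by (intro roof_seq_inj) simp_all
  qed
  from theI'[OF this]
  show "finite_heap m (heap_with_roofs m (top_roofs k W))"
    "roof_seq m (heap_with_roofs m (top_roofs k W)) = (\<lambda>i. if i < k then W i else {})"
    unfolding heap_with_roofs_def has_roofs_top_roofs by auto
qed

text \<open>The finite heap with the first \<open>j + 1\<close> roofs of \<open>W\<close> agrees
  with \<open>W\<close> on everything that the first \<open>j\<close> roofs of the result read. So
  the finite results fit together to \<open>drop_config c W\<close>, and this is the only sequence
  with these prefixes.\<close>

lemma gen_drop:
  assumes W: "W \<in> gen_heaps m" and c: "fst c < m"
  shows "gen_drop m c W = drop_config c W" and "drop_config c W \<in> gen_heaps m"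
proof -
  let ?V = "\<lambda>j. drop_piece m c (heap_with_roofs m (top_roofs (j + 1) W))"
  have V: "finite_heap m (?V j)" for j
    by (rule heap_drop[OF heap_with_roofs(1)[OF W] c])
  have eq: "roof_seq m (?V j) i = drop_config c W i" if "i < j" for i j
    unfolding roof_seq_drop[OF heap_with_roofs(1)[OF W] c]
    using that by (intro drop_config_cong) (simp add: heap_with_roofs(2)[OF W])
  then have top: "top_roofs j (drop_config c W) = top_roofs j (roof_seq m (?V j))" for j
    by (simp add: top_roofs_eq_iff)
  show mem: "drop_config c W \<in> gen_heaps m"
    unfolding gen_heaps_def has_roofs_top_roofs
  proof (intro CollectI allI)
    fix k
    obtain V' where "finite_heap m V'" "roof_seq m V' = (\<lambda>i. if i < k then roof_seq m (?V k) i else {})"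
      by (rule heap_truncate[OF V])
    moreover have "(\<lambda>i. if i < k then roof_seq m (?V k) i else {}) = (\<lambda>i. if i < k then drop_config c W i else {})"
      using eq[of _ k] by (intro ext) auto
    ultimately show "\<exists>V. finite_heap m V \<and> roof_seq m V = (\<lambda>i. if i < k then drop_config c W i else {})"
      by auto
  qed
  show "gen_drop m c W = drop_config c W"
    unfolding gen_drop_def
  proof (rule the_equality)
    show "drop_config c W \<in> gen_heaps m \<and> (\<forall>j. top_roofs j (drop_config c W) = top_roofs j (roof_seq m (?V j)))"
      using mem top by simp
  next
    fix W' assume "W' \<in> gen_heaps m \<and> (\<forall>j. top_roofs j W' = top_roofs j (roof_seq m (?V j)))"
    then have "top_roofs (Suc i) W' = top_roofs (Suc i) (drop_config c W)" for i using top by simp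
    then show "W' = drop_config c W" unfolding top_roofs_eq_iff by auto
  qed
qed

lemma gen_drop_mem: "W \<in> gen_heaps m \<Longrightarrow> fst c < m \<Longrightarrow> gen_drop m c W \<in> gen_heaps m"
  by (simp add: gen_drop)

lemma gen_drop_roof_seq:
  "finite_heap m V \<Longrightarrow> fst c < m \<Longrightarrow> gen_drop m c (roof_seq m V) = roof_seq m (drop_piece m c V)"
  by (simp add: gen_drop roof_seq_gen_heap roof_seq_drop)

lemma gen_drop_cong:
  assumes "W \<in> gen_heaps m" "W' \<in> gen_heaps m" "fst c < m" "top_roofs (Suc k) W = top_roofs (Suc k) W'"
  shows "top_roofs k (gen_drop m c W) = top_roofs k (gen_drop m c W')"
  using assms(4) unfolding top_roofs_eq_iff gen_drop(1)[OF assms(1,3)] gen_drop(1)[OF assms(2,3)]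
  by (intro allI impI drop_config_cong) auto

section \<open>Averages over the next drops\<close>

definition choices :: "(nat \<times> sign) set" where
  "choices = {..<m} \<times> UNIV"

lemma finite_choices: "finite choices"
  by (simp add: choices_def)

lemma card_choices: "card choices = 2 * m"
  by (simp add: choices_def card_cartesian_product)

lemma choices_nonempty: "choices \<noteq> {}"
  using two_columns by (auto simp: choices_def lessThan_empty_iff)

lemma mem_choices: "c \<in> choices \<longleftrightarrow> fst c < m"
  by (cases c) (auto simp: choices_def)

text \<open>The expectation of \<open>F\<close> after \<open>n\<close> uniform drops from
  \<open>x\<close>, as a finite sum. The update \<open>d\<close> is a parameter because the same
  operator serves finite heaps, coupled pairs and generalized heaps.\<close>

primrec walk :: "(nat \<times> sign \<Rightarrow> 'x \<Rightarrow> 'x) \<Rightarrow> nat \<Rightarrow> ('x \<Rightarrow> real) \<Rightarrow> 'x \<Rightarrow> real" where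
  "walk d 0 F x = F x"
| "walk d (Suc n) F x = (\<Sum>c\<in>choices. walk d n F (d c x)) / real (2 * m)"

lemma walk_add: "walk d (n + k) F x = walk d k (walk d n F) x"
  by (induction k arbitrary: x) simp_all

lemma two_m_pos: "0 < real (2 * m)"
  using two_columns by simp

lemma walk_mono:
  assumes "x \<in> S" "\<And>c y. c \<in> choices \<Longrightarrow> y \<in> S \<Longrightarrow> d c y \<in> S" "\<And>y. y \<in> S \<Longrightarrow> F y \<le> G y"
  shows "walk d n F x \<le> walk d n G x"
  using assms(1)
proof (induction n arbitrary: x)
  case (Suc n)
  then have "(\<Sum>c\<in>choices. walk d n F (d c x)) \<le> (\<Sum>c\<in>choices. walk d n G (d c x))"
    by (intro sum_mono) (simp add: assms(2))
  then show ?case using two_m_pos by (simp add: divide_right_mono)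
qed (use assms(3) in simp)

lemma walk_const [simp]: "walk d n (\<lambda>_. a) x = a"
  using two_columns by (induction n arbitrary: x) (simp_all add: card_choices)

lemma walk_linear: "walk d n (\<lambda>y. a * F y + b * G y) x = a * walk d n F x + b * walk d n G x"
  by (induction n arbitrary: x) (simp_all add: sum.distrib sum_distrib_left add_divide_distrib)

lemma walk_diff_le: "\<bar>walk d n F x - walk d n G x\<bar> \<le> walk d n (\<lambda>y. \<bar>F y - G y\<bar>) x"
proof -
  have eq: "walk d n F x - walk d n G x = walk d n (\<lambda>y. F y - G y) x"
    using walk_linear[of d n 1 F "-1" G x] by simp
  have neg: "walk d n (\<lambda>y. - (F y - G y)) x = - walk d n (\<lambda>y. F y - G y) x"
    using walk_linear[of d n "-1" "\<lambda>y. F y - G y" 0 "\<lambda>_. 0" x] by simp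
  have "walk d n (\<lambda>y. F y - G y) x \<le> walk d n (\<lambda>y. \<bar>F y - G y\<bar>) x"
    "walk d n (\<lambda>y. - (F y - G y)) x \<le> walk d n (\<lambda>y. \<bar>F y - G y\<bar>) x"
    by (rule walk_mono[of _ UNIV]; simp)+
  then show ?thesis unfolding eq using neg by linarith
qed

text \<open>Averages pass through a map that intertwines two updates. The maps of interest are
  \<open>roof_seq\<close> and the two projections of a coupled pair.\<close>

lemma walk_image:
  assumes "x \<in> S" "\<And>c y. c \<in> choices \<Longrightarrow> y \<in> S \<Longrightarrow> d c y \<in> S"
    and "\<And>c y. c \<in> choices \<Longrightarrow> y \<in> S \<Longrightarrow> h (d c y) = d' c (h y)"
  shows "walk d' n F (h x) = walk d n (\<lambda>y. F (h y)) x"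
  using assms(1)
proof (induction n arbitrary: x)
  case (Suc n)
  have "walk d' n F (d' c (h x)) = walk d n (\<lambda>y. F (h y)) (d c x)" if "c \<in> choices" for c
    using Suc.IH[of "d c x"] Suc.prems that assms(2,3) by simp
  then show ?case by simp
qed simp

text \<open>The word \<open>w\<close> has probability \<open>1 / (2m)^length w\<close>. A gain
  \<open>e\<close> after this word lowers the average by that fraction of \<open>e\<close>, while
  every other word is still bounded by \<open>B\<close>.\<close>

lemma walk_word:
  assumes S: "\<And>c y. c \<in> choices \<Longrightarrow> y \<in> S \<Longrightarrow> d c y \<in> S"
    and B: "\<And>y. y \<in> S \<Longrightarrow> walk d n F y \<le> B"
    and "x \<in> S" "set w \<subseteq> choices" "walk d n F (fold d w x) \<le> B - e"
  shows "walk d (n + length w) F x \<le> B - e / real (2 * m) ^ length w"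
  using assms(3-)
proof (induction w arbitrary: x)
  case (Cons c w)
  have B': "walk d (n + k) F y \<le> B" if "y \<in> S" for k y
    unfolding walk_add using walk_mono[OF that S B, where n = k] by simp
  have c: "c \<in> choices" using Cons.prems by simp
  have "(\<Sum>c\<in>choices. walk d (n + length w) F (d c x)) =
      walk d (n + length w) F (d c x) + (\<Sum>c\<in>choices - {c}. walk d (n + length w) F (d c x))"
    by (rule sum.remove[OF finite_choices c])
  also have "\<dots> \<le> (B - e / real (2 * m) ^ length w) + (\<Sum>c\<in>choices - {c}. B)"
    using Cons.IH[of "d c x"] Cons.prems S by (intro add_mono sum_mono B') auto
  also have "(\<Sum>c\<in>choices - {c}. B) = (real (2 * m) - 1) * B"
    using c two_columns by (simp add: finite_choices card_choices of_nat_diff)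
  finally have "(\<Sum>c\<in>choices. walk d (n + length w) F (d c x)) \<le>
      real (2 * m) * B - e / real (2 * m) ^ length w" by (simp add: algebra_simps)
  then have "(\<Sum>c\<in>choices. walk d (n + length w) F (d c x)) / real (2 * m) \<le>
      (real (2 * m) * B - e / real (2 * m) ^ length w) / real (2 * m)"
    using two_m_pos by (intro divide_right_mono) simp_all
  also have "\<dots> = B - e / real (2 * m) ^ length (c # w)"
    using two_columns by (simp add: field_simps)
  finally show ?case by simp
qed simp

section \<open>The pieces above a given piece\<close>

text \<open>The piece \<open>p\<close> counts as above itself, and the set is empty if
  \<open>p\<close> is not in \<open>X\<close>; so losing \<open>p\<close> makes the potential
  1.\<close>

inductive_set above :: "piece set \<Rightarrow> piece \<Rightarrow> piece set" for X p where
  base: "p \<in> X \<Longrightarrow> p \<in> above X p"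
| step: "x \<in> above X p \<Longrightarrow> y \<in> X \<Longrightarrow> below x y \<Longrightarrow> y \<in> above X p"

text \<open>When additions are three times as likely as deletions, every base strictly between
  \<open>1/3\<close> and 1 yields a supermartingale. With \<open>1/2\<close> a deletion doubles the
  potential and an addition at least halves it.\<close>

definition pot :: "piece set \<Rightarrow> piece \<Rightarrow> real" where
  "pot X p = (1 / 2) ^ card (above X p)"

lemma above_subset: "above X p \<subseteq> X"
  by (auto elim: above.cases)

lemma above_mono: "X \<subseteq> Y \<Longrightarrow> above X p \<subseteq> above Y p"
proof
  fix x assume "X \<subseteq> Y" "x \<in> above X p"
  from this(2,1) show "x \<in> above Y p"
    by (induction rule: above.induct) (auto intro: above.intros)
qed

text \<open>No chain of blockers passes through a removable piece, so only that piece itself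
  disappears.\<close>

lemma above_remove:
  assumes q: "q \<in> roof m X"
  shows "above (X - {q}) p = above X p - {q}"
proof (intro equalityI subsetI)
  fix x assume "x \<in> above (X - {q}) p"
  then show "x \<in> above X p - {q}"
    using above_mono[of "X - {q}" X p] above_subset[of "X - {q}" p] by blast
next
  fix x assume "x \<in> above X p - {q}"
  then have "x \<in> above X p" "x \<noteq> q" by auto
  then show "x \<in> above (X - {q}) p"
  proof (induction rule: above.induct)
    case base
    then show ?case by (intro above.base) simp
  next
    case (step x y)
    then have "x \<noteq> q" using q unfolding roof_iff by blast
    show ?case by (rule above.step[of x]) (use step \<open>x \<noteq> q\<close> in auto)
  qed
qed

lemma pot_nonneg: "0 \<le> pot X p"
  by (simp add: pot_def)

lemma pot_absent: "p \<notin> X \<Longrightarrow> pot X p = 1"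
proof -
  assume p: "p \<notin> X"
  have "x \<in> above X p \<Longrightarrow> False" for x
    by (induction rule: above.induct) (use p in auto)
  then have "above X p = {}" by blast
  then show ?thesis by (simp add: pot_def)
qed

lemma pot_remove:
  assumes "q \<in> roof m X" "finite X"
  shows "q \<in> above X p \<Longrightarrow> pot (X - {q}) p = 2 * pot X p"
    and "q \<notin> above X p \<Longrightarrow> pot (X - {q}) p = pot X p"
proof -
  have "finite (above X p)" using above_subset assms(2) finite_subset by blast
  then have "card (above X p) = Suc (card (above X p - {q}))" if "q \<in> above X p"
    using that by (rule card.remove)
  then show "q \<in> above X p \<Longrightarrow> pot (X - {q}) p = 2 * pot X p"
    unfolding pot_def above_remove[OF assms(1)] by (simp only: power_Suc)
  show "q \<notin> above X p \<Longrightarrow> pot (X - {q}) p = pot X p"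
    unfolding pot_def above_remove[OF assms(1)] by simp
qed

lemma pot_insert:
  assumes "q \<notin> X" "finite X"
  shows "pot (insert q X) p \<le> pot X p"
    and "y \<in> above X p \<Longrightarrow> below y q \<Longrightarrow> pot (insert q X) p \<le> pot X p / 2"
proof -
  have fin: "finite (above (insert q X) p)" "finite (above X p)"
    using above_subset assms(2) finite_subset finite_insert by metis+
  have sub: "above X p \<subseteq> above (insert q X) p" by (rule above_mono) auto
  then show "pot (insert q X) p \<le> pot X p"
    unfolding pot_def using card_mono[OF fin(1) sub] by (intro power_decreasing) auto
  assume y: "y \<in> above X p" "below y q"
  have "q \<in> above (insert q X) p" by (rule above.step[of y]) (use y sub in auto)
  moreover have "q \<notin> above X p" using above_subset assms(1) by blast
  ultimately have "Suc (card (above X p)) \<le> card (above (insert q X) p)"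
    using card_mono[OF fin(1), of "insert q (above X p)"] sub fin(2) by simp
  then have "pot (insert q X) p \<le> (1 / 2) ^ Suc (card (above X p))"
    unfolding pot_def by (intro power_decreasing) auto
  then show "pot (insert q X) p \<le> pot X p / 2" by (simp add: pot_def)
qed

lemma pot_drop_add:
  assumes X: "finite_heap m X" and k: "k < m" and na: "\<And>x. x \<in> roof m X \<Longrightarrow> snd x \<noteq> (k, \<not> s)"
  shows "pot (drop_piece m (k, s) X) p \<le> pot X p"
    and "y \<in> above X p \<Longrightarrow> near k (fst (snd y)) \<Longrightarrow> pot (drop_piece m (k, s) X) p \<le> pot X p / 2"
proof -
  let ?q = "(new_height X k, k, s)"
  note F = heap_finite[OF X]
  have d: "drop_piece m (k, s) X = insert ?q X" by (rule drop_add[OF X k na])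
  have q: "?q \<notin> X" using new_height_greater[OF F, of ?q k] by auto
  show "pot (drop_piece m (k, s) X) p \<le> pot X p" unfolding d by (rule pot_insert(1)[OF q F])
  assume y: "y \<in> above X p" "near k (fst (snd y))"
  have yX: "y \<in> X" using y above_subset by blast
  have "below y ?q"
    using new_height_greater[OF F yX y(2)] y(2) near_sym[OF k heap_bounds(2)[OF X yX]]
    by (simp add: below_def)
  then show "pot (drop_piece m (k, s) X) p \<le> pot X p / 2"
    unfolding d by (rule pot_insert(2)[OF q F y(1)])
qed

text \<open>If \<open>R\<close> is the set of columns of the removable pieces above \<open>p\<close>, then a drop deletes such a
  piece for only one choice of the sign in each column of \<open>R\<close>, while a drop in a column of \<open>R\<close> with
  the other sign, or in the column to the right of one of \<open>R\<close> with any sign, adds a piece above \<open>p\<close>.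
  Additions are thus at least three times as likely as deletions.\<close>

lemma pot_drift:
  assumes X: "finite_heap m X" and p: "p \<in> X"
  shows "(\<Sum>c\<in>choices. pot (drop_piece m c X) p) \<le> (real (2 * m) - 1 / 2) * pot X p"
proof -
  note F = heap_finite[OF X]
  define M where "M = above X p"
  define R where "R = (\<lambda>x. fst (snd x)) ` (roof m X \<inter> M)"
  have M: "M \<subseteq> X" "p \<in> M" "finite M"
    unfolding M_def using above_subset above.base[OF p] finite_subset[OF above_subset F] by auto
  have Rm: "R \<subseteq> {..<m}" unfolding R_def using heap_bounds(2)[OF X] M(1) by blast
  \<comment> \<open>A highest piece of \<open>M\<close> is removable in all of \<open>X\<close>:
    anything blocking it would again be above \<open>p\<close>. Hence \<open>R\<close> is nonempty,
    which gives the drift its constant term.\<close>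
  have "Max (fst ` M) \<in> fst ` M" using M by (intro Max_in) auto
  then obtain x where x: "x \<in> M" "fst x = Max (fst ` M)" by auto
  have "\<not> below x y" if "y \<in> X" for y
  proof
    assume b: "below x y"
    have "y \<in> M" unfolding M_def by (rule above.step[of x]) (use b that x(1) M_def in auto)
    then have "fst y \<le> fst x" using x(2) M(3) by simp
    then show False using b by (simp add: below_def)
  qed
  then have "x \<in> roof m X" using x M unfolding roof_iff by blast
  then have "R \<noteq> {}" using x unfolding R_def by blast
  then have R1: "1 \<le> card R" using Rm finite_subset[OF Rm] by (simp add: Suc_leI card_gt_0_iff)
  have no_roof: "k \<noteq> fst (snd z)" if "x \<in> roof m X" "near (fst (snd x)) k" "k \<noteq> fst (snd x)" "z \<in> roof m X" for x z k
    using roof_near_eq[OF X that(1,4)] that by auto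
  have inj: "inj_on (right_col m) R"
  proof (rule inj_onI)
    fix k k' assume "k \<in> R" "k' \<in> R" and eq: "right_col m k = right_col m k'"
    then have "k < m" "k' < m" using Rm by auto
    then show "k = k'" using eq by (auto simp: right_col_eq split: if_splits)
  qed
  \<comment> \<open>Two removable pieces never occupy adjacent columns, so the gains at the right
    neighbours are not counted on columns of \<open>R\<close>.\<close>
  have disj: "R \<inter> right_col m ` R = {}"
  proof -
    have False if R: "k \<in> R" "right_col m k \<in> R" for k
    proof -
      obtain x z where xz: "x \<in> roof m X" "z \<in> roof m X" "k = fst (snd x)" "right_col m k = fst (snd z)"
        using R unfolding R_def by blast
      have "right_col m k \<noteq> k" using col_neq(2)[of k] R(1) Rm by auto
      then show False
        using no_roof[OF xz(1) _ _ xz(2), of "right_col m k"] near_right[of k] xz(3,4) by simp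
    qed
    then show ?thesis by blast
  qed
  \<comment> \<open>The two signs together give \<open>2 + 1/2\<close> in a column of
    \<open>R\<close> (one deletion, one addition), at most \<open>1/2 + 1/2\<close> just to the
    right of it, and at most 2 elsewhere. Summed over columns this is
    \<open>2m + card R / 2 - card R\<close>.\<close>
  have g: "(\<Sum>s\<in>UNIV. pot (drop_piece m (k, s) X) p) \<le>
      (2 + of_bool (k \<in> R) / 2 - of_bool (k \<in> right_col m ` R)) * pot X p" if k: "k < m" for k
  proof -
    have UB: "(\<Sum>s\<in>UNIV. f s) = f True + f False" for f :: "bool \<Rightarrow> real"
      by (simp add: UNIV_bool)
    consider (R) "k \<in> R" | (right) "k \<in> right_col m ` R" | (other) "k \<notin> R" "k \<notin> right_col m ` R" by blast
    then show ?thesis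
    proof cases
      case R
      then obtain x where x: "x \<in> roof m X" "x \<in> M" "fst (snd x) = k" unfolding R_def by blast
      define t where "t = snd (snd x)"
      have xt: "snd x = (k, t)" using x by (simp add: t_def prod_eq_iff)
      have "pot (drop_piece m (k, \<not> t) X) p = 2 * pot X p"
        using drop_cancel[OF X x(1), of k "\<not> t"] xt pot_remove(1)[OF x(1) F] x(2) by (simp add: M_def)
      moreover have "pot (drop_piece m (k, t) X) p \<le> pot X p / 2"
      proof (rule pot_drop_add(2)[OF X k, of _ x])
        fix z assume z: "z \<in> roof m X"
        show "snd z \<noteq> (k, \<not> t)"
        proof
          assume zk: "snd z = (k, \<not> t)"
          have "x = z" by (rule roof_near_eq[OF X x(1) z]) (simp add: zk x(3))
          then show False using zk xt by simp
        qed
      qed (use x M_def in auto)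
      moreover have "(\<Sum>s\<in>UNIV. pot (drop_piece m (k, s) X) p) =
          pot (drop_piece m (k, t) X) p + pot (drop_piece m (k, \<not> t) X) p"
        unfolding UB by (cases t) simp_all
      moreover have "k \<notin> right_col m ` R" using R disj by blast
      ultimately show ?thesis using R by (simp add: algebra_simps)
    next
      case right
      then obtain x where x: "x \<in> roof m X" "x \<in> M" "k = right_col m (fst (snd x))" unfolding R_def by blast
      have xm: "fst (snd x) < m" using heap_bounds(2)[OF X] x M by blast
      have nr: "near (fst (snd x)) k" "k \<noteq> fst (snd x)" using x(3) near_right col_neq(2)[OF xm] by auto
      have "pot (drop_piece m (k, s) X) p \<le> pot X p / 2" for s
      proof (rule pot_drop_add(2)[OF X k, of _ x])
        show "near k (fst (snd x))" using near_sym[OF k xm] nr by simp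
        show "snd z \<noteq> (k, \<not> s)" if "z \<in> roof m X" for z
          using no_roof[OF x(1) nr that] by auto
      qed (use x M_def in auto)
      from this[of True] this[of False] show ?thesis
        using right disj unfolding UB by auto
    next
      case other
      have "pot (drop_piece m (k, s) X) p \<le> pot X p" for s
      proof (cases "\<exists>x\<in>roof m X. snd x = (k, \<not> s)")
        case True
        then obtain x where x: "x \<in> roof m X" "snd x = (k, \<not> s)" by blast
        then have "x \<notin> M" using other(1) unfolding R_def by force
        then show ?thesis
          using drop_cancel[OF X x] pot_remove(2)[OF x(1) F] by (simp add: M_def)
      next
        case False
        then show ?thesis by (intro pot_drop_add(1)[OF X k]) blast
      qed
      from this[of True] this[of False] show ?thesis
        using other unfolding UB by auto
    qed
  qed
  have "(\<Sum>c\<in>choices. pot (drop_piece m c X) p) = (\<Sum>k<m. \<Sum>s\<in>UNIV. pot (drop_piece m (k, s) X) p)"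
    unfolding choices_def by (subst sum.cartesian_product) (simp add: case_prod_beta)
  also have "\<dots> \<le> (\<Sum>k<m. (2 + of_bool (k \<in> R) / 2 - of_bool (k \<in> right_col m ` R)) * pot X p)"
    by (intro sum_mono g) simp
  also have "\<dots> = (\<Sum>k<m. 2 + of_bool (k \<in> R) / 2 - of_bool (k \<in> right_col m ` R)) * pot X p"
    by (rule sum_distrib_right[symmetric])
  also have "(\<Sum>k<m. 2 + of_bool (k \<in> R) / 2 - of_bool (k \<in> right_col m ` R) :: real) =
      2 * real m + real (card R) / 2 - real (card (right_col m ` R))"
  proof -
    have "(\<Sum>k<m. of_bool (k \<in> A) :: real) = real (card A)" if "A \<subseteq> {..<m}" for A
    proof -
      have "(\<Sum>k<m. of_bool (k \<in> A) :: real) = real (card ({..<m} \<inter> A))"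
        by (simp add: sum.If_cases of_bool_def)
      then show ?thesis using that by (simp add: Int_absorb1)
    qed
    from this[OF Rm] this[of "right_col m ` R"] show ?thesis
      using col_less by (simp add: sum.distrib sum_subtractf sum_divide_distrib[symmetric] image_subset_iff)
  qed
  also have "\<dots> * pot X p \<le> (real (2 * m) - 1 / 2) * pot X p"
    using R1 by (intro mult_right_mono pot_nonneg) (simp add: card_image[OF inj])
  finally show ?thesis .
qed

section \<open>Spirals\<close>

abbreviation shift :: "nat \<Rightarrow> piece \<Rightarrow> piece" where
  "shift a x \<equiv> (fst x + a, snd x)"

text \<open>What is seen of \<open>V\<close> above height \<open>a\<close>, lowered to the ground.
  Two heaps can show the same top while it rests at different heights, so tops are compared in this
  normalized form.\<close>

definition up :: "nat \<Rightarrow> piece set \<Rightarrow> piece set" where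
  "up a V = {x. 1 \<le> fst x \<and> shift a x \<in> V}"

definition full :: "piece set \<Rightarrow> bool" where
  "full X \<longleftrightarrow> (\<forall>k<m. \<exists>x\<in>X. fst (snd x) = k)"

lemma below_shift: "below (shift a x) (shift a y) \<longleftrightarrow> below x y"
  by (simp add: below_def)

lemma inj_shift: "inj (shift a)"
  by (auto intro!: injI simp: prod_eq_iff)

lemma mem_up_shift: "a < fst x \<Longrightarrow> x \<in> V \<Longrightarrow> (fst x - a, snd x) \<in> up a V"
  by (simp add: up_def)

lemma heap_up:
  assumes V: "finite_heap m V"
  shows "finite_heap m (up a V)"
proof (rule heapI)
  have "shift a ` up a V \<subseteq> V" by (auto simp: up_def)
  from finite_imageD[OF finite_subset[OF this heap_finite[OF V]] inj_on_subset[OF inj_shift subset_UNIV]]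
  show "finite (up a V)" .
next
  fix x assume "x \<in> up a V"
  then have x: "1 \<le> fst x" "shift a x \<in> V" by (simp_all add: up_def)
  show "1 \<le> fst x" by (rule x(1))
  show "fst (snd x) < m" using heap_bounds(2)[OF V x(2)] by simp
  show "\<exists>y\<in>up a V. fst y = fst x - 1 \<and> near (fst (snd x)) (fst (snd y))" if "1 < fst x"
  proof -
    have "1 < fst (shift a x)" using that by simp
    then obtain y where y: "y \<in> V" "fst y = fst (shift a x) - 1" "near (fst (snd (shift a x))) (fst (snd y))"
      by (rule heap_support[OF V x(2)])
    then have "(fst y - a, snd y) \<in> up a V" using that by (intro mem_up_shift) simp_all
    then show ?thesis using y by (intro bexI[of _ "(fst y - a, snd y)"]) simp_all
  qed
  fix y assume "y \<in> up a V"
  then have y: "shift a y \<in> V" by (simp add: up_def)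
  show "snd x = snd y" if "fst y = Suc (fst x)" "fst (snd x) = fst (snd y)"
    using heap_consecutive[OF V x(2) y] that by simp
  show "x = y" if "near (fst (snd x)) (fst (snd y))" "fst x = fst y"
    using heap_near_eq[OF V x(2) y] that by (simp add: prod_eq_iff)
qed

text \<open>When every column is occupied above height \<open>a\<close>, each lower piece is blocked
  by one in its own column, and pieces above \<open>a\<close> can only be blocked from above
  \<open>a\<close>. The part beneath is invisible.\<close>

lemma roof_up:
  assumes V: "finite_heap m V" and full: "full (up a V)"
  shows "roof m V = shift a ` roof m (up a V)"
proof (intro set_eqI iffI)
  fix x assume x: "x \<in> roof m V"
  then have xV: "x \<in> V" using roof_subset by blast
  obtain y where y: "y \<in> up a V" "fst (snd y) = fst (snd x)"
    using full heap_bounds(2)[OF V xV] unfolding full_def by blast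
  then have yV: "1 \<le> fst y" "shift a y \<in> V" by (simp_all add: up_def)
  then have "\<not> below x (shift a y)" using x unfolding roof_iff by blast
  then have a: "a < fst x" using y yV by (auto simp: below_def)
  let ?x = "(fst x - a, snd x)"
  have sx: "shift a ?x = x" using a by (simp add: prod_eq_iff)
  have "\<not> below ?x z" if "z \<in> up a V" for z
  proof -
    have "shift a z \<in> V" using that by (simp add: up_def)
    then have "\<not> below (shift a ?x) (shift a z)" unfolding sx using x unfolding roof_iff by blast
    then show ?thesis unfolding below_shift .
  qed
  then have "?x \<in> roof m (up a V)" using mem_up_shift[OF a xV] unfolding roof_iff by blast
  from imageI[OF this, of "shift a"] show "x \<in> shift a ` roof m (up a V)" unfolding sx .
next
  fix x assume "x \<in> shift a ` roof m (up a V)"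
  then obtain y where y: "y \<in> roof m (up a V)" "x = shift a y" by blast
  then have yu: "y \<in> up a V" using roof_subset by blast
  have "\<not> below x z" if z: "z \<in> V" for z
  proof
    assume b: "below x z"
    then have az: "a < fst z" using y by (simp add: below_def)
    have "below y (fst z - a, snd z)" using b y(2) az by (simp add: below_def less_diff_conv)
    then show False using mem_up_shift[OF az z] y(1) unfolding roof_iff by blast
  qed
  moreover have "x \<in> V" using yu y(2) by (simp add: up_def)
  ultimately show "x \<in> roof m V" unfolding roof_iff by blast
qed

text \<open>Fullness puts a piece above height \<open>a\<close> in column \<open>k\<close> itself,
  so the landing height is determined by the part above \<open>a\<close>.\<close>

lemma new_height_up:
  assumes V: "finite_heap m V" and full: "full (up a V)" and k: "k < m"
  shows "new_height V k = new_height (up a V) k + a"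
proof (rule antisym)
  note F = heap_finite[OF V] and FU = heap_finite[OF heap_up[OF V]]
  obtain y where y: "y \<in> up a V" "fst (snd y) = k" using full k unfolding full_def by blast
  then have yV: "1 \<le> fst y" "shift a y \<in> V" by (simp_all add: up_def)
  have gy: "fst y < new_height (up a V) k" using new_height_greater[OF FU y(1)] y(2) by simp
  have gV: "fst y + a < new_height V k" using new_height_greater[OF F yV(2)] y(2) by simp
  have "1 < new_height V k" using gV yV by simp
  then obtain x where x: "x \<in> V" "fst x = new_height V k - 1" "near k (fst (snd x))"
    by (rule new_height_attained[OF F])
  have "a < fst x" using x gV yV by simp
  from new_height_greater[OF FU mem_up_shift[OF this x(1)], of k] x
  show "new_height V k \<le> new_height (up a V) k + a" by simp
  have "1 < new_height (up a V) k" using gy yV by simp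
  then obtain z where z: "z \<in> up a V" "fst z = new_height (up a V) k - 1" "near k (fst (snd z))"
    by (rule new_height_attained[OF FU])
  then have "shift a z \<in> V" by (simp add: up_def)
  from new_height_greater[OF F this, of k] z show "new_height (up a V) k + a \<le> new_height V k" by simp
qed

lemma up_drop:
  assumes V: "finite_heap m V" and full: "full (up a V)" and c: "fst c < m"
  shows "up a (drop_piece m c V) = drop_piece m c (up a V)"
proof -
  obtain k s where c': "c = (k, s)" by (cases c)
  have k: "k < m" using c c' by simp
  note U = heap_up[OF V, of a]
  show ?thesis
  proof (cases "\<exists>x\<in>roof m (up a V). snd x = (k, \<not> s)")
    case True
    then obtain x where x: "x \<in> roof m (up a V)" "snd x = (k, \<not> s)" by blast
    have "shift a x \<in> roof m V" unfolding roof_up[OF V full] using x by blast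
    then have "drop_piece m c V = V - {shift a x}"
      unfolding c' using x by (intro drop_cancel[OF V]) simp_all
    moreover have "up a (V - {shift a x}) = up a V - {x}"
      unfolding up_def by (auto simp: prod_eq_iff)
    ultimately show ?thesis using drop_cancel[OF U x] c' by simp
  next
    case False
    have "drop_piece m c V = insert (new_height V k, k, s) V"
      unfolding c' using False by (intro drop_add[OF V k]) (auto simp: roof_up[OF V full])
    moreover have "drop_piece m c (up a V) = insert (new_height (up a V) k, k, s) (up a V)"
      unfolding c' using False by (intro drop_add[OF U k]) blast
    moreover have "1 \<le> new_height (up a V) k" by (simp add: new_height_def)
    ultimately show ?thesis unfolding new_height_up[OF V full k] by (auto simp: up_def)
  qed
qed

text \<open>A staircase around the cylinder: each step is blocked by the next one, and any
  \<open>m\<close> consecutive steps visit every column.\<close>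

definition spiral :: "nat \<Rightarrow> piece set" where
  "spiral N = (\<lambda>i. (Suc i, i mod m, True)) ` {..<N}"

definition tip :: "nat \<Rightarrow> piece" where
  "tip N = (N, (N - 1) mod m, True)"

lemma spiral_Suc: "spiral (Suc N) = insert (Suc N, N mod m, True) (spiral N)"
  by (simp add: spiral_def lessThan_Suc)

lemma right_mod: "right_col m (i mod m) = Suc i mod m"
  by (simp add: right_col_def mod_Suc_eq)

lemma spiral_below: "below (Suc i, i mod m, True) (Suc (Suc i), Suc i mod m, True)"
  using near_right[of "i mod m"] by (simp add: below_def right_mod)

lemma spiral_full: "m \<le> N \<Longrightarrow> spiral N \<subseteq> X \<Longrightarrow> full X"
  unfolding full_def
proof (intro allI impI)
  fix k assume "m \<le> N" "spiral N \<subseteq> X" "k < m"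
  moreover from this have "(Suc k, k mod m, True) \<in> spiral N"
    unfolding spiral_def by (intro image_eqI[of _ _ k]) auto
  ultimately show "\<exists>x\<in>X. fst (snd x) = k"
    by (intro bexI[of _ "(Suc k, k mod m, True)"]) auto
qed

text \<open>Every step but the last is blocked, so one stripping costs the spiral at most its last
  step.\<close>

lemma spiral_strip:
  assumes "spiral (Suc N) \<subseteq> X"
  shows "spiral N \<subseteq> strip X"
proof
  fix x assume "x \<in> spiral N"
  then obtain i where i: "i < N" "x = (Suc i, i mod m, True)" unfolding spiral_def by blast
  have "(Suc (Suc i), Suc i mod m, True) \<in> X" "x \<in> X" using assms i unfolding spiral_def by auto
  moreover from this have "x \<notin> roof m X" using spiral_below[of i] i(2) unfolding roof_iff by blast
  ultimately show "x \<in> strip X" by blast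
qed

text \<open>As long as \<open>m\<close> steps of the spiral remain, the top part is full and
  stripping commutes with cutting at height \<open>a\<close>. The hypothesis
  \<open>i + m \<le> N\<close> keeps at least \<open>m\<close> steps through \<open>i\<close>
  strippings.\<close>

lemma deep_up:
  assumes V: "finite_heap m V" and S: "spiral N \<subseteq> up a V"
  shows "i + m \<le> N \<Longrightarrow> up a (deep i V) = deep i (up a V) \<and> spiral (N - i) \<subseteq> deep i (up a V)"
proof (induction i)
  case (Suc i)
  then have IH: "up a (deep i V) = deep i (up a V)" "spiral (N - i) \<subseteq> deep i (up a V)" by auto
  have full: "full (up a (deep i V))"
    unfolding IH by (rule spiral_full[OF _ IH(2)]) (use Suc.prems in simp)
  have "up a (strip (deep i V)) = up a (deep i V) - {x. shift a x \<in> roof m (deep i V)}"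
    by (auto simp: up_def)
  also have "{x. shift a x \<in> roof m (deep i V)} = roof m (up a (deep i V))"
    unfolding roof_up[OF heap_deep[OF V] full] by (simp add: inj_image_mem_iff[OF inj_shift])
  finally have "up a (deep (Suc i) V) = deep (Suc i) (up a V)" unfolding deep_Suc IH .
  moreover have "N - i = Suc (N - Suc i)" using Suc.prems by simp
  then have "spiral (N - Suc i) \<subseteq> deep (Suc i) (up a V)"
    unfolding deep_Suc using IH(2) spiral_strip by metis
  ultimately show ?case by blast
qed (use S in simp)

lemma roof_seq_up:
  assumes V: "finite_heap m V" and S: "spiral N \<subseteq> up a V" and i: "i + m \<le> N"
  shows "roof_seq m V i = roof_seq m (up a V) i"
proof -
  have D: "up a (deep i V) = deep i (up a V)" "spiral (N - i) \<subseteq> deep i (up a V)"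
    using deep_up[OF V S i] by auto
  have "full (up a (deep i V))"
    unfolding D by (rule spiral_full[OF _ D(2)]) (use i in simp)
  then have "roof m (deep i V) = shift a ` roof m (up a (deep i V))"
    by (rule roof_up[OF heap_deep[OF V]])
  then show ?thesis
    unfolding roof_seq_def D by (simp add: image_image)
qed

text \<open>The spiral can only be eaten from its tip, since a cancellation removes a removable
  piece and all other steps are blocked. Watching the single piece \<open>tip N\<close> therefore
  suffices.\<close>

lemma spiral_drop:
  assumes X: "finite_heap m X" and S: "spiral N \<subseteq> X" and c: "fst c < m" and N: "0 < N"
  shows "spiral N \<subseteq> drop_piece m c X \<or> tip N \<notin> drop_piece m c X"
proof -
  obtain k s where c': "c = (k, s)" by (cases c)
  show ?thesis
  proof (cases "\<exists>x\<in>roof m X. snd x = (k, \<not> s)")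
    case True
    then obtain x where x: "x \<in> roof m X" "snd x = (k, \<not> s)" by blast
    have d: "drop_piece m c X = X - {x}" unfolding c' by (rule drop_cancel[OF X x])
    obtain M where M: "N = Suc M" using N by (cases N) auto
    have sub: "spiral M \<subseteq> strip X" by (rule spiral_strip) (use S M in simp)
    have N_eq: "spiral N = insert (tip N) (spiral M)"
      unfolding M tip_def spiral_Suc by simp
    show ?thesis
    proof (cases "x = tip N")
      case False
      have "x \<notin> spiral M" using sub x(1) by blast
      then have "x \<notin> spiral N" using False unfolding N_eq by blast
      then have "spiral N \<subseteq> X - {x}" using S by blast
      then show ?thesis unfolding d ..
    next
      case True
      then show ?thesis unfolding d by blast
    qed
  next
    case False
    have "drop_piece m c X = insert (new_height X k, k, s) X"
      unfolding c' by (rule drop_add[OF X]) (use False c c' in auto)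
    then show ?thesis using S by (simp add: subset_insertI2)
  qed
qed

lemma pot_spiral:
  assumes "0 < N"
  shows "pot (spiral N) (tip N) = 1 / 2"
proof -
  have tip: "tip N \<in> spiral N"
    using spiral_Suc[of "N - 1"] assms by (simp add: tip_def)
  have "x = tip N" if "x \<in> above (spiral N) (tip N)" for x
    using that
  proof (induction rule: above.induct)
    case (step x y)
    then have "N < fst y" by (simp add: below_def tip_def)
    moreover have "fst y \<le> N" using step unfolding spiral_def by auto
    ultimately show ?case by simp
  qed simp
  then have "above (spiral N) (tip N) = {tip N}" using above.base[OF tip] by blast
  then show ?thesis by (simp add: pot_def)
qed

section \<open>Building a spiral\<close>

abbreviation drops :: "(nat \<times> sign) list \<Rightarrow> piece set \<Rightarrow> piece set" where
  "drops w V \<equiv> fold (drop_piece m) w V"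

lemma heap_drops: "finite_heap m V \<Longrightarrow> set w \<subseteq> choices \<Longrightarrow> finite_heap m (drops w V)"
  by (induction w arbitrary: V) (auto simp: heap_drop mem_choices)

lemma new_piece_roof:
  assumes V: "finite_heap m V"
  shows "(new_height V k, k, s) \<in> roof m (insert (new_height V k, k, s) V)"
  using new_height_greater[OF heap_finite[OF V], of _ k] by (fastforce simp: roof_iff below_def)

text \<open>Removable pieces are never adjacent. A drop beside a removable piece therefore adds a
  piece whatever its sign, with no knowledge of the rest of the heap.\<close>

lemma no_cancel_next:
  assumes V: "finite_heap m V" and x: "x \<in> roof m V" "near (fst (snd x)) k" "k \<noteq> fst (snd x)"
  shows "z \<in> roof m V \<Longrightarrow> snd z \<noteq> (k, s)"
  using roof_near_eq[OF V x(1), of z] x by auto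

lemma drop_next_to_roof:
  assumes V: "finite_heap m V" and x: "x \<in> roof m V" "near (fst (snd x)) k" "k \<noteq> fst (snd x)" "k < m"
  shows "drop_piece m (k, s) V = insert (new_height V k, k, s) V"
  using no_cancel_next[OF V x(1-3)] x(4) by (intro drop_add[OF V]) blast

text \<open>The same two drops must work for both heaps. If some sign cancels in neither, it is
  dropped twice, the second time only to match the length of the other case. Otherwise both heaps
  already have a removable piece in column 0, and drops in columns 1 and 0 are safe, each being next
  to a removable piece.\<close>

lemma expose_column:
  assumes V: "finite_heap m V" and U: "finite_heap m U"
  obtains w x y where "length w = 2" "set w \<subseteq> choices"
    "x \<in> roof m (drops w V)" "fst (snd x) = 0" "y \<in> roof m (drops w U)" "fst (snd y) = 0"
proof (cases "\<exists>s. (\<forall>x\<in>roof m V. snd x \<noteq> (0, \<not> s)) \<and> (\<forall>x\<in>roof m U. snd x \<noteq> (0, \<not> s))")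
  case True
  then obtain s where s: "\<forall>x\<in>roof m V. snd x \<noteq> (0, \<not> s)" "\<forall>x\<in>roof m U. snd x \<noteq> (0, \<not> s)" by blast
  have *: "\<exists>x\<in>roof m (drops [(0, s), (0, s)] Y). fst (snd x) = 0"
    if Y: "finite_heap m Y" "\<forall>x\<in>roof m Y. snd x \<noteq> (0, \<not> s)" for Y
  proof -
    let ?q = "(new_height Y 0, 0, s)"
    let ?Y = "drop_piece m (0, s) Y"
    have m0: "0 < m" using two_columns by simp
    have d: "?Y = insert ?q Y" using Y(2) m0 by (intro drop_add[OF Y(1)]) auto
    have Y': "finite_heap m ?Y" by (rule heap_drop[OF Y(1)]) (simp add: m0)
    have q: "?q \<in> roof m ?Y" unfolding d by (rule new_piece_roof[OF Y(1)])
    have "snd z \<noteq> (0, \<not> s)" if "z \<in> roof m ?Y" for z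
      using roof_near_eq[OF Y' q that] by auto
    then have "drop_piece m (0, s) ?Y = insert (new_height ?Y 0, 0, s) ?Y"
      by (intro drop_add[OF Y' m0])
    then have "drops [(0, s), (0, s)] Y = insert (new_height ?Y 0, 0, s) ?Y" by simp
    then show ?thesis using new_piece_roof[OF Y', of 0 s] by (intro bexI) auto
  qed
  then show thesis
    using that[of "[(0, s), (0, s)]"] *[OF V s(1)] *[OF U s(2)] two_columns
    by (auto simp: mem_choices)
next
  case False
  have "\<exists>x. (x \<in> roof m V \<or> x \<in> roof m U) \<and> snd x = (0, s)" for s
  proof (rule ccontr)
    assume "\<not> ?thesis"
    then have "(\<forall>x\<in>roof m V. snd x \<noteq> (0, \<not> (\<not> s))) \<and> (\<forall>x\<in>roof m U. snd x \<noteq> (0, \<not> (\<not> s)))"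
      by auto
    then show False using False by blast
  qed
  then obtain x1 x2 where x12: "x1 \<in> roof m V \<or> x1 \<in> roof m U" "snd x1 = (0, True)"
    "x2 \<in> roof m V \<or> x2 \<in> roof m U" "snd x2 = (0, False)" by meson
  \<comment> \<open>One roof has at most one piece in column 0, so the two signs are found on
    different roofs; in particular neither roof is without a piece there.\<close>
  have ne: "\<not> (x1 \<in> roof m Y \<and> x2 \<in> roof m Y)" if "finite_heap m Y" for Y
    using roof_near_eq[OF that, of x1 x2] x12 by auto
  have *: "\<exists>x\<in>roof m (drops [(1, True), (0, True)] Y). fst (snd x) = 0"
    if Y: "finite_heap m Y" and x: "x \<in> roof m Y" "fst (snd x) = 0" for Y x
  proof -
    let ?q = "(new_height Y 1, 1, True)"
    let ?Y = "drop_piece m (1, True) Y"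
    have m0: "0 < m" "1 < m" using two_columns by simp_all
    have n01: "near 0 1" using near_right[of 0] right_col_eq[of 0] two_columns
      by (simp add: near_def split: if_splits)
    have n10: "near 1 0" using n01 near_sym m0 by simp
    have d: "?Y = insert ?q Y"
      by (rule drop_next_to_roof[OF Y x(1)]) (simp_all add: x n01 m0 del: One_nat_def)
    have Y': "finite_heap m ?Y" by (rule heap_drop[OF Y]) (simp add: m0 del: One_nat_def)
    have q: "?q \<in> roof m ?Y" unfolding d by (rule new_piece_roof[OF Y])
    have "drop_piece m (0, True) ?Y = insert (new_height ?Y 0, 0, True) ?Y"
      by (rule drop_next_to_roof[OF Y' q]) (simp_all add: n10 m0 del: One_nat_def)
    then have "drops [(1, True), (0, True)] Y = insert (new_height ?Y 0, 0, True) ?Y" by simp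
    then show ?thesis using new_piece_roof[OF Y', of 0 True] by (intro bexI) auto
  qed
  obtain x y where "x \<in> roof m V" "fst (snd x) = 0" "y \<in> roof m U" "fst (snd y) = 0"
    using x12 ne[OF V] ne[OF U] by (metis fst_conv)
  then show thesis
    using that[of "[(1, True), (0, True)]"] *[OF V, of x] *[OF U, of y] two_columns
    by (auto simp: mem_choices)
qed

text \<open>Going once around levels the unknown heap: each new piece lands above its predecessor
  and above its own column, so it strictly exceeds everything in the columns visited so far. After
  column \<open>m - 1\<close> the last piece is the unique highest one of the heap.\<close>

lemma drops_turn:
  assumes V: "finite_heap m V" and x: "x \<in> roof m V" "fst (snd x) = 0"
  shows "j < m \<Longrightarrow> \<exists>x\<in>roof m (drops (map (\<lambda>j. (j, True)) [1..<Suc j]) V). fst (snd x) = j \<and>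
     (\<forall>y\<in>drops (map (\<lambda>j. (j, True)) [1..<Suc j]) V. fst (snd y) \<le> j \<longrightarrow> y = x \<or> fst y < fst x)"
proof (induction j)
  case 0
  have "y = x \<or> fst y < fst x" if "y \<in> V" "fst (snd y) \<le> 0" for y
  proof -
    have "x \<in> V" using x roof_subset by blast
    from heap_near_cases[OF V this that(1)] show ?thesis
      using x that unfolding roof_iff by (auto simp: below_def)
  qed
  then have "\<forall>y\<in>V. fst (snd y) \<le> 0 \<longrightarrow> y = x \<or> fst y < fst x" by blast
  then show ?case using x by (intro bexI[of _ x] conjI) simp_all
next
  case (Suc j)
  define Y where "Y = drops (map (\<lambda>j. (j, True)) [1..<Suc j]) V"
  define q where "q = (new_height Y (Suc j), Suc j, True)"
  have Y: "finite_heap m Y"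
    unfolding Y_def using Suc.prems by (intro heap_drops[OF V]) (auto simp: mem_choices)
  obtain x where x: "x \<in> roof m Y" "fst (snd x) = j"
    "\<And>y. y \<in> Y \<Longrightarrow> fst (snd y) \<le> j \<Longrightarrow> y = x \<or> fst y < fst x"
    using Suc unfolding Y_def by auto
  have xY: "x \<in> Y" using x(1) roof_subset by blast
  have n: "near j (Suc j)" using near_right[of j] right_col_eq[of j] Suc.prems
    by (simp split: if_splits)
  have n': "near (Suc j) j" using n near_sym Suc.prems by simp
  have d: "drop_piece m (Suc j, True) Y = insert q Y"
    unfolding q_def by (rule drop_next_to_roof[OF Y x(1)]) (simp_all add: x(2) n Suc.prems)
  have Yq: "drops (map (\<lambda>j. (j, True)) [1..<Suc (Suc j)]) V = insert q Y"
  proof -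
    have "[1..<Suc (Suc j)] = [1..<Suc j] @ [Suc j]" by (rule upt_Suc_append) simp
    then have "drops (map (\<lambda>j. (j, True)) [1..<Suc (Suc j)]) V = drop_piece m (Suc j, True) Y"
      unfolding Y_def by (simp del: upt_Suc)
    then show ?thesis unfolding d .
  qed
  have gt: "fst z < fst q" if "z \<in> Y" "near (Suc j) (fst (snd z))" for z
    unfolding q_def using new_height_greater[OF heap_finite[OF Y] that] by simp
  have xq: "fst x < fst q" using gt[OF xY] x(2) n' by simp
  have "y = q \<or> fst y < fst q" if "y \<in> insert q Y" "fst (snd y) \<le> Suc j" for y
  proof (cases "y = q")
    case False
    then have yY: "y \<in> Y" using that by simp
    show ?thesis
    proof (cases "fst (snd y) = Suc j")
      case True
      then show ?thesis using gt[OF yY] by simp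
    next
      case False
      then show ?thesis using x(3)[OF yY] that xq by auto
    qed
  qed simp
  moreover have "q \<in> roof m (insert q Y)" unfolding q_def by (rule new_piece_roof[OF Y])
  ultimately show ?case unfolding Yq by (intro bexI[of _ q]) (auto simp: q_def)
qed

text \<open>The last piece is always a highest one, so the next lands exactly one higher and nothing
  old shows above the starting height. The column \<open>(N + m - 1) mod m\<close> is that of the
  last piece; for \<open>N = 0\<close> this piece is \<open>x\<close>, whose sign is arbitrary,
  hence the existential quantifier.\<close>

lemma drops_spiral:
  assumes V: "finite_heap m V" and x: "x \<in> roof m V" "fst (snd x) = m - 1"
    and max: "\<And>y. y \<in> V \<Longrightarrow> y = x \<or> fst y < fst x"
  shows "up (fst x) (drops (map (\<lambda>i. (i mod m, True)) [0..<N]) V) = spiral N \<and>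
    (\<exists>s. (fst x + N, (N + m - 1) mod m, s) \<in> drops (map (\<lambda>i. (i mod m, True)) [0..<N]) V) \<and>
    (\<forall>y\<in>drops (map (\<lambda>i. (i mod m, True)) [0..<N]) V. fst y \<le> fst x + N)"
proof (induction N)
  case 0
  have xV: "x \<in> V" using x roof_subset by blast
  have le: "fst y \<le> fst x" if "y \<in> V" for y using max[OF that] by auto
  have "\<not> (1 \<le> fst y \<and> shift (fst x) y \<in> V)" for y
    using le[of "shift (fst x) y"] by auto
  then have "up (fst x) V = {}" unfolding up_def by blast
  moreover have "(m - 1) mod m = m - 1" using two_columns by simp
  then have "(fst x, (m - 1) mod m, snd (snd x)) = x" using x(2) by (simp add: prod_eq_iff)
  then have "\<exists>s. (fst x, (m - 1) mod m, s) \<in> V" using xV by metis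
  ultimately show ?case using le by (simp add: spiral_def)
next
  case (Suc N)
  define Y where "Y = drops (map (\<lambda>i. (i mod m, True)) [0..<N]) V"
  define k where "k = N mod m"
  define q where "q = (new_height Y k, k, True)"
  have Y: "finite_heap m Y"
    unfolding Y_def using two_columns by (intro heap_drops[OF V]) (auto simp: mem_choices)
  obtain s where s: "(fst x + N, (N + m - 1) mod m, s) \<in> Y"
    and up: "up (fst x) Y = spiral N" and le: "\<And>y. y \<in> Y \<Longrightarrow> fst y \<le> fst x + N"
    using Suc.IH unfolding Y_def[symmetric] by blast
  let ?t = "(fst x + N, (N + m - 1) mod m, s)"
  have "\<not> below ?t y" if "y \<in> Y" for y using le[OF that] by (simp add: below_def)
  then have t: "?t \<in> roof m Y" using s unfolding roof_iff by blast
  have km: "k < m" using two_columns by (simp add: k_def)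
  have r: "right_col m ((N + m - 1) mod m) = k"
    unfolding right_mod k_def using two_columns by simp
  have tm: "(N + m - 1) mod m < m" using two_columns by simp
  have n: "near ((N + m - 1) mod m) k" "k \<noteq> (N + m - 1) mod m"
    using near_right col_neq(2)[OF tm] unfolding r[symmetric] by auto
  have d: "drop_piece m (k, True) Y = insert q Y"
    unfolding q_def by (rule drop_next_to_roof[OF Y t]) (use n km in simp_all)
  have Yq: "drops (map (\<lambda>i. (i mod m, True)) [0..<Suc N]) V = insert q Y"
  proof -
    have "drops (map (\<lambda>i. (i mod m, True)) [0..<Suc N]) V = drop_piece m (k, True) Y"
      unfolding Y_def k_def by simp
    then show ?thesis unfolding d .
  qed
  have "fst x + N < new_height Y k"
    using new_height_greater[OF heap_finite[OF Y] s] near_sym[OF km tm] n by simp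
  moreover have "new_height Y k \<le> fst x + Suc N"
  proof (rule ccontr)
    assume nl: "\<not> ?thesis"
    then have "1 < new_height Y k" by simp
    then obtain z where "z \<in> Y" "fst z = new_height Y k - 1" "near k (fst (snd z))"
      by (rule new_height_attained[OF heap_finite[OF Y]])
    then show False using le[of z] nl by simp
  qed
  ultimately have nh: "new_height Y k = fst x + Suc N" by simp
  have "up (fst x) (insert q Y) = insert (Suc N, k, True) (up (fst x) Y)"
    unfolding up_def q_def nh by (auto simp: prod_eq_iff)
  then have "up (fst x) (insert q Y) = spiral (Suc N)" unfolding up spiral_Suc k_def .
  moreover have "(Suc N + m - 1) mod m = k" by (simp add: k_def)
  then have "(fst x + Suc N, (Suc N + m - 1) mod m, True) \<in> insert q Y" unfolding q_def nh by simp
  moreover have "fst y \<le> fst x + Suc N" if "y \<in> insert q Y" for y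
    using that le[of y] unfolding q_def nh by auto
  ultimately show ?case unfolding Yq by blast
qed

text \<open>The word depends on the two heaps, but its length \<open>2 + (m - 1) + N\<close> does
  not, so its probability has a uniform lower bound.\<close>

lemma build_spiral:
  assumes V: "finite_heap m V" and U: "finite_heap m U"
  obtains w a b where "length w = m + 1 + N" "set w \<subseteq> choices"
    "up a (drops w V) = spiral N" "up b (drops w U) = spiral N"
proof -
  obtain w0 x y where w0: "length w0 = 2" "set w0 \<subseteq> choices"
    and x: "x \<in> roof m (drops w0 V)" "fst (snd x) = 0"
    and y: "y \<in> roof m (drops w0 U)" "fst (snd y) = 0"
    by (rule expose_column[OF V U])
  define w1 where "w1 = map (\<lambda>j. (j, True)) [1..<m]"
  define w2 where "w2 = map (\<lambda>i. (i mod m, True)) [0..<N]"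
  have w1: "set w1 \<subseteq> choices" by (auto simp: w1_def mem_choices)
  have w2: "set w2 \<subseteq> choices" using two_columns by (auto simp: w2_def mem_choices)
  have *: "\<exists>a. up a (drops (w0 @ w1 @ w2) Y) = spiral N"
    if Y: "finite_heap m Y" and x: "x \<in> roof m (drops w0 Y)" "fst (snd x) = 0" for Y x
  proof -
    have H: "finite_heap m (drops w1 (drops w0 Y))"
      by (intro heap_drops Y w0 w1)
    have "[1..<Suc (m - 1)] = [1..<m]" "m - 1 < m" using two_columns by auto
    then obtain z where z: "z \<in> roof m (drops w1 (drops w0 Y))" "fst (snd z) = m - 1"
      "\<And>y. y \<in> drops w1 (drops w0 Y) \<Longrightarrow> fst (snd y) \<le> m - 1 \<Longrightarrow> y = z \<or> fst y < fst z"
      using drops_turn[OF heap_drops[OF Y w0(2)] x, of "m - 1"] unfolding w1_def by auto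
    have "y = z \<or> fst y < fst z" if "y \<in> drops w1 (drops w0 Y)" for y
      using z(3)[OF that] heap_bounds(2)[OF H that] by simp
    from drops_spiral[OF H z(1,2) this, of N] show ?thesis
      unfolding w2_def[symmetric] by auto
  qed
  obtain a b where "up a (drops (w0 @ w1 @ w2) V) = spiral N" "up b (drops (w0 @ w1 @ w2) U) = spiral N"
    using *[OF V x] *[OF U y] by blast
  moreover have "length (w0 @ w1 @ w2) = m + 1 + N"
    using w0 two_columns by (simp add: w1_def w2_def)
  moreover have "set (w0 @ w1 @ w2) \<subseteq> choices" using w0 w1 w2 by simp
  ultimately show thesis using that by blast
qed

section \<open>Coupling two heaps\<close>

abbreviation drop_pair :: "nat \<times> sign \<Rightarrow> piece set \<times> piece set \<Rightarrow> piece set \<times> piece set" where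
  "drop_pair c \<equiv> \<lambda>(V, U). (drop_piece m c V, drop_piece m c U)"

abbreviation heap_pairs :: "(piece set \<times> piece set) set" where
  "heap_pairs \<equiv> {V. finite_heap m V} \<times> {V. finite_heap m V}"

definition roofs_differ :: "nat \<Rightarrow> piece set \<times> piece set \<Rightarrow> real" where
  "roofs_differ l = (\<lambda>(V, U). of_bool (top_roofs l (roof_seq m V) \<noteq> top_roofs l (roof_seq m U)))"

text \<open>The cutting heights may differ, but what is above them is the same heap
  \<open>X\<close>. The spiral stands at the bottom of \<open>X\<close> and seals off the parts in
  which the two heaps differ.\<close>

definition common_spiral :: "nat \<Rightarrow> piece set \<Rightarrow> piece set \<Rightarrow> piece set \<Rightarrow> bool" where
  "common_spiral N V U X \<longleftrightarrow> (\<exists>a b. up a V = X \<and> up b U = X) \<and> spiral N \<subseteq> X"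

lemma heap_pairs_closed: "c \<in> choices \<Longrightarrow> p \<in> heap_pairs \<Longrightarrow> drop_pair c p \<in> heap_pairs"
  by (auto simp: mem_choices heap_drop)

lemma roofs_differ_le_1: "roofs_differ l p \<le> 1"
  by (simp add: roofs_differ_def split: prod.split)

lemma fold_drop_pair: "fold drop_pair w (V, U) = (drops w V, drops w U)"
  by (induction w arbitrary: V U) simp_all

lemma common_spiral_roofs:
  assumes V: "finite_heap m V" and U: "finite_heap m U" and S: "common_spiral (m + l) V U X"
  shows "roofs_differ l (V, U) = 0"
proof -
  obtain a b where ab: "up a V = X" "up b U = X" "spiral (m + l) \<subseteq> X"
    using S unfolding common_spiral_def by blast
  have "roof_seq m V i = roof_seq m U i" if "i < l" for i
    using roof_seq_up[OF V, of "m + l" a i] roof_seq_up[OF U, of "m + l" b i] ab that by simp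
  then show ?thesis by (simp add: roofs_differ_def top_roofs_eq_iff)
qed

lemma common_spiral_heap: "finite_heap m V \<Longrightarrow> common_spiral N V U X \<Longrightarrow> finite_heap m X"
  unfolding common_spiral_def using heap_up by blast

lemma common_spiral_drop:
  assumes V: "finite_heap m V" and U: "finite_heap m U" and S: "common_spiral N V U X"
    and N: "m \<le> N" and c: "c \<in> choices"
  shows "common_spiral N (drop_piece m c V) (drop_piece m c U) (drop_piece m c X) \<or>
    tip N \<notin> drop_piece m c X"
proof -
  obtain a b where ab: "up a V = X" "up b U = X" and X: "spiral N \<subseteq> X"
    using S unfolding common_spiral_def by blast
  have c: "fst c < m" using c by (simp add: mem_choices)
  have full: "full X" by (rule spiral_full[OF N X])
  have "up a (drop_piece m c V) = drop_piece m c X" "up b (drop_piece m c U) = drop_piece m c X"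
    using up_drop[OF V _ c, of a] up_drop[OF U _ c, of b] ab full by simp_all
  moreover have "0 < N" using N two_columns by simp
  ultimately show ?thesis
    using spiral_drop[OF common_spiral_heap[OF V S] X c] unfolding common_spiral_def by blast
qed

text \<open>A renewal argument carried out as one strong induction: building the spiral gains a
  factor \<open>1/2\<close> in the bound, the potential controls the time while it stands, and its
  loss leads back to the bound for arbitrary heaps.\<close>

theorem coupling:
  obtains C \<rho> :: real where "0 < \<rho>" "\<rho> < 1"
    "\<And>n V U. finite_heap m V \<Longrightarrow> finite_heap m U \<Longrightarrow> walk drop_pair n (roofs_differ l) (V, U) \<le> C * \<rho> ^ n"
proof -
  define N where "N = m + l"
  define L where "L = m + 1 + N"
  define q where "q = 1 / real (2 * m) ^ L"
  \<comment> \<open>Two demands meet here: \<rho> is at least \<open>1 - 1/(4m)\<close>, the factor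
    in \<open>pot_drift\<close>, and \<open>\<rho> ^ L\<close> is at least \<open>1 - q/2\<close>,
    the factor gained by \<open>L\<close> building drops of probability \<open>q\<close>. The second
    follows from Bernoulli's inequality.\<close>
  define \<rho> where "\<rho> = 1 - q / (2 * real L)"
  \<comment> \<open>Makes the bound at least 1, hence trivial, for \<open>n < L\<close>.\<close>
  define C where "C = 1 / \<rho> ^ L"
  have m1: "1 \<le> real (2 * m)" using two_columns by simp
  have L1: "1 \<le> L" by (simp add: L_def)
  have q0: "0 < q" using two_columns by (simp add: q_def)
  have "real (2 * m) ^ 1 \<le> real (2 * m) ^ L" by (rule power_increasing[OF L1 m1])
  then have qm: "q \<le> 1 / real (2 * m)"
    unfolding q_def using m1 by (intro divide_left_mono) simp_all
  then have q1: "q \<le> 1" using m1 by (simp add: order_trans[OF qm])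
  have qL: "q / (2 * real L) \<le> q / 2"
    using L1 q0 by (intro divide_left_mono) simp_all
  have \<rho>1: "\<rho> < 1" using q0 L1 by (simp add: \<rho>_def)
  have \<rho>m: "1 - 1 / (4 * real m) \<le> \<rho>"
    using qL qm by (simp add: \<rho>_def)
  have \<rho>0: "0 < \<rho>" using qL q1 by (simp add: \<rho>_def)
  have "1 + real L * (- (q / (2 * real L))) \<le> (1 + (- (q / (2 * real L)))) ^ L"
    by (rule Bernoulli_inequality) (use qL q1 in simp)
  then have \<rho>L: "1 - q / 2 \<le> \<rho> ^ L"
    using L1 by (simp add: \<rho>_def)
  have C0: "0 < C" using \<rho>0 by (simp add: C_def)
  let ?w = "\<lambda>n. walk drop_pair n (roofs_differ l)"
  have step: "?w (Suc n) (V, U) \<le> B"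
    if "(\<Sum>c\<in>choices. ?w n (drop_piece m c V, drop_piece m c U)) \<le> real (2 * m) * B" for n V U B
  proof -
    have "(\<Sum>c\<in>choices. ?w n (drop_piece m c V, drop_piece m c U)) / real (2 * m) \<le> B"
      using that two_m_pos by (simp only: pos_divide_le_eq mult.commute)
    then show ?thesis by simp
  qed
  \<comment> \<open>The second bound is the first one multiplied by the potential of the tip. Each
    uses the other: a lost tip needs the first, a finished spiral the second.\<close>
  have "(\<forall>V U. finite_heap m V \<longrightarrow> finite_heap m U \<longrightarrow> ?w n (V, U) \<le> C * \<rho> ^ n) \<and>
    (\<forall>V U X. finite_heap m V \<longrightarrow> finite_heap m U \<longrightarrow> common_spiral N V U X \<longrightarrow>
       ?w n (V, U) \<le> C * \<rho> ^ n * pot X (tip N))" for n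
  proof (induction n rule: less_induct)
    case (less n)
    have gen: "?w k (V, U) \<le> C * \<rho> ^ k" if "k < n" "finite_heap m V" "finite_heap m U" for k V U
      using less that by blast
    have spi: "?w k (V, U) \<le> C * \<rho> ^ k * pot X (tip N)"
      if "k < n" "finite_heap m V" "finite_heap m U" "common_spiral N V U X" for k V U X
      using less that by blast
    have spi_n: "?w n (V, U) \<le> C * \<rho> ^ n * pot X (tip N)"
      if V: "finite_heap m V" and U: "finite_heap m U" and S: "common_spiral N V U X" for V U X
    proof (cases n)
      case 0
      then show ?thesis
        using common_spiral_roofs[OF V U] S C0 \<rho>0 pot_nonneg unfolding N_def by simp
    next
      case (Suc k)
      have X: "finite_heap m X" by (rule common_spiral_heap[OF V S])
      have mN: "m \<le> N" "0 < N" using two_columns by (simp_all add: N_def)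
      have tip: "tip N \<in> X"
      proof -
        have "tip N \<in> spiral N" using spiral_Suc[of "N - 1"] mN by (simp add: tip_def)
        then show ?thesis using S unfolding common_spiral_def by blast
      qed
      have "?w k (drop_piece m c V, drop_piece m c U) \<le> C * \<rho> ^ k * pot (drop_piece m c X) (tip N)"
        if c: "c \<in> choices" for c
      proof -
        have H: "finite_heap m (drop_piece m c V)" "finite_heap m (drop_piece m c U)"
          using V U c by (auto simp: heap_drop mem_choices)
        from common_spiral_drop[OF V U S mN(1) c] show ?thesis
        proof
          \<comment> \<open>The potential of an absent piece is 1, so the bound for arbitrary heaps
            is just what is required.\<close>
          assume "tip N \<notin> drop_piece m c X"
          then show ?thesis using gen[OF _ H, of k] Suc by (simp add: pot_absent)
        qed (use spi[OF _ H] Suc in simp)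
      qed
      then have "(\<Sum>c\<in>choices. ?w k (drop_piece m c V, drop_piece m c U)) \<le>
          (\<Sum>c\<in>choices. C * \<rho> ^ k * pot (drop_piece m c X) (tip N))" by (rule sum_mono)
      also have "\<dots> = C * \<rho> ^ k * (\<Sum>c\<in>choices. pot (drop_piece m c X) (tip N))"
        by (rule sum_distrib_left[symmetric])
      also have "\<dots> \<le> C * \<rho> ^ k * ((real (2 * m) - 1 / 2) * pot X (tip N))"
        using C0 \<rho>0 by (intro mult_left_mono pot_drift[OF X tip]) simp
      also have "\<dots> = C * \<rho> ^ k * (real (2 * m) * (1 - 1 / (4 * real m)) * pot X (tip N))"
        using two_columns by (simp add: field_simps)
      also have "\<dots> \<le> C * \<rho> ^ k * (real (2 * m) * \<rho> * pot X (tip N))"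
        using C0 \<rho>0 \<rho>m m1 by (intro mult_left_mono mult_right_mono pot_nonneg) simp_all
      finally have "(\<Sum>c\<in>choices. ?w k (drop_piece m c V, drop_piece m c U)) \<le>
          real (2 * m) * (C * \<rho> ^ n * pot X (tip N))" by (simp add: Suc mult_ac)
      then show ?thesis unfolding Suc by (rule step)
    qed
    have gen_n: "?w n (V, U) \<le> C * \<rho> ^ n" if V: "finite_heap m V" and U: "finite_heap m U" for V U
    proof (cases "n < L")
      case True
      have "?w n (V, U) \<le> walk drop_pair n (\<lambda>_. 1) (V, U)"
        by (rule walk_mono[of _ UNIV]) (simp_all add: roofs_differ_le_1)
      then have "?w n (V, U) \<le> 1" by simp
      also have "1 \<le> C * \<rho> ^ n"
        using power_decreasing[of n L \<rho>] \<rho>0 \<rho>1 True by (simp add: C_def field_simps)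
      finally show ?thesis .
    next
      case False
      then have n: "n - L + L = n" "n - L < n" using L1 by simp_all
      let ?B = "C * \<rho> ^ (n - L)"
      have B0: "0 \<le> ?B" using C0 \<rho>0 by simp
      obtain w a b where w: "length w = m + 1 + N" "set w \<subseteq> choices"
        "up a (drops w V) = spiral N" "up b (drops w U) = spiral N"
        by (rule build_spiral[OF V U])
      have S: "common_spiral N (drops w V) (drops w U) (spiral N)"
        unfolding common_spiral_def using w by blast
      have "0 < N" using two_columns by (simp add: N_def)
      \<comment> \<open>The bare spiral has only the tip itself above the tip, hence potential
        \<open>1/2\<close>.\<close>
      then have "?w (n - L) (fold drop_pair w (V, U)) \<le> ?B - ?B / 2"
        using spi[OF n(2) heap_drops[OF V w(2)] heap_drops[OF U w(2)] S]
        by (simp add: fold_drop_pair pot_spiral)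
      then have "?w (n - L + length w) (V, U) \<le> ?B - ?B / 2 / real (2 * m) ^ length w"
        by (rule walk_word[where S = heap_pairs, rotated 4])
          (use heap_pairs_closed gen[OF n(2)] V U w in auto)
      also have "\<dots> = ?B * (1 - q / 2)"
        by (simp add: q_def w(1) L_def algebra_simps)
      also have "\<dots> \<le> ?B * \<rho> ^ L" by (rule mult_left_mono[OF \<rho>L B0])
      also have "\<dots> = C * \<rho> ^ (n - L + L)" by (simp only: power_add mult.assoc)
      finally show ?thesis unfolding w(1) L_def[symmetric] n(1) .
    qed
    show ?case using gen_n spi_n by blast
  qed
  then show thesis using \<rho>0 \<rho>1 that by blast
qed

section \<open>The walk on generalized heaps\<close>

definition depends :: "nat \<Rightarrow> ((nat \<Rightarrow> config) \<Rightarrow> 'x) \<Rightarrow> bool" where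
  "depends l F \<longleftrightarrow>
     (\<forall>W\<in>gen_heaps m. \<forall>W'\<in>gen_heaps m. top_roofs l W = top_roofs l W' \<longrightarrow> F W = F W')"

abbreviation gen_walk :: "nat \<Rightarrow> ((nat \<Rightarrow> config) \<Rightarrow> real) \<Rightarrow> (nat \<Rightarrow> config) \<Rightarrow> real" where
  "gen_walk \<equiv> walk (gen_drop m)"

abbreviation no_roofs :: "nat \<Rightarrow> config" where
  "no_roofs \<equiv> roof_seq m {}"

lemma no_roofs_mem: "no_roofs \<in> gen_heaps m"
  by (simp add: roof_seq_gen_heap)

lemma gen_heaps_closed: "c \<in> choices \<Longrightarrow> W \<in> gen_heaps m \<Longrightarrow> gen_drop m c W \<in> gen_heaps m"
  by (simp add: mem_choices gen_drop_mem)

lemma dependsI: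
  "(\<And>W W'. W \<in> gen_heaps m \<Longrightarrow> W' \<in> gen_heaps m \<Longrightarrow> top_roofs l W = top_roofs l W' \<Longrightarrow> F W = F W') \<Longrightarrow>
     depends l F"
  unfolding depends_def by blast

lemma dependsD:
  "depends l F \<Longrightarrow> W \<in> gen_heaps m \<Longrightarrow> W' \<in> gen_heaps m \<Longrightarrow> top_roofs l W = top_roofs l W' \<Longrightarrow> F W = F W'"
  unfolding depends_def by blast

lemma depends_mono:
  assumes "depends l F" "l \<le> l'"
  shows "depends l' F"
proof -
  have "top_roofs l W = top_roofs l W'" if "top_roofs l' W = top_roofs l' W'" for W W' :: "nat \<Rightarrow> config"
    using that assms(2) by (simp add: top_roofs_eq_iff)
  then show ?thesis using assms(1) unfolding depends_def by blast
qed

text \<open>Each drop may lift one more roof into view.\<close>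

lemma depends_walk:
  assumes "depends l F"
  shows "depends (l + n) (gen_walk n F)"
proof (induction n)
  case (Suc n)
  show ?case
  proof (rule dependsI)
    fix W W' assume W: "W \<in> gen_heaps m" "W' \<in> gen_heaps m" and eq: "top_roofs (l + Suc n) W = top_roofs (l + Suc n) W'"
    have "gen_walk n F (gen_drop m c W) = gen_walk n F (gen_drop m c W')" if c: "c \<in> choices" for c
    proof (rule dependsD[OF Suc gen_heaps_closed[OF c W(1)] gen_heaps_closed[OF c W(2)]])
      show "top_roofs (l + n) (gen_drop m c W) = top_roofs (l + n) (gen_drop m c W')"
        by (rule gen_drop_cong[OF W]) (use c eq in \<open>simp_all add: mem_choices\<close>)
    qed
    then show "gen_walk (Suc n) F W = gen_walk (Suc n) F W'" by simp
  qed
qed (use assms in simp)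

lemma walk_roof_seq:
  "finite_heap m V \<Longrightarrow> gen_walk n F (roof_seq m V) = walk (drop_piece m) n (\<lambda>U. F (roof_seq m U)) V"
  by (rule walk_image[where S = "{V. finite_heap m V}"]) (auto simp: mem_choices heap_drop gen_drop_roof_seq)

lemma walk_bounds:
  assumes "W \<in> gen_heaps m" "\<And>W. W \<in> gen_heaps m \<Longrightarrow> 0 \<le> F W \<and> F W \<le> 1"
  shows "0 \<le> gen_walk n F W \<and> gen_walk n F W \<le> 1"
proof -
  have "gen_walk n (\<lambda>_. 0) W \<le> gen_walk n F W" "gen_walk n F W \<le> gen_walk n (\<lambda>_. 1) W"
    by (rule walk_mono[OF assms(1) gen_heaps_closed]; simp add: assms(2))+
  then show ?thesis by simp
qed

text \<open>The constants depend on \<open>l\<close> alone and not on \<open>F\<close>; this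
  uniformity becomes convergence in total variation at the end.\<close>

lemma gen_coupling:
  obtains C \<rho> :: real where "0 < \<rho>" "\<rho> < 1"
    "\<And>n F W W'. depends l F \<Longrightarrow> (\<And>W. W \<in> gen_heaps m \<Longrightarrow> 0 \<le> F W \<and> F W \<le> 1) \<Longrightarrow>
      W \<in> gen_heaps m \<Longrightarrow> W' \<in> gen_heaps m \<Longrightarrow> \<bar>gen_walk n F W - gen_walk n F W'\<bar> \<le> C * \<rho> ^ n"
proof -
  obtain C \<rho> :: real where \<rho>: "0 < \<rho>" "\<rho> < 1" and bound:
    "\<And>n V U. finite_heap m V \<Longrightarrow> finite_heap m U \<Longrightarrow> walk drop_pair n (roofs_differ l) (V, U) \<le> C * \<rho> ^ n"
    by (rule coupling[of l]) blast
  have "\<bar>gen_walk n F W - gen_walk n F W'\<bar> \<le> C * \<rho> ^ n"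
    if F: "depends l F" "\<And>W. W \<in> gen_heaps m \<Longrightarrow> 0 \<le> F W \<and> F W \<le> 1"
      and W: "W \<in> gen_heaps m" "W' \<in> gen_heaps m" for n F W W'
  proof -
    let ?G = "\<lambda>U. F (roof_seq m U)"
    \<comment> \<open>During \<open>n\<close> drops only the first \<open>l + n\<close> roofs
      matter, so an infinite heap may be replaced by the finite heap with these roofs.\<close>
    have fin: "\<exists>V. finite_heap m V \<and> gen_walk n F W = walk (drop_piece m) n ?G V" if W: "W \<in> gen_heaps m" for W
    proof -
      let ?V = "heap_with_roofs m (top_roofs (l + n) W)"
      have V: "finite_heap m ?V" by (rule heap_with_roofs(1)[OF W])
      have "top_roofs (l + n) W = top_roofs (l + n) (roof_seq m ?V)"
        by (simp add: top_roofs_eq_iff heap_with_roofs(2)[OF W])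
      then have "gen_walk n F W = gen_walk n F (roof_seq m ?V)"
        using depends_walk[OF F(1), of n] W roof_seq_gen_heap[OF V] unfolding depends_def by blast
      then show ?thesis using V walk_roof_seq[OF V] by metis
    qed
    obtain V U where V: "finite_heap m V" "gen_walk n F W = walk (drop_piece m) n ?G V"
      and U: "finite_heap m U" "gen_walk n F W' = walk (drop_piece m) n ?G U"
      using fin[OF W(1)] fin[OF W(2)] by blast
    have 1: "walk (drop_piece m) n ?G V = walk drop_pair n (\<lambda>p. ?G (fst p)) (V, U)"
      using walk_image[of "(V, U)" UNIV drop_pair fst "drop_piece m" n ?G] by auto
    have 2: "walk (drop_piece m) n ?G U = walk drop_pair n (\<lambda>p. ?G (snd p)) (V, U)"
      using walk_image[of "(V, U)" UNIV drop_pair snd "drop_piece m" n ?G] by auto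
    have "\<bar>gen_walk n F W - gen_walk n F W'\<bar> \<le> walk drop_pair n (\<lambda>p. \<bar>?G (fst p) - ?G (snd p)\<bar>) (V, U)"
      unfolding V(2) U(2) 1 2 by (rule walk_diff_le)
    also have "\<dots> \<le> walk drop_pair n (roofs_differ l) (V, U)"
    proof (rule walk_mono[where S = heap_pairs])
      show "(V, U) \<in> heap_pairs" using V U by simp
      show "drop_pair c p \<in> heap_pairs" if "c \<in> choices" "p \<in> heap_pairs" for c p
        by (rule heap_pairs_closed[OF that])
      fix p assume "p \<in> heap_pairs"
      then have p: "finite_heap m (fst p)" "finite_heap m (snd p)" by auto
      note g = roof_seq_gen_heap[OF p(1)] roof_seq_gen_heap[OF p(2)]
      show "\<bar>?G (fst p) - ?G (snd p)\<bar> \<le> roofs_differ l p"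
      proof (cases "top_roofs l (roof_seq m (fst p)) = top_roofs l (roof_seq m (snd p))")
        case True
        then have "?G (fst p) = ?G (snd p)" using F(1) g unfolding depends_def by blast
        then show ?thesis by (simp add: roofs_differ_def case_prod_beta)
      next
        case False
        then show ?thesis using F(2)[OF g(1)] F(2)[OF g(2)]
          by (simp add: roofs_differ_def case_prod_beta abs_le_iff)
      qed
    qed
    also have "\<dots> \<le> C * \<rho> ^ n" by (rule bound[OF V(1) U(1)])
    finally show ?thesis .
  qed
  then show thesis by (intro that[OF \<rho>]) blast
qed

section \<open>Limits of the averages\<close>

definition mean :: "((nat \<Rightarrow> config) \<Rightarrow> real) \<Rightarrow> real" where
  "mean F = lim (\<lambda>n. gen_walk n F no_roofs)"

lemma walk_mean:
  obtains C \<rho> :: real where "0 < \<rho>" "\<rho> < 1"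
    "\<And>n F W. depends l F \<Longrightarrow> (\<And>W. W \<in> gen_heaps m \<Longrightarrow> 0 \<le> F W \<and> F W \<le> 1) \<Longrightarrow>
      W \<in> gen_heaps m \<Longrightarrow> \<bar>gen_walk n F W - mean F\<bar> \<le> C * \<rho> ^ n"
proof -
  obtain C \<rho> :: real where \<rho>: "0 < \<rho>" "\<rho> < 1" and bound:
    "\<And>n F W W'. depends l F \<Longrightarrow> (\<And>W. W \<in> gen_heaps m \<Longrightarrow> 0 \<le> F W \<and> F W \<le> 1) \<Longrightarrow>
      W \<in> gen_heaps m \<Longrightarrow> W' \<in> gen_heaps m \<Longrightarrow> \<bar>gen_walk n F W - gen_walk n F W'\<bar> \<le> C * \<rho> ^ n"
    by (rule gen_coupling[of l]) blast
  have to0: "(\<lambda>n. C * \<rho> ^ n) \<longlonglongrightarrow> 0"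
    using \<rho> by (intro tendsto_mult_right_zero LIMSEQ_realpow_zero) simp_all
  have "\<bar>gen_walk n F W - mean F\<bar> \<le> C * \<rho> ^ n"
    if F: "depends l F" "\<And>W. W \<in> gen_heaps m \<Longrightarrow> 0 \<le> F W \<and> F W \<le> 1" and W: "W \<in> gen_heaps m" for n F W
  proof -
    let ?f = "\<lambda>n. gen_walk n F no_roofs"
    \<comment> \<open>The value after \<open>n + k\<close> drops is the average of
      \<open>gen_walk n F\<close> over the heap reached after the first \<open>k\<close> drops, and
      \<open>gen_walk n F\<close> hardly depends on the heap.\<close>
    have later: "\<bar>gen_walk n F W - ?f (n + k)\<bar> \<le> C * \<rho> ^ n" if W: "W \<in> gen_heaps m" for n k W
    proof -
      have "\<bar>walk (gen_drop m) k (\<lambda>_. gen_walk n F W) no_roofs - walk (gen_drop m) k (gen_walk n F) no_roofs\<bar>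
          \<le> gen_walk k (\<lambda>W'. \<bar>gen_walk n F W - gen_walk n F W'\<bar>) no_roofs"
        by (rule walk_diff_le)
      also have "\<dots> \<le> gen_walk k (\<lambda>_. C * \<rho> ^ n) no_roofs"
        by (rule walk_mono[OF no_roofs_mem gen_heaps_closed bound[OF F W]])
      finally show ?thesis by (simp add: walk_add)
    qed
    have "Cauchy ?f"
    proof (rule CauchyI')
      fix e :: real assume "0 < e"
      then obtain M where M: "\<And>n. M \<le> n \<Longrightarrow> \<bar>C * \<rho> ^ n\<bar> < e"
        using LIMSEQ_D[OF to0] by (auto simp: real_norm_def)
      have "dist (?f i) (?f j) < e" if "M \<le> i" "i < j" for i j
      proof -
        have "\<bar>?f i - ?f (i + (j - i))\<bar> \<le> C * \<rho> ^ i" by (rule later[OF no_roofs_mem])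
        then show ?thesis using M[OF that(1)] that(2) by (simp add: dist_real_def)
      qed
      then show "\<exists>M. \<forall>i\<ge>M. \<forall>j>i. dist (?f i) (?f j) < e" by blast
    qed
    then have "?f \<longlonglongrightarrow> mean F"
      unfolding mean_def by (simp add: Cauchy_convergent_iff convergent_LIMSEQ_iff)
    then have "(\<lambda>k. \<bar>gen_walk n F W - ?f (k + n)\<bar>) \<longlonglongrightarrow> \<bar>gen_walk n F W - mean F\<bar>"
      by (intro tendsto_intros LIMSEQ_ignore_initial_segment)
    then show ?thesis
      by (rule Lim_bounded) (use later[OF W, of n] in \<open>simp add: add.commute\<close>)
  qed
  then show thesis by (intro that[OF \<rho>]) blast
qed

lemma mean_tendsto:
  assumes F: "depends l F" "\<And>W. W \<in> gen_heaps m \<Longrightarrow> 0 \<le> F W \<and> F W \<le> 1"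
  shows "(\<lambda>n. gen_walk n F no_roofs) \<longlonglongrightarrow> mean F"
proof -
  obtain C \<rho> :: real where \<rho>: "0 < \<rho>" "\<rho> < 1" and bound:
    "\<And>n F W. depends l F \<Longrightarrow> (\<And>W. W \<in> gen_heaps m \<Longrightarrow> 0 \<le> F W \<and> F W \<le> 1) \<Longrightarrow>
      W \<in> gen_heaps m \<Longrightarrow> \<bar>gen_walk n F W - mean F\<bar> \<le> C * \<rho> ^ n"
    by (rule walk_mean[of l]) blast
  have "(\<lambda>n. C * \<rho> ^ n) \<longlonglongrightarrow> 0"
    using \<rho> by (intro tendsto_mult_right_zero LIMSEQ_realpow_zero) simp_all
  then have "(\<lambda>n. gen_walk n F no_roofs - mean F) \<longlonglongrightarrow> 0"
    by (rule Lim_null_comparison[rotated]) (use bound[OF F no_roofs_mem] in simp)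
  then show ?thesis by (simp add: LIM_zero_iff)
qed

section \<open>Cylinder sets\<close>

definition cylinder :: "nat \<Rightarrow> (nat \<Rightarrow> config) set \<Rightarrow> bool" where
  "cylinder l A \<longleftrightarrow> A \<subseteq> gen_heaps m \<and> depends l (\<lambda>W. W \<in> A)"

definition cylinders :: "(nat \<Rightarrow> config) set set" where
  "cylinders = {A. \<exists>l. cylinder l A}"

lemma cylinder_mono: "cylinder l A \<Longrightarrow> l \<le> l' \<Longrightarrow> cylinder l' A"
  unfolding cylinder_def using depends_mono by blast

lemma cylinder_preimage: "cylinder l {W \<in> gen_heaps m. top_roofs l W \<in> B}"
  by (auto simp: cylinder_def depends_def)

lemma cylinder_vimage:
  assumes "depends l F"
  shows "cylinder l (F -` B \<inter> gen_heaps m)"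
  unfolding cylinder_def
proof
  show "depends l (\<lambda>W. W \<in> F -` B \<inter> gen_heaps m)"
    using dependsD[OF assms] by (intro dependsI) (metis IntI Int_iff vimage_eq)
qed simp

lemma cylinder_iff:
  "cylinder l A \<Longrightarrow> W \<in> gen_heaps m \<Longrightarrow> W' \<in> gen_heaps m \<Longrightarrow> top_roofs l W = top_roofs l W' \<Longrightarrow> W \<in> A \<longleftrightarrow> W' \<in> A"
  unfolding cylinder_def by (rule dependsD) auto

lemma cylinderI:
  "A \<subseteq> gen_heaps m \<Longrightarrow> (\<And>W W'. W \<in> A \<Longrightarrow> W' \<in> gen_heaps m \<Longrightarrow> top_roofs l W = top_roofs l W' \<Longrightarrow> W' \<in> A) \<Longrightarrow>
     cylinder l A"
  unfolding cylinder_def by (intro conjI dependsI) metis+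

lemma cylinder_indicator:
  assumes "cylinder l A"
  shows "depends l (indicator A :: _ \<Rightarrow> real)"
proof (rule dependsI)
  fix W W' assume "W \<in> gen_heaps m" "W' \<in> gen_heaps m" "top_roofs l W = top_roofs l W'"
  from cylinder_iff[OF assms this] show "indicator A W = (indicator A W' :: real)"
    by (simp add: indicator_def)
qed

lemma algebra_cylinders: "algebra (gen_heaps m) cylinders"
  unfolding algebra_iff_Un
proof (intro conjI ballI)
  show "cylinders \<subseteq> Pow (gen_heaps m)" by (auto simp: cylinders_def cylinder_def)
  show "{} \<in> cylinders" by (auto simp: cylinders_def cylinder_def depends_def)
  fix A assume "A \<in> cylinders"
  then obtain l where A: "cylinder l A" by (auto simp: cylinders_def)
  have "cylinder l (gen_heaps m - A)"
  proof (rule cylinderI)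
    show "W' \<in> gen_heaps m - A" if "W \<in> gen_heaps m - A" "W' \<in> gen_heaps m" "top_roofs l W = top_roofs l W'" for W W'
      using cylinder_iff[OF A _ that(2,3)] that(1,2) by blast
  qed simp
  then show "gen_heaps m - A \<in> cylinders" by (auto simp: cylinders_def)
  fix B assume "B \<in> cylinders"
  then obtain l' where B: "cylinder l' B" by (auto simp: cylinders_def)
  have "cylinder (max l l') A" "cylinder (max l l') B"
    using A B cylinder_mono by auto
  note AB = this
  have "cylinder (max l l') (A \<union> B)"
  proof (rule cylinderI)
    show "A \<union> B \<subseteq> gen_heaps m" using AB unfolding cylinder_def by blast
    show "W' \<in> A \<union> B" if "W \<in> A \<union> B" "W' \<in> gen_heaps m" "top_roofs (max l l') W = top_roofs (max l l') W'" for W W'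
      using cylinder_iff[OF AB(1) _ that(2,3)] cylinder_iff[OF AB(2) _ that(2,3)] that(1) AB
      unfolding cylinder_def by blast
  qed
  then show "A \<union> B \<in> cylinders" by (auto simp: cylinders_def)
qed

lemma config_subset_choices:
  assumes "finite_heap m V"
  shows "roof_seq m V i \<subseteq> choices"
proof
  fix p assume "p \<in> roof_seq m V i"
  then obtain x where x: "x \<in> roof m (deep i V)" "p = snd x" by (auto simp: roof_seq_def)
  then have "x \<in> V" using roof_subset[of "deep i V"] deep_subset[of i V] by blast
  then show "p \<in> choices" using heap_bounds(2)[OF assms] x by (simp add: mem_choices)
qed

lemma gen_config_subset_choices:
  assumes "W \<in> gen_heaps m"
  shows "W i \<subseteq> choices"
  using config_subset_choices[OF heap_with_roofs(1)[OF assms, of "Suc i"], of i]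
  by (simp add: heap_with_roofs(2)[OF assms])

lemma finite_roof_configs: "finite (roof_configs m k)"
proof (rule finite_subset)
  show "roof_configs m k \<subseteq> {xs. set xs \<subseteq> Pow choices \<and> length xs = k}"
    using config_subset_choices by (fastforce simp: roof_configs_def top_roofs_def)
  show "finite {xs. set xs \<subseteq> Pow choices \<and> length xs = k}"
    by (intro finite_lists_length_eq) (simp add: finite_choices)
qed

lemma top_roofs_mem_roof_configs:
  assumes "W \<in> gen_heaps m"
  shows "top_roofs k W \<in> roof_configs m k"
proof -
  let ?V = "heap_with_roofs m (top_roofs k W)"
  have "top_roofs k W = top_roofs k (roof_seq m ?V)"
    by (simp add: top_roofs_eq_iff heap_with_roofs(2)[OF assms])
  then show ?thesis unfolding roof_configs_def using heap_with_roofs(1)[OF assms] by blast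
qed

abbreviation basic_cylinders :: "(nat \<Rightarrow> config) set set" where
  "basic_cylinders \<equiv> {top_roofs k -` {\<phi>} \<inter> gen_heaps m | k \<phi>. 1 \<le> k \<and> \<phi> \<in> roof_configs m k}"

lemma space_heap_space: "space (heap_space m) = gen_heaps m"
  unfolding heap_space_def by (rule space_measure_of) blast

lemma basic_cylinder:
  assumes "A \<in> basic_cylinders"
  shows "A \<in> cylinders"
proof -
  obtain k \<phi> where "A = top_roofs k -` {\<phi>} \<inter> gen_heaps m" using assms by blast
  moreover have "top_roofs k -` {\<phi>} \<inter> gen_heaps m = {W \<in> gen_heaps m. top_roofs k W \<in> {\<phi>}}" by blast
  ultimately have "cylinder k A" using cylinder_preimage[of k "{\<phi>}"] by simp
  then show "A \<in> cylinders" by (auto simp: cylinders_def)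
qed

lemma cylinder_union_basic:
  assumes "A \<in> cylinders"
  obtains \<B> where "finite \<B>" "\<B> \<subseteq> basic_cylinders" "\<Union> \<B> = A"
proof -
  obtain l where "cylinder l A" using assms by (auto simp: cylinders_def)
  \<comment> \<open>The generators of the \<sigma>-field have level at least 1, while
    \<open>l\<close> may be 0.\<close>
  then have A: "cylinder (Suc l) A" by (rule cylinder_mono) simp
  define S where "S \<phi> = top_roofs (Suc l) -` {\<phi>} \<inter> gen_heaps m" for \<phi>
  have AG: "A \<subseteq> gen_heaps m" using A by (simp add: cylinder_def)
  have sub: "top_roofs (Suc l) ` A \<subseteq> roof_configs m (Suc l)"
    using AG top_roofs_mem_roof_configs by blast
  show thesis
  proof (rule that)
    show "finite (S ` top_roofs (Suc l) ` A)"
      using finite_subset[OF sub finite_roof_configs] by (rule finite_imageI)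
    show "S ` top_roofs (Suc l) ` A \<subseteq> basic_cylinders"
    proof (rule image_subsetI)
      fix \<phi> assume "\<phi> \<in> top_roofs (Suc l) ` A"
      then have "\<phi> \<in> roof_configs m (Suc l)" using sub by blast
      then show "S \<phi> \<in> basic_cylinders"
        unfolding mem_Collect_eq S_def by (intro exI[of _ "Suc l"] exI[of _ \<phi>] conjI) simp_all
    qed
    show "\<Union> (S ` top_roofs (Suc l) ` A) = A"
    proof (intro equalityI subsetI)
      fix W assume "W \<in> \<Union> (S ` top_roofs (Suc l) ` A)"
      then obtain W' where W: "W' \<in> A" "W \<in> S (top_roofs (Suc l) W')" by blast
      then have "W \<in> gen_heaps m" "top_roofs (Suc l) W = top_roofs (Suc l) W'" by (simp_all add: S_def)
      then show "W \<in> A" using cylinder_iff[OF A, of W W'] AG W(1) by blast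
    next
      fix W assume W: "W \<in> A"
      then have "W \<in> S (top_roofs (Suc l) W)" using AG by (auto simp: S_def)
      then show "W \<in> \<Union> (S ` top_roofs (Suc l) ` A)" using W by blast
    qed
  qed
qed

lemma sets_heap_space: "sets (heap_space m) = sigma_sets (gen_heaps m) cylinders"
proof -
  have sub: "basic_cylinders \<subseteq> Pow (gen_heaps m)" by blast
  have "sets (heap_space m) = sigma_sets (gen_heaps m) basic_cylinders"
    unfolding heap_space_def by (rule sets_measure_of[OF sub])
  also have "\<dots> = sigma_sets (gen_heaps m) cylinders"
  proof (rule sigma_sets_eqI)
    fix A assume "A \<in> basic_cylinders"
    then show "A \<in> sigma_sets (gen_heaps m) cylinders"
      by (rule sigma_sets.Basic[OF basic_cylinder])
  next
    fix A assume "A \<in> cylinders"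
    then obtain \<B> where B: "finite \<B>" "\<B> \<subseteq> basic_cylinders" "\<Union> \<B> = A"
      by (rule cylinder_union_basic)
    have "\<Union> \<B> \<in> sigma_sets (gen_heaps m) basic_cylinders"
    proof (rule sigma_sets_UNION)
      show "countable \<B>" using B(1) by (rule countable_finite)
      show "S \<in> sigma_sets (gen_heaps m) basic_cylinders" if "S \<in> \<B>" for S
        by (rule sigma_sets.Basic, rule subsetD[OF B(2) that])
    qed
    then show "A \<in> sigma_sets (gen_heaps m) basic_cylinders" unfolding B(3) .
  qed
  finally show ?thesis .
qed

lemma cylinder_sets: "cylinder l A \<Longrightarrow> A \<in> sets (heap_space m)"
  unfolding sets_heap_space cylinders_def by (intro sigma_sets.Basic) blast

lemma depends_measurable:
  assumes "depends l F"
  shows "F \<in> borel_measurable (heap_space m)"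
  by (rule measurableI) (use cylinder_sets[OF cylinder_vimage[OF assms]] in \<open>simp_all add: space_heap_space\<close>)

text \<open>Koenig's argument: each level has finitely many possible configurations, so some heap shares
  its first \<open>k\<close> roofs with infinitely many of the chosen \<open>x i\<close>, for every \<open>k\<close>.\<close>

lemma cylinders_compact:
  assumes A: "\<And>i. A i \<in> cylinders" "decseq A" "\<And>i. A i \<noteq> {}"
  shows "(\<Inter>i. A i) \<noteq> {}"
proof -
  have "\<forall>i. \<exists>x. x \<in> A i" using A(3) by blast
  then obtain x where x: "\<And>i. x i \<in> A i" by metis
  have xg: "x i \<in> gen_heaps m" for i
    using x[of i] A(1)[of i] by (auto simp: cylinders_def cylinder_def)
  let ?S = "\<lambda>xs. {i. top_roofs (length xs) (x i) = xs}"
  have "\<exists>f. \<forall>n. (length (f n) = n \<and> infinite (?S (f n))) \<and> (\<exists>a. f (Suc n) = f n @ [a])"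
  proof (rule dependent_nat_choice)
    show "\<exists>xs :: config list. length xs = 0 \<and> infinite (?S xs)"
      by (intro exI[of _ "[]"]) (simp add: top_roofs_def)
    fix xs :: "config list" and n assume xs: "length xs = n \<and> infinite (?S xs)"
    have "(\<lambda>i. x i n) ` ?S xs \<subseteq> Pow choices" using gen_config_subset_choices[OF xg] by blast
    then have "finite ((\<lambda>i. x i n) ` ?S xs)" using finite_choices finite_subset by blast
    then obtain i0 where i0: "infinite {i \<in> ?S xs. x i n = x i0 n}"
      using pigeonhole_infinite xs by blast
    have "{i \<in> ?S xs. x i n = x i0 n} \<subseteq> ?S (xs @ [x i0 n])"
      using xs by (auto simp: top_roofs_def)
    then have "infinite (?S (xs @ [x i0 n]))" using i0 infinite_super by blast
    then show "\<exists>ys. (length ys = Suc n \<and> infinite (?S ys)) \<and> (\<exists>a. ys = xs @ [a])"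
      using xs by (intro exI[of _ "xs @ [x i0 n]"]) auto
  qed
  then obtain f where f: "\<And>n. length (f n) = n" "\<And>n. infinite (?S (f n))" "\<And>n. \<exists>a. f (Suc n) = f n @ [a]"
    by blast
  define y where "y n = last (f (Suc n))" for n
  have fy: "f n = top_roofs n y" for n
  proof (induction n)
    case 0
    then show ?case using f(1)[of 0] by (simp add: top_roofs_def)
  next
    case (Suc n)
    obtain a where "f (Suc n) = f n @ [a]" using f(3) by blast
    then have "f (Suc n) = f n @ [y n]" by (simp add: y_def)
    then show ?case using Suc by (simp add: top_roofs_def)
  qed
  have often: "\<exists>i\<ge>j. top_roofs n (x i) = top_roofs n y" for j n
  proof -
    have "infinite {i. top_roofs n (x i) = top_roofs n y}" using f(2)[of n] f(1)[of n] fy[of n] by simp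
    then show ?thesis unfolding infinite_nat_iff_unbounded_le by blast
  qed
  have yg: "y \<in> gen_heaps m"
    unfolding gen_heaps_def
  proof (intro CollectI allI)
    fix k
    \<comment> \<open>Being a generalized heap is a condition on finite prefixes, and every prefix
      of \<open>y\<close> is shared with some \<open>x i\<close>.\<close>
    obtain i where i: "top_roofs k (x i) = top_roofs k y" using often by blast
    have "\<exists>V. finite_heap m V \<and> has_roofs m V (top_roofs k (x i))"
      using xg[of i] by (simp add: gen_heaps_def)
    then show "\<exists>V. finite_heap m V \<and> has_roofs m V (top_roofs k y)"
      unfolding i .
  qed
  have "y \<in> A j" for j
  proof -
    obtain l where l: "cylinder l (A j)" using A(1)[of j] by (auto simp: cylinders_def)
    obtain i where i: "j \<le> i" "top_roofs l (x i) = top_roofs l y" using often by blast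
    have "x i \<in> A j" using x[of i] decseqD[OF A(2) i(1)] by blast
    then show ?thesis using cylinder_iff[OF l xg[of i] yg i(2)] by simp
  qed
  then show ?thesis by blast
qed

section \<open>The stationary distribution\<close>

lemma gen_walk_cong:
  assumes "W \<in> gen_heaps m" "\<And>W. W \<in> gen_heaps m \<Longrightarrow> F W = G W"
  shows "gen_walk n F W = gen_walk n G W"
  by (intro antisym walk_mono[OF assms(1) gen_heaps_closed]) (simp_all add: assms(2))

lemma mean_cong: "(\<And>W. W \<in> gen_heaps m \<Longrightarrow> F W = G W) \<Longrightarrow> mean F = mean G"
  unfolding mean_def using gen_walk_cong[OF no_roofs_mem, of F G] by simp

lemma walk_sum:
  "finite I \<Longrightarrow> walk d n (\<lambda>y. \<Sum>i\<in>I. a i * F i y) x = (\<Sum>i\<in>I. a i * walk d n (F i) x)"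
proof (induction I rule: finite_induct)
  case (insert i I)
  then show ?case
    using walk_linear[of d n "a i" "F i" 1 "\<lambda>y. \<Sum>i\<in>I. a i * F i y" x] by simp
qed simp

lemma indicator_bounds: "0 \<le> (indicator A W :: real) \<and> (indicator A W :: real) \<le> 1"
  by (simp add: indicator_def)

lemma mean_nonneg:
  assumes "depends l F" "\<And>W. W \<in> gen_heaps m \<Longrightarrow> 0 \<le> F W \<and> F W \<le> 1"
  shows "0 \<le> mean F"
proof (rule LIMSEQ_le_const)
  show "(\<lambda>n. gen_walk n F no_roofs) \<longlonglongrightarrow> mean F" by (rule mean_tendsto[OF assms])
  have "0 \<le> gen_walk n F no_roofs" for n
    by (rule walk_bounds[OF no_roofs_mem, THEN conjunct1]) (rule assms(2))
  then show "\<exists>N. \<forall>n\<ge>N. 0 \<le> gen_walk n F no_roofs" by blast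
qed

lemma mean_add:
  assumes A: "cylinder l A" and B: "cylinder l' B" and disj: "A \<inter> B = {}"
  shows "mean (indicator (A \<union> B)) = mean (indicator A) + mean (indicator B)"
proof -
  have AB: "A \<union> B \<in> cylinders"
    using ring_of_sets.Un[OF algebra.axioms(1)[OF algebra_cylinders]] A B by (auto simp: cylinders_def)
  then obtain l'' where l'': "cylinder l'' (A \<union> B)" by (auto simp: cylinders_def)
  have "indicator (A \<union> B) W = (indicator A W + indicator B W :: real)" for W
    using disj by (auto simp: indicator_def)
  then have eq: "gen_walk n (indicator (A \<union> B)) no_roofs =
      gen_walk n (indicator A) no_roofs + gen_walk n (indicator B) no_roofs" for n
    using walk_linear[of "gen_drop m" n 1 "indicator A" 1 "indicator B" no_roofs]
      gen_walk_cong[OF no_roofs_mem, of "indicator (A \<union> B)" "\<lambda>W. indicator A W + indicator B W" n] by simp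
  have "(\<lambda>n. gen_walk n (indicator (A \<union> B)) no_roofs) \<longlonglongrightarrow> mean (indicator A) + mean (indicator B)"
    unfolding eq
    by (intro tendsto_add mean_tendsto[OF cylinder_indicator[OF A]] mean_tendsto[OF cylinder_indicator[OF B]]
        indicator_bounds)
  then show ?thesis
    by (rule LIMSEQ_unique[OF mean_tendsto[OF cylinder_indicator[OF l''] indicator_bounds]])
qed

lemma mean_const: "mean (\<lambda>_. a) = a"
  unfolding mean_def by simp

lemma exists_measure:
  obtains \<nu> where "prob_space \<nu>" "sets \<nu> = sets (heap_space m)"
    "\<And>A. A \<in> cylinders \<Longrightarrow> measure \<nu> A = mean (indicator A)"
proof -
  interpret algebra "gen_heaps m" cylinders by (rule algebra_cylinders)
  let ?f = "\<lambda>A. ennreal (mean (indicator A))"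
  have nonneg: "0 \<le> mean (indicator A)" if A: "A \<in> cylinders" for A
  proof -
    obtain l where "cylinder l A" using A unfolding cylinders_def by blast
    then show ?thesis by (intro mean_nonneg[OF cylinder_indicator] indicator_bounds)
  qed
  have empty: "mean (indicator {}) = 0"
    using mean_cong[of "indicator {}" "\<lambda>_. 0"] mean_const[of 0] by simp
  have "\<exists>\<mu> :: (nat \<Rightarrow> config) set \<Rightarrow> ennreal. (\<forall>A\<in>cylinders. \<mu> A = ?f A) \<and>
      measure_space (gen_heaps m) (sigma_sets (gen_heaps m) cylinders) \<mu>"
  proof (rule caratheodory_empty_continuous)
    show "positive cylinders ?f" by (simp add: positive_def empty)
    show "additive cylinders ?f"
      unfolding additive_def
    proof (intro ballI impI)
      fix A B assume AB: "A \<in> cylinders" "B \<in> cylinders" "A \<inter> B = {}"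
      obtain l l' where "cylinder l A" "cylinder l' B" using AB by (auto simp: cylinders_def)
      then show "?f (A \<union> B) = ?f A + ?f B"
        using mean_add AB(3) nonneg[OF AB(1)] nonneg[OF AB(2)] by simp
    qed
    show "?f A \<noteq> \<infinity>" if "A \<in> cylinders" for A by simp
    fix A :: "nat \<Rightarrow> (nat \<Rightarrow> config) set"
    assume A: "range A \<subseteq> cylinders" "decseq A" "(\<Inter>i. A i) = {}"
    \<comment> \<open>Compactness makes continuity at the empty set trivial: the sequence is not
      merely small but eventually empty.\<close>
    then obtain j where j: "A j = {}" using cylinders_compact[of A] by blast
    have "A i = {}" if "j \<le> i" for i using decseqD[OF A(2) that] j by simp
    then have "eventually (\<lambda>i. ?f (A i) = 0) sequentially"
      unfolding eventually_sequentially using empty by (intro exI[of _ j]) simp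
    then show "(\<lambda>i. ?f (A i)) \<longlonglongrightarrow> 0" by (rule tendsto_eventually)
  qed
  then obtain \<mu> :: "(nat \<Rightarrow> config) set \<Rightarrow> ennreal" where \<mu>: "\<forall>A\<in>cylinders. \<mu> A = ?f A"
    "measure_space (gen_heaps m) (sigma_sets (gen_heaps m) cylinders) \<mu>" by blast
  define \<nu> where "\<nu> = measure_of (gen_heaps m) cylinders \<mu>"
  have sub: "cylinders \<subseteq> Pow (gen_heaps m)" by (rule space_closed)
  have em: "emeasure \<nu> A = ?f A" if "A \<in> cylinders" for A
    unfolding \<nu>_def emeasure_measure_of_conv using that \<mu> by (simp add: sigma_sets.Basic)
  have sp: "space \<nu> = gen_heaps m" unfolding \<nu>_def by (rule space_measure_of[OF sub])
  have "gen_heaps m \<in> cylinders" by (rule top)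
  moreover have "mean (indicator (gen_heaps m)) = 1"
    using mean_cong[of "indicator (gen_heaps m)" "\<lambda>_. 1"] mean_const[of 1] by simp
  ultimately have "emeasure \<nu> (space \<nu>) = 1" unfolding sp by (simp add: em)
  then have "prob_space \<nu>" by (rule prob_spaceI)
  moreover have "sets \<nu> = sets (heap_space m)"
    unfolding \<nu>_def sets_heap_space by (rule sets_measure_of[OF sub])
  moreover have "measure \<nu> A = mean (indicator A)" if "A \<in> cylinders" for A
    using em[OF that] nonneg[OF that] by (simp add: measure_def)
  ultimately show thesis by (rule that)
qed

lemma integral_eq_mean:
  assumes prob: "prob_space \<nu>" and sets: "sets \<nu> = sets (heap_space m)"
    and \<nu>: "\<And>A. A \<in> cylinders \<Longrightarrow> measure \<nu> A = mean (indicator A)"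
    and F: "depends l F" "\<And>W. W \<in> gen_heaps m \<Longrightarrow> 0 \<le> F W \<and> F W \<le> 1"
  shows "integral\<^sup>L \<nu> F = mean F"
proof -
  interpret prob_space \<nu> by (rule prob)
  have sp: "space \<nu> = gen_heaps m" using sets_eq_imp_space_eq[OF sets] by (simp add: space_heap_space)
  define S where "S \<phi> = {W \<in> gen_heaps m. top_roofs l W \<in> {\<phi>}}" for \<phi>
  \<comment> \<open>The value of \<open>F\<close> on heaps with first roofs \<open>\<phi>\<close>;
    any representative serves. Thus \<open>F\<close> is a finite combination of cylinder
    indicators.\<close>
  define g where "g \<phi> = F (SOME W. W \<in> S \<phi>)" for \<phi>
  have S: "cylinder l (S \<phi>)" for \<phi> unfolding S_def by (rule cylinder_preimage)
  have decomp: "F W = (\<Sum>\<phi>\<in>roof_configs m l. g \<phi> * indicator (S \<phi>) W)" if W: "W \<in> gen_heaps m" for W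
  proof -
    have "indicator (S \<phi>) W = (if \<phi> = top_roofs l W then 1 else 0 :: real)" for \<phi>
      using W by (auto simp: S_def indicator_def)
    then have "(\<Sum>\<phi>\<in>roof_configs m l. g \<phi> * indicator (S \<phi>) W) = g (top_roofs l W)"
      using top_roofs_mem_roof_configs[OF W, of l] finite_roof_configs by (simp add: mult_delta_right sum.delta)
    also have "\<dots> = F W"
    proof -
      have "W \<in> S (top_roofs l W)" using W by (simp add: S_def)
      then have "(SOME W'. W' \<in> S (top_roofs l W)) \<in> S (top_roofs l W)"
        by (rule someI[where P = "\<lambda>W'. W' \<in> S (top_roofs l W)"])
      then show ?thesis unfolding g_def by (intro dependsD[OF F(1) _ W]) (simp_all add: S_def)
    qed
    finally show ?thesis by simp
  qed
  have "integral\<^sup>L \<nu> F = integral\<^sup>L \<nu> (\<lambda>W. \<Sum>\<phi>\<in>roof_configs m l. g \<phi> * indicator (S \<phi>) W)"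
    by (rule Bochner_Integration.integral_cong) (simp_all add: sp decomp)
  also have "\<dots> = (\<Sum>\<phi>\<in>roof_configs m l. g \<phi> * measure \<nu> (S \<phi>))"
  proof -
    have Sm: "S \<phi> \<in> sets \<nu>" for \<phi> unfolding sets by (rule cylinder_sets[OF S])
    have sub: "S \<phi> \<inter> space \<nu> = S \<phi>" for \<phi> unfolding sp S_def by blast
    have "integrable \<nu> (\<lambda>W. g \<phi> * indicator (S \<phi>) W)" for \<phi>
      using Sm by (auto simp: emeasure_eq_measure)
    then show ?thesis
      using Bochner_Integration.integral_sum[of "roof_configs m l" \<nu> "\<lambda>\<phi> W. g \<phi> * indicator (S \<phi>) W"]
      by (simp add: sub)
  qed
  also have "\<dots> = (\<Sum>\<phi>\<in>roof_configs m l. g \<phi> * mean (indicator (S \<phi>)))"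
  proof -
    have "S \<phi> \<in> cylinders" for \<phi> unfolding cylinders_def using S by blast
    then show ?thesis by (simp add: \<nu>)
  qed
  also have "\<dots> = mean F"
  proof (rule LIMSEQ_unique)
    have "gen_walk n F no_roofs = (\<Sum>\<phi>\<in>roof_configs m l. g \<phi> * gen_walk n (indicator (S \<phi>)) no_roofs)" for n
      using gen_walk_cong[OF no_roofs_mem decomp, where n = n] by (simp add: walk_sum[OF finite_roof_configs])
    then show "(\<lambda>n. gen_walk n F no_roofs) \<longlonglongrightarrow> (\<Sum>\<phi>\<in>roof_configs m l. g \<phi> * mean (indicator (S \<phi>)))"
      by (simp only:) (intro tendsto_sum tendsto_mult_left mean_tendsto[OF cylinder_indicator[OF S]] indicator_bounds)
    show "(\<lambda>n. gen_walk n F no_roofs) \<longlonglongrightarrow> mean F" by (rule mean_tendsto[OF F])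
  qed
  finally show ?thesis .
qed

section \<open>The Markov operator\<close>

lemma choice_measure_eq: "choice_measure m = uniform_count_measure choices"
  by (simp add: choice_measure_def choices_def)

lemma prob_space_choice: "prob_space (choice_measure m)"
  unfolding choice_measure_eq by (rule prob_space_uniform_count_measure[OF finite_choices choices_nonempty])

lemma gen_drop_measurable:
  assumes c: "c \<in> choices"
  shows "gen_drop m c \<in> measurable (heap_space m) (heap_space m)"
proof (rule measurable_sigma_sets[OF sets_heap_space])
  show "cylinders \<subseteq> Pow (gen_heaps m)" by (auto simp: cylinders_def cylinder_def)
  show "gen_drop m c \<in> space (heap_space m) \<rightarrow> gen_heaps m"
    unfolding space_heap_space using gen_heaps_closed[OF c] by blast
  fix A assume "A \<in> cylinders"
  then obtain l where A: "cylinder l A" by (auto simp: cylinders_def)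
  have "cylinder (Suc l) (gen_drop m c -` A \<inter> gen_heaps m)"
  proof (rule cylinderI)
    fix W W' assume W: "W \<in> gen_drop m c -` A \<inter> gen_heaps m" "W' \<in> gen_heaps m"
      and eq: "top_roofs (Suc l) W = top_roofs (Suc l) W'"
    have "top_roofs l (gen_drop m c W) = top_roofs l (gen_drop m c W')"
      by (rule gen_drop_cong) (use W c eq in \<open>auto simp: mem_choices\<close>)
    moreover have "gen_drop m c W \<in> A" "gen_drop m c W \<in> gen_heaps m" "gen_drop m c W' \<in> gen_heaps m"
      using W gen_heaps_closed[OF c] by auto
    ultimately have "gen_drop m c W' \<in> A" using cylinder_iff[OF A] by blast
    then show "W' \<in> gen_drop m c -` A \<inter> gen_heaps m" using W(2) by blast
  qed simp
  then show "gen_drop m c -` A \<inter> space (heap_space m) \<in> sets (heap_space m)"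
    unfolding space_heap_space by (rule cylinder_sets)
qed

lemma choice_measurable:
  "W \<in> gen_heaps m \<Longrightarrow> (\<lambda>c. gen_drop m c W) \<in> measurable (choice_measure m) (heap_space m)"
  by (rule measurableI)
    (auto simp: choice_measure_eq space_uniform_count_measure sets_uniform_count_measure space_heap_space
      gen_heaps_closed)

lemma prob_space_kernel: "W \<in> gen_heaps m \<Longrightarrow> prob_space (heap_kernel m W)"
  unfolding heap_kernel_def by (rule prob_space.prob_space_distr[OF prob_space_choice choice_measurable])

lemma integral_kernel:
  assumes "W \<in> gen_heaps m" "F \<in> borel_measurable (heap_space m)"
  shows "integral\<^sup>L (heap_kernel m W) F = gen_walk 1 F W"
  unfolding heap_kernel_def integral_distr[OF choice_measurable[OF assms(1)] assms(2)]
  unfolding choice_measure_eq by (simp add: integral_uniform_count_measure finite_choices card_choices)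

lemma walk_measurable:
  assumes "F \<in> borel_measurable (heap_space m)"
  shows "gen_walk n F \<in> borel_measurable (heap_space m)"
proof (induction n)
  case (Suc n)
  have "(\<lambda>W. (\<Sum>c\<in>choices. gen_walk n F (gen_drop m c W)) / real (2 * m)) \<in> borel_measurable (heap_space m)"
    by (intro borel_measurable_divide borel_measurable_sum measurable_compose[OF gen_drop_measurable Suc]
        borel_measurable_const)
  then show ?case by simp
qed (use assms in simp)

text \<open>The mass that the kernel gives to \<open>A\<close> is the one-step average of its
  indicator, a finite sum of measurable functions of the heap.\<close>

lemma kernel_measurable: "heap_kernel m \<in> measurable (heap_space m) (subprob_algebra (heap_space m))"
proof (rule measurable_subprob_algebra)
  fix W assume "W \<in> space (heap_space m)"
  then show "subprob_space (heap_kernel m W)"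
    by (intro prob_space_imp_subprob_space prob_space_kernel) (simp add: space_heap_space)
  show "sets (heap_kernel m W) = sets (heap_space m)" by (simp add: heap_kernel_def)
next
  fix A assume A: "A \<in> sets (heap_space m)"
  have ind: "(indicator A :: _ \<Rightarrow> real) \<in> borel_measurable (heap_space m)"
    by (rule borel_measurable_indicator[OF A])
  have "emeasure (heap_kernel m W) A = ennreal (gen_walk 1 (indicator A) W)" if W: "W \<in> gen_heaps m" for W
  proof -
    interpret prob_space "heap_kernel m W" by (rule prob_space_kernel[OF W])
    have "A \<in> sets (heap_kernel m W)" using A by (simp add: heap_kernel_def)
    then have "measure (heap_kernel m W) A = integral\<^sup>L (heap_kernel m W) (indicator A)"
      by (simp add: Int_absorb2 sets.sets_into_space)
    then show ?thesis unfolding emeasure_eq_measure integral_kernel[OF W ind] by simp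
  qed
  moreover have "(\<lambda>W. ennreal (gen_walk 1 (indicator A) W)) \<in> borel_measurable (heap_space m)"
    using walk_measurable[OF ind, of 1] by measurable
  ultimately show "(\<lambda>W. emeasure (heap_kernel m W) A) \<in> borel_measurable (heap_space m)"
    using measurable_cong[of "heap_space m" "\<lambda>W. emeasure (heap_kernel m W) A" "\<lambda>W. ennreal (gen_walk 1 (indicator A) W)" borel]
    by (simp add: space_heap_space)
qed

context
  fixes \<nu> :: "(nat \<Rightarrow> config) measure"
  assumes prob: "prob_space \<nu>" and sets_\<nu>: "sets \<nu> = sets (heap_space m)"
begin

lemma space_\<nu>: "space \<nu> = gen_heaps m"
  using sets_eq_imp_space_eq[OF sets_\<nu>] by (simp add: space_heap_space)

lemma kernel_measurable_\<nu>: "heap_kernel m \<in> measurable \<nu> (subprob_algebra (heap_space m))"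
  using kernel_measurable measurable_cong_sets[OF sets_\<nu> refl] by blast

lemma prob_space_markov: "prob_space (markov_op m \<nu>)"
  unfolding markov_op_def
  by (rule prob_space.prob_space_bind[OF prob _ kernel_measurable_\<nu>])
    (intro AE_I2, simp add: space_\<nu> prob_space_kernel)

lemma sets_markov: "sets (markov_op m \<nu>) = sets (heap_space m)"
  unfolding markov_op_def
  by (rule sets_bind_measurable[OF kernel_measurable_\<nu>]) (use prob_space.not_empty[OF prob] in simp)

lemma integral_markov:
  assumes F: "depends l F" "\<And>W. W \<in> gen_heaps m \<Longrightarrow> 0 \<le> F W \<and> F W \<le> 1"
  shows "integral\<^sup>L (markov_op m \<nu>) F = integral\<^sup>L \<nu> (gen_walk 1 F)"
proof -
  have Fm: "F \<in> borel_measurable (heap_space m)" by (rule depends_measurable[OF F(1)])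
  have "integral\<^sup>L (markov_op m \<nu>) F = (\<integral>W. integral\<^sup>L (heap_kernel m W) F \<partial>\<nu>)"
    unfolding markov_op_def
  proof (rule integral_bind[OF Fm _ kernel_measurable_\<nu>])
    show "\<bar>F W\<bar> \<le> 1" if "W \<in> space (heap_space m)" for W
      using F(2)[of W] that by (simp add: space_heap_space)
    show "finite_measure \<nu>" using prob by (rule prob_space.finite_measure)
    show "AE W in \<nu>. emeasure (heap_kernel m W) (space (heap_kernel m W)) \<le> ennreal 1"
      using prob_space_kernel by (intro AE_I2) (simp add: space_\<nu> prob_space.emeasure_space_1)
  qed
  also have "\<dots> = integral\<^sup>L \<nu> (gen_walk 1 F)"
    by (rule Bochner_Integration.integral_cong) (simp_all add: space_\<nu> integral_kernel[OF _ Fm])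
  finally show ?thesis .
qed

lemma measure_eq_integral: "A \<in> cylinders \<Longrightarrow> measure \<nu> A = integral\<^sup>L \<nu> (indicator A)"
  by (auto simp: cylinders_def cylinder_def space_\<nu> Int_absorb2)

text \<open>Stationarity lets \<open>F\<close> be replaced by its \<open>n\<close>-step average
  under the integral, and this average is within \<open>C * \<rho> ^ n\<close> of a constant on the
  whole space.\<close>

lemma integral_stationary:
  assumes st: "markov_op m \<nu> = \<nu>"
    and F: "depends l F" "\<And>W. W \<in> gen_heaps m \<Longrightarrow> 0 \<le> F W \<and> F W \<le> 1"
  shows "integral\<^sup>L \<nu> F = mean F"
proof -
  interpret prob_space \<nu> by (rule prob)
  have wb: "0 \<le> gen_walk n F W \<and> gen_walk n F W \<le> 1" if "W \<in> gen_heaps m" for n W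
    by (rule walk_bounds[OF that]) (rule F(2))
  have step: "integral\<^sup>L \<nu> F = integral\<^sup>L \<nu> (gen_walk n F)" for n
  proof (induction n)
    case (Suc n)
    have "integral\<^sup>L (markov_op m \<nu>) (gen_walk n F) = integral\<^sup>L \<nu> (gen_walk 1 (gen_walk n F))"
      by (rule integral_markov[OF depends_walk[OF F(1)] wb])
    then have "integral\<^sup>L \<nu> (gen_walk n F) = integral\<^sup>L \<nu> (gen_walk 1 (gen_walk n F))"
      unfolding st .
    also have "gen_walk 1 (gen_walk n F) = gen_walk (Suc n) F"
      using walk_add[of "gen_drop m" n 1 F] by auto
    finally show ?case using Suc by simp
  qed simp
  obtain C \<rho> :: real where \<rho>: "0 < \<rho>" "\<rho> < 1" and bound:
    "\<And>n F W. depends l F \<Longrightarrow> (\<And>W. W \<in> gen_heaps m \<Longrightarrow> 0 \<le> F W \<and> F W \<le> 1) \<Longrightarrow>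
      W \<in> gen_heaps m \<Longrightarrow> \<bar>gen_walk n F W - mean F\<bar> \<le> C * \<rho> ^ n"
    by (rule walk_mean[of l]) blast
  have close: "\<bar>integral\<^sup>L \<nu> F - mean F\<bar> \<le> C * \<rho> ^ n" for n
  proof -
    have b: "\<bar>gen_walk n F W - mean F\<bar> \<le> C * \<rho> ^ n" if "W \<in> space \<nu>" for W
      using bound[OF F] that by (simp add: space_\<nu>)
    have int: "integrable \<nu> (gen_walk n F)"
    proof (rule integrable_const_bound[of _ 1])
      show "AE W in \<nu>. norm (gen_walk n F W) \<le> 1"
        using wb by (intro AE_I2) (simp add: space_\<nu>)
      show "gen_walk n F \<in> borel_measurable \<nu>"
        using walk_measurable[OF depends_measurable[OF F(1)]] measurable_cong_sets[OF sets_\<nu> refl] by blast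
    qed
    have "integral\<^sup>L \<nu> (gen_walk n F) \<le> mean F + C * \<rho> ^ n"
      by (rule integral_le_const[OF int]) (intro AE_I2, use b in force)
    moreover have "mean F - C * \<rho> ^ n \<le> integral\<^sup>L \<nu> (gen_walk n F)"
      by (rule integral_ge_const[OF int]) (intro AE_I2, use b in force)
    ultimately show ?thesis unfolding step[of n] by linarith
  qed
  have "(\<lambda>n. C * \<rho> ^ n) \<longlonglongrightarrow> 0"
    using \<rho> by (intro tendsto_mult_right_zero LIMSEQ_realpow_zero) simp_all
  then have "\<bar>integral\<^sup>L \<nu> F - mean F\<bar> \<le> 0"
    by (rule LIMSEQ_le_const) (use close in blast)
  then show ?thesis by simp
qed

end

lemma measure_eqI_cylinders:
  assumes "prob_space \<mu>" "sets \<mu> = sets (heap_space m)" "prob_space \<nu>" "sets \<nu> = sets (heap_space m)"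
    and eq: "\<And>A. A \<in> cylinders \<Longrightarrow> measure \<mu> A = measure \<nu> A"
  shows "\<mu> = \<nu>"
proof (rule measure_eqI_generator_eq)
  interpret \<mu>: prob_space \<mu> by fact
  interpret \<nu>: prob_space \<nu> by fact
  interpret algebra "gen_heaps m" cylinders by (rule algebra_cylinders)
  show "Int_stable cylinders" by (auto simp: Int_stable_def)
  show "cylinders \<subseteq> Pow (gen_heaps m)" by (rule space_closed)
  show "emeasure \<mu> A = emeasure \<nu> A" if "A \<in> cylinders" for A
    using eq[OF that] by (simp add: \<mu>.emeasure_eq_measure \<nu>.emeasure_eq_measure)
  show "sets \<mu> = sigma_sets (gen_heaps m) cylinders" "sets \<nu> = sigma_sets (gen_heaps m) cylinders"
    using assms by (simp_all add: sets_heap_space)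
  show "range (\<lambda>_ :: nat. gen_heaps m) \<subseteq> cylinders" using top by blast
  show "(\<Union>i :: nat. gen_heaps m) = gen_heaps m" by simp
  show "emeasure \<mu> (gen_heaps m) \<noteq> \<infinity>" using \<mu>.emeasure_finite[of "gen_heaps m"] by simp
qed

text \<open>One more initial drop only shifts the index of the converging sequence.\<close>

lemma mean_walk:
  assumes F: "depends l F" "\<And>W. W \<in> gen_heaps m \<Longrightarrow> 0 \<le> F W \<and> F W \<le> 1"
  shows "mean (gen_walk 1 F) = mean F"
proof (rule LIMSEQ_unique)
  have "gen_walk n (gen_walk 1 F) no_roofs = gen_walk (n + 1) F no_roofs" for n
    using walk_add[of "gen_drop m" 1 n F no_roofs] by (simp add: add.commute del: walk.simps)
  then show "(\<lambda>n. gen_walk n (gen_walk 1 F) no_roofs) \<longlonglongrightarrow> mean F"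
    using LIMSEQ_ignore_initial_segment[OF mean_tendsto[OF F], of 1] by (simp del: walk.simps)
  show "(\<lambda>n. gen_walk n (gen_walk 1 F) no_roofs) \<longlonglongrightarrow> mean (gen_walk 1 F)"
    by (rule mean_tendsto[OF depends_walk[OF F(1)]], rule walk_bounds) (simp_all add: F(2))
qed

lemma unique_stationary:
  obtains \<nu> where "stationary m \<nu>" "\<And>\<nu>'. stationary m \<nu>' \<Longrightarrow> \<nu>' = \<nu>"
    "\<And>l F. depends l F \<Longrightarrow> (\<And>W. W \<in> gen_heaps m \<Longrightarrow> 0 \<le> F W \<and> F W \<le> 1) \<Longrightarrow> integral\<^sup>L \<nu> F = mean F"
proof -
  obtain \<nu> where prob: "prob_space \<nu>" and sets: "sets \<nu> = sets (heap_space m)"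
    and \<nu>: "\<And>A. A \<in> cylinders \<Longrightarrow> measure \<nu> A = mean (indicator A)"
    using exists_measure by blast
  have int: "integral\<^sup>L \<nu> F = mean F"
    if "depends l F" "\<And>W. W \<in> gen_heaps m \<Longrightarrow> 0 \<le> F W \<and> F W \<le> 1" for l F
    by (rule integral_eq_mean[OF prob sets \<nu> that])
  have "markov_op m \<nu> = \<nu>"
  proof (rule measure_eqI_cylinders[OF prob_space_markov[OF prob sets] sets_markov[OF prob sets] prob sets])
    fix A assume A: "A \<in> cylinders"
    then obtain l where "cylinder l A" by (auto simp: cylinders_def)
    note ind = cylinder_indicator[OF this]
    have "measure (markov_op m \<nu>) A = integral\<^sup>L (markov_op m \<nu>) (indicator A)"
      by (rule measure_eq_integral[OF prob_space_markov[OF prob sets] sets_markov[OF prob sets] A])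
    also have "\<dots> = integral\<^sup>L \<nu> (gen_walk 1 (indicator A))"
      by (rule integral_markov[OF prob sets ind indicator_bounds])
    also have "\<dots> = mean (gen_walk 1 (indicator A))"
      by (rule int[OF depends_walk[OF ind]], rule walk_bounds) (simp_all add: indicator_bounds)
    also have "\<dots> = mean (indicator A)" by (rule mean_walk[OF ind indicator_bounds])
    finally show "measure (markov_op m \<nu>) A = measure \<nu> A" using \<nu>[OF A] by simp
  qed
  then have "stationary m \<nu>" unfolding stationary_def using prob sets by blast
  moreover have "\<nu>' = \<nu>" if "stationary m \<nu>'" for \<nu>'
  proof -
    have st: "prob_space \<nu>'" "sets \<nu>' = sets (heap_space m)" "markov_op m \<nu>' = \<nu>'"
      using that unfolding stationary_def by auto
    show ?thesis
    proof (rule measure_eqI_cylinders[OF st(1,2) prob sets])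
      fix A assume A: "A \<in> cylinders"
      then obtain l where "cylinder l A" by (auto simp: cylinders_def)
      note ind = cylinder_indicator[OF this]
      show "measure \<nu>' A = measure \<nu> A"
        using measure_eq_integral[OF st(1,2) A] integral_stationary[OF st ind indicator_bounds] \<nu>[OF A] by simp
    qed
  qed
  ultimately show thesis using that int by blast
qed

section \<open>The process started from the empty heap\<close>

lemma process_heap:
  assumes "\<forall>\<omega>\<in>space Pr. W 0 \<omega> = {} \<and> (\<forall>n. W (Suc n) \<omega> = drop_piece m (C n \<omega>) (W n \<omega>))"
    and "\<And>n \<omega>. \<omega> \<in> space Pr \<Longrightarrow> C n \<omega> \<in> choices" and "\<omega> \<in> space Pr"
  shows "finite_heap m (W n \<omega>)" and "W n \<omega> = drops (map (\<lambda>i. C i \<omega>) [0..<n]) {}"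
proof -
  show eq: "W n \<omega> = drops (map (\<lambda>i. C i \<omega>) [0..<n]) {}" for n
    using assms(1,3) by (induction n) auto
  show "finite_heap m (W n \<omega>)"
    unfolding eq using assms(2,3) by (intro heap_drops) auto
qed

text \<open>The bridge from an abstract probability space to the finite sums: independence and
  uniformity enter the development only here, as the equal probability of all words of
  drops.\<close>

lemma process_walk:
  assumes Pr: "prob_space Pr" and indep: "prob_space.indep_vars Pr (\<lambda>_. choice_measure m) C UNIV"
    and law: "\<And>n. distr Pr (choice_measure m) (C n) = choice_measure m"
    and W: "\<forall>\<omega>\<in>space Pr. W 0 \<omega> = {} \<and> (\<forall>n. W (Suc n) \<omega> = drop_piece m (C n \<omega>) (W n \<omega>))"
  shows "{\<omega> \<in> space Pr. P (W n \<omega>)} \<in> sets Pr \<and>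
    measure Pr {\<omega> \<in> space Pr. P (W n \<omega>)} = walk (drop_piece m) n (\<lambda>V. of_bool (P V)) {}"
proof -
  interpret prob_space Pr by (rule Pr)
  have meas: "C n \<in> measurable Pr (choice_measure m)" for n
    using indep unfolding indep_vars_def by simp
  have sp: "space (choice_measure m) = choices" "sets (choice_measure m) = Pow choices"
    by (simp_all add: choice_measure_eq space_uniform_count_measure sets_uniform_count_measure)
  have C: "C n \<omega> \<in> choices" if "\<omega> \<in> space Pr" for n \<omega>
    using measurable_space[OF meas that] by (simp add: sp)
  \<comment> \<open>The event that the drops begin with the word \<open>w\<close>. The induction
    below fixes a prefix \<open>w\<close> and counts the remaining drops, since \<open>walk\<close>
    peels off the first drop.\<close>
  define E where "E w = {\<omega> \<in> space Pr. \<forall>i<length w. C i \<omega> = w ! i}" for w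
  have one: "prob (C i -` {c} \<inter> space Pr) = 1 / real (2 * m)" if c: "c \<in> choices" for i c
  proof -
    have "prob (C i -` {c} \<inter> space Pr) = measure (distr Pr (choice_measure m) (C i)) {c}"
      using c by (intro measure_distr[OF meas, symmetric]) (simp add: sp)
    also have "\<dots> = 1 / real (2 * m)"
      unfolding law unfolding choice_measure_eq
      using c by (simp add: measure_uniform_count_measure finite_choices card_choices)
    finally show ?thesis .
  qed
  have E: "E w \<in> sets Pr \<and> prob (E w) = (1 / real (2 * m)) ^ length w" if w: "set w \<subseteq> choices" for w
  proof (cases "w = []")
    case True
    then show ?thesis by (simp add: E_def prob_space)
  next
    case False
    have eq: "E w = (\<Inter>i\<in>{..<length w}. C i -` {w ! i} \<inter> space Pr)"
      using False by (auto simp: E_def)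
    have wi: "w ! i \<in> choices" if "i < length w" for i using w that nth_mem by blast
    have "C i -` {w ! i} \<inter> space Pr \<in> sets Pr" if "i < length w" for i
      by (rule measurable_sets[OF meas]) (simp add: sp wi[OF that])
    then have "E w \<in> sets Pr" unfolding eq using False by (intro sets.finite_INT) auto
    moreover have "prob (E w) = (\<Prod>i\<in>{..<length w}. prob (C i -` {w ! i} \<inter> space Pr))"
      unfolding eq
      by (rule indep_varsD[OF indep, where A = "\<lambda>i. {w ! i}"]) (use False wi in \<open>auto simp: sp\<close>)
    moreover have "\<dots> = (1 / real (2 * m)) ^ length w" by (simp add: one[OF wi])
    ultimately show ?thesis by simp
  qed
  have "{\<omega> \<in> E w. P (W (length w + n) \<omega>)} \<in> sets Pr \<and>
      prob {\<omega> \<in> E w. P (W (length w + n) \<omega>)} =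
        (1 / real (2 * m)) ^ length w * walk (drop_piece m) n (\<lambda>V. of_bool (P V)) (drops w {})"
    if "set w \<subseteq> choices" for w n
    using that
  proof (induction n arbitrary: w)
    case 0
    have "W (length w) \<omega> = drops w {}" if "\<omega> \<in> E w" for \<omega>
    proof -
      have "map (\<lambda>i. C i \<omega>) [0..<length w] = w" using that by (intro nth_equalityI) (auto simp: E_def)
      then show ?thesis using process_heap(2)[OF W C, of \<omega> "length w"] that by (simp add: E_def)
    qed
    then have "{\<omega> \<in> E w. P (W (length w) \<omega>)} = (if P (drops w {}) then E w else {})" by auto
    then show ?case using E[OF 0] by simp
  next
    case (Suc n)
    let ?S = "\<lambda>c. {\<omega> \<in> E (w @ [c]). P (W (length (w @ [c]) + n) \<omega>)}"
    have IH: "?S c \<in> sets Pr" "prob (?S c) = (1 / real (2 * m)) ^ Suc (length w) *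
        walk (drop_piece m) n (\<lambda>V. of_bool (P V)) (drop_piece m c (drops w {}))"
      if "c \<in> choices" for c
      using Suc.IH[of "w @ [c]"] Suc.prems that by simp_all
    have Ec: "\<omega> \<in> E (w @ [c]) \<longleftrightarrow> \<omega> \<in> E w \<and> C (length w) \<omega> = c" for \<omega> c
      by (auto simp: E_def nth_append less_Suc_eq)
    have eq: "{\<omega> \<in> E w. P (W (length w + Suc n) \<omega>)} = (\<Union>c\<in>choices. ?S c)"
      using C[of _ "length w"] unfolding Ec by (auto simp: E_def)
    have "disjoint_family_on ?S choices"
      unfolding disjoint_family_on_def Ec by auto
    then have "prob (\<Union>c\<in>choices. ?S c) = (\<Sum>c\<in>choices. prob (?S c))"
      using IH(1) by (intro finite_measure_finite_Union finite_choices) auto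
    also have "\<dots> = (\<Sum>c\<in>choices. (1 / real (2 * m)) ^ Suc (length w) *
        walk (drop_piece m) n (\<lambda>V. of_bool (P V)) (drop_piece m c (drops w {})))"
      by (rule sum.cong[OF refl IH(2)])
    also have "\<dots> = (1 / real (2 * m)) ^ length w * walk (drop_piece m) (Suc n) (\<lambda>V. of_bool (P V)) (drops w {})"
      by (simp add: sum_distrib_left sum_divide_distrib mult_ac)
    finally have "prob {\<omega> \<in> E w. P (W (length w + Suc n) \<omega>)} =
        (1 / real (2 * m)) ^ length w * walk (drop_piece m) (Suc n) (\<lambda>V. of_bool (P V)) (drops w {})"
      unfolding eq .
    moreover have "{\<omega> \<in> E w. P (W (length w + Suc n) \<omega>)} \<in> sets Pr"
      unfolding eq using IH(1) finite_choices by (intro sets.finite_UN) auto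
    ultimately show ?case by blast
  qed
  from this[of "[]" n] show ?thesis by (simp add: E_def)
qed

lemma total_variation_convergence:
  fixes Pr :: "'a measure"
  assumes \<nu>: "prob_space \<nu>" "sets \<nu> = sets (heap_space m)"
    and int: "\<And>F. depends l F \<Longrightarrow> (\<And>W. W \<in> gen_heaps m \<Longrightarrow> 0 \<le> F W \<and> F W \<le> 1) \<Longrightarrow> integral\<^sup>L \<nu> F = mean F"
    and process: "heap_process_from_empty m Pr W"
  shows "(\<lambda>n. tv_dist
      (distr Pr (count_space (roof_configs m l)) (\<lambda>\<omega>. top_roofs l (roof_seq m (W n \<omega>))))
      (distr \<nu> (count_space (roof_configs m l)) (top_roofs l))) \<longlonglongrightarrow> 0"
proof -
  let ?R = "roof_configs m l"
  obtain C where Pr: "prob_space Pr" and indep: "prob_space.indep_vars Pr (\<lambda>_. choice_measure m) C UNIV"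
    and law: "\<And>n. distr Pr (choice_measure m) (C n) = choice_measure m"
    and W: "\<forall>\<omega>\<in>space Pr. W 0 \<omega> = {} \<and> (\<forall>n. W (Suc n) \<omega> = drop_piece m (C n \<omega>) (W n \<omega>))"
    using process unfolding heap_process_from_empty_def by blast
  interpret Pr: prob_space Pr by (rule Pr)
  interpret \<nu>: prob_space \<nu> by (rule \<nu>(1))
  have sp: "space \<nu> = gen_heaps m" using sets_eq_imp_space_eq[OF \<nu>(2)] by (simp add: space_heap_space)
  have meas: "C n \<in> measurable Pr (choice_measure m)" for n
    using indep unfolding Pr.indep_vars_def by simp
  have Cc: "C n \<omega> \<in> choices" if "\<omega> \<in> space Pr" for n \<omega>
    using measurable_space[OF meas that] by (simp add: choice_measure_eq space_uniform_count_measure)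
  have heap: "finite_heap m (W n \<omega>)" if "\<omega> \<in> space Pr" for n \<omega>
    by (rule process_heap(1)[OF W Cc that])
  note walk = process_walk[OF Pr indep law W]
  let ?F = "\<lambda>A W. indicator A (top_roofs l W) :: real"
  have dep: "depends l (?F A)" for A by (rule dependsI) simp
  have bnd: "0 \<le> ?F A W \<and> ?F A W \<le> 1" for A W by (simp add: indicator_def)
  have m1: "(\<lambda>\<omega>. top_roofs l (roof_seq m (W n \<omega>))) \<in> measurable Pr (count_space ?R)" for n
    unfolding measurable_count_space_eq2[OF finite_roof_configs]
  proof (intro conjI ballI)
    show "(\<lambda>\<omega>. top_roofs l (roof_seq m (W n \<omega>))) \<in> space Pr \<rightarrow> ?R"
      using heap by (auto simp: roof_configs_def)
    fix \<phi>
    have "(\<lambda>\<omega>. top_roofs l (roof_seq m (W n \<omega>))) -` {\<phi>} \<inter> space Pr =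
        {\<omega> \<in> space Pr. top_roofs l (roof_seq m (W n \<omega>)) = \<phi>}" by auto
    then show "(\<lambda>\<omega>. top_roofs l (roof_seq m (W n \<omega>))) -` {\<phi>} \<inter> space Pr \<in> sets Pr"
      using walk[of "\<lambda>V. top_roofs l (roof_seq m V) = \<phi>" n] by simp
  qed
  have m2: "top_roofs l \<in> measurable \<nu> (count_space ?R)"
    unfolding measurable_count_space_eq2[OF finite_roof_configs]
  proof (intro conjI ballI)
    show "top_roofs l \<in> space \<nu> \<rightarrow> ?R" using top_roofs_mem_roof_configs by (auto simp: sp)
    fix \<phi>
    have "top_roofs l -` {\<phi>} \<inter> space \<nu> = {W \<in> gen_heaps m. top_roofs l W \<in> {\<phi>}}" by (auto simp: sp)
    then show "top_roofs l -` {\<phi>} \<inter> space \<nu> \<in> sets \<nu>"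
      using cylinder_sets[OF cylinder_preimage[of l "{\<phi>}"]] by (simp add: \<nu>(2))
  qed
  have e1: "measure (distr Pr (count_space ?R) (\<lambda>\<omega>. top_roofs l (roof_seq m (W n \<omega>)))) A =
      gen_walk n (?F A) no_roofs" if A: "A \<subseteq> ?R" for A n
  proof -
    have "measure (distr Pr (count_space ?R) (\<lambda>\<omega>. top_roofs l (roof_seq m (W n \<omega>)))) A =
        measure Pr ((\<lambda>\<omega>. top_roofs l (roof_seq m (W n \<omega>))) -` A \<inter> space Pr)"
      by (rule measure_distr[OF m1]) (simp add: A)
    also have "(\<lambda>\<omega>. top_roofs l (roof_seq m (W n \<omega>))) -` A \<inter> space Pr =
        {\<omega> \<in> space Pr. top_roofs l (roof_seq m (W n \<omega>)) \<in> A}" by auto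
    also have "measure Pr \<dots> = walk (drop_piece m) n (\<lambda>V. of_bool (top_roofs l (roof_seq m V) \<in> A)) {}"
      using walk[of "\<lambda>V. top_roofs l (roof_seq m V) \<in> A" n] by simp
    also have "\<dots> = gen_walk n (?F A) no_roofs"
      unfolding walk_roof_seq[OF heap_empty] by (simp add: indicator_def of_bool_def)
    finally show ?thesis .
  qed
  have e2: "measure (distr \<nu> (count_space ?R) (top_roofs l)) A = mean (?F A)" if A: "A \<subseteq> ?R" for A
  proof -
    have "measure (distr \<nu> (count_space ?R) (top_roofs l)) A = \<nu>.prob (top_roofs l -` A \<inter> space \<nu>)"
      by (rule measure_distr[OF m2]) (simp add: A)
    also have "\<dots> = integral\<^sup>L \<nu> (indicator (top_roofs l -` A \<inter> space \<nu>))" by simp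
    also have "\<dots> = integral\<^sup>L \<nu> (?F A)"
      by (rule Bochner_Integration.integral_cong) (auto simp: indicator_def)
    also have "\<dots> = mean (?F A)" by (rule int[OF dep bnd])
    finally show ?thesis .
  qed
  obtain K \<rho> :: real where \<rho>: "0 < \<rho>" "\<rho> < 1" and bound:
    "\<And>n F W. depends l F \<Longrightarrow> (\<And>W. W \<in> gen_heaps m \<Longrightarrow> 0 \<le> F W \<and> F W \<le> 1) \<Longrightarrow>
      W \<in> gen_heaps m \<Longrightarrow> \<bar>gen_walk n F W - mean F\<bar> \<le> K * \<rho> ^ n"
    by (rule walk_mean[of l]) blast
  let ?tv = "\<lambda>n. tv_dist
      (distr Pr (count_space ?R) (\<lambda>\<omega>. top_roofs l (roof_seq m (W n \<omega>))))
      (distr \<nu> (count_space ?R) (top_roofs l))"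
  \<comment> \<open>The same bound for every set \<open>A\<close> of configurations, because
    \<open>K\<close> and \<rho> were obtained for all \<open>F\<close> at once; hence it passes to
    the supremum.\<close>
  have le: "\<bar>measure (distr Pr (count_space ?R) (\<lambda>\<omega>. top_roofs l (roof_seq m (W n \<omega>)))) A -
      measure (distr \<nu> (count_space ?R) (top_roofs l)) A\<bar> \<le> K * \<rho> ^ n" if "A \<in> Pow ?R" for A n
    using that bound[OF dep bnd no_roofs_mem] by (simp add: e1 e2)
  have "norm (?tv n) \<le> K * \<rho> ^ n" for n
  proof -
    have "?tv n \<le> K * \<rho> ^ n"
      unfolding tv_dist_def by (rule cSUP_least) (use le in auto)
    moreover have "0 \<le> ?tv n"
      unfolding tv_dist_def
    proof (rule cSUP_upper2[where x = "{}"])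
      show "bdd_above ((\<lambda>A. \<bar>measure (distr Pr (count_space ?R) (\<lambda>\<omega>. top_roofs l (roof_seq m (W n \<omega>)))) A -
          measure (distr \<nu> (count_space ?R) (top_roofs l)) A\<bar>) `
          sets (distr Pr (count_space ?R) (\<lambda>\<omega>. top_roofs l (roof_seq m (W n \<omega>)))))"
        by (rule bdd_aboveI2[where M = "K * \<rho> ^ n"]) (use le in simp)
    qed simp_all
    ultimately show ?thesis by simp
  qed
  moreover have "(\<lambda>n. K * \<rho> ^ n) \<longlonglongrightarrow> 0"
    using \<rho> by (intro tendsto_mult_right_zero LIMSEQ_realpow_zero) simp_all
  ultimately show ?thesis by (intro Lim_null_comparison[of ?tv]) simp_all
qed

end

theorem mainTheorem3:
  fixes m :: nat
  assumes "m \<ge> 4"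
  shows "\<exists>\<nu>. stationary m \<nu> \<and> (\<forall>\<nu>'. stationary m \<nu>' \<longrightarrow> \<nu>' = \<nu>) \<and>
     (\<forall>(Pr :: 'a measure) W l. heap_process_from_empty m Pr W \<longrightarrow> 1 \<le> l \<longrightarrow>
        (\<lambda>n. tv_dist
           (distr Pr (count_space (roof_configs m l)) (\<lambda>\<omega>. top_roofs l (roof_seq m (W n \<omega>))))
           (distr \<nu> (count_space (roof_configs m l)) (top_roofs l)))
        \<longlonglongrightarrow> 0)"
proof -
  interpret columns m by unfold_locales (use assms in simp)
  obtain \<nu> where st: "stationary m \<nu>" and uniq: "\<And>\<nu>'. stationary m \<nu>' \<Longrightarrow> \<nu>' = \<nu>"
    and int: "\<And>l F. depends l F \<Longrightarrow> (\<And>W. W \<in> gen_heaps m \<Longrightarrow> 0 \<le> F W \<and> F W \<le> 1) \<Longrightarrow>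
      integral\<^sup>L \<nu> F = mean F"
    by (rule unique_stationary) blast
  have \<nu>: "prob_space \<nu>" "sets \<nu> = sets (heap_space m)" using st by (simp_all add: stationary_def)
  have "(\<lambda>n. tv_dist
      (distr Pr (count_space (roof_configs m l)) (\<lambda>\<omega>. top_roofs l (roof_seq m (W n \<omega>))))
      (distr \<nu> (count_space (roof_configs m l)) (top_roofs l))) \<longlonglongrightarrow> 0"
    if process: "heap_process_from_empty m Pr W" for Pr :: "'a measure" and W l
  proof (rule total_variation_convergence[OF \<nu> _ process])
    show "integral\<^sup>L \<nu> F = mean F"
      if "depends l F" "\<And>W. W \<in> gen_heaps m \<Longrightarrow> 0 \<le> F W \<and> F W \<le> 1" for F
      by (rule int[OF that])
  qed
  then show ?thesis using st uniq by blast
qed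

end
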